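(* Let $\mathbf k$ be an algebraically closed field, $\mathcal C$ a finite tensor category over $\mathbf k$, $\mathcal M$ a finite semisimple indecomposable left $\mathcal C$-module category, and $a$ a pivotal structure on $\mathcal C$. Then $a$ is matched to $\mathcal M$ if and only if $\mathcal M$ admits a nonzero module trace with respect to $a$. In this case, the module trace is unique up to scaling.
   Context: Duals: $X^*$ has $\mathrm{coev}_X:\mathbf 1\to X\otimes X^*$ and $\mathrm{ev}_X:X^*\otimes X\to\mathbf 1$. A pivotal structure is a tensor isomorphism $a:\mathrm{Id}\to **$. Matched: let $F:\mathcal C\to\mathrm{End}\,\mathcal M$ be the tensor functor given by the action. For $V\in\mathrm{End}\,\mathcal M$ identify $V^{**}$ with $V$ naturally (writing $\mathcal M=A\text{-mod}$ with $A=\bigoplus_{i\in I}\mathbf k$, $I$ labeling the simple objects $M_i$, this is the usual double dual of $A$-bimodules). Then $F(X^{**})\cong F(X)^{**}\cong F(X)$, i.e. $X^{**}\otimes M=X\otimes M$ canonically, and $a\otimes1:X\otimes M\to X^{**}\otimes M=X\otimes M$ is a $\mathcal C$-module functor structure on the identity functor of $\mathcal M$. This gives an invertible object $\chi(a,\mathcal M)$ of $\mathcal C_{\mathcal M}^*=\mathrm{Fun}_{\mathcal C}(\mathcal M,\mathcal M)$, and $a$ is matched to $\mathcal M$ if $\chi(a,\mathcal M)=\mathbf 1$. Module trace: for $\mathbf m=(m_i)_{i\in I}$ with $m_i\in\mathbf k$, and an endomorphism $f:M\to M$ in $\mathcal M$, put $\mathrm{Tr}^{\mathbf m}_M(f)=\sum_{i\in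 I}m_i\,\mathrm{Tr}(f|_{\mathrm{Hom}(M_i,M)})$. Then $\mathrm{Tr}^{\mathbf m}$ is a module trace on $\mathcal M$ with respect to $a$ if for all $X\in\mathcal C$, $M\in\mathcal M$ and $f:X\otimes M\to X\otimes M$ one has $\mathrm{Tr}^{\mathbf m}_{X\otimes M}(f)=\mathrm{Tr}^{\mathbf m}_M(\mathrm{Tr}_X(f))$, where $\mathrm{Tr}_X(f):M\to M$ is the partial trace obtained by composing $\mathrm{coev}_X\otimes1:M\to X\otimes X^*\otimes M$, the map $X\otimes X^*\otimes M\to X^{**}\otimes X^*\otimes M$ given by $f$ (on $X$ and $M$) and $a_X$, and $\mathrm{ev}_{X^*}\otimes1:X^{**}\otimes X^*\otimes M\to M$.
   Formalization: The composite given for Tr_X(f) is undefined, since X* stands between X and M where f should act; Tr_X(f) is taken instead as the left partial trace M → X*⊗X**⊗M → X*⊗X⊗M → X*⊗X⊗M → M built from coev of X*, the inverse of a_X, f, and ev_X. *)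

theory Defs
  imports "HOL-Computational_Algebra.Polynomial"
begin

section \<open>Trace of an endomorphism of a finite-dimensional subspace\<close>

context vector_space
begin

definition trace_on :: "'b set \<Rightarrow> ('b \<Rightarrow> 'b) \<Rightarrow> 'a" where
  "trace_on V T =
     (let B = (SOME B. B \<subseteq> V \<and> independent B \<and> span B = V)
      in \<Sum>b\<in>B. representation B (T b) b)"

end


section \<open>Linear and abelian categories\<close>

text \<open>
  The objects are all elements of the type \<open>'o\<close>. All morphism spaces are subspaces of one vector
  space \<open>'a\<close>. Every small \<open>'k\<close>-linear category has this form: take for \<open>'a\<close> the direct sum of all
  the spaces \<open>Hom(X,Y)\<close>. For this reason composition (and later the tensor product of morphisms)
  does not need source and target as arguments. Its values are constrained only on composable
  pairs. The morphism spaces need not be disjoint (they share 0); notions that depend on source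
  and target, such as being mono, take them as arguments.
\<close>

record ('k, 'o, 'a) lcat =
  Hom :: "'o \<Rightarrow> 'o \<Rightarrow> 'a set"
  cmp :: "'a \<Rightarrow> 'a \<Rightarrow> 'a" (infixr "\<cdot>\<index>" 55)
  idm :: "'o \<Rightarrow> 'a"
  scl :: "'k \<Rightarrow> 'a \<Rightarrow> 'a"

locale linear_category = vector_space "scl C"
  for C :: "('k::field, 'o, 'a::ab_group_add, 'z) lcat_scheme" (structure) +
  assumes Hom_subspace: "subspace (Hom C X Y)"
    and id_in: "idm C X \<in> Hom C X X"
    and cmp_in: "\<lbrakk>f \<in> Hom C X Y; g \<in> Hom C Y Z\<rbrakk> \<Longrightarrow> g \<cdot> f \<in> Hom C X Z"
    and id_left: "f \<in> Hom C X Y \<Longrightarrow> idm C Y \<cdot> f = f"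
    and id_right: "f \<in> Hom C X Y \<Longrightarrow> f \<cdot> idm C X = f"
    and cmp_assoc: "\<lbrakk>f \<in> Hom C W X; g \<in> Hom C X Y; h \<in> Hom C Y Z\<rbrakk>
        \<Longrightarrow> (h \<cdot> g) \<cdot> f = h \<cdot> (g \<cdot> f)"
    and cmp_add_left: "\<lbrakk>f \<in> Hom C X Y; g \<in> Hom C Y Z; g' \<in> Hom C Y Z\<rbrakk>
        \<Longrightarrow> (g + g') \<cdot> f = (g \<cdot> f) + (g' \<cdot> f)"
    and cmp_add_right: "\<lbrakk>f \<in> Hom C X Y; f' \<in> Hom C X Y; g \<in> Hom C Y Z\<rbrakk>
        \<Longrightarrow> g \<cdot> (f + f') = (g \<cdot> f) + (g \<cdot> f')"
    and cmp_scl_left: "\<lbrakk>f \<in> Hom C X Y; g \<in> Hom C Y Z\<rbrakk>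
        \<Longrightarrow> (scl C c g) \<cdot> f = scl C c (g \<cdot> f)"
    and cmp_scl_right: "\<lbrakk>f \<in> Hom C X Y; g \<in> Hom C Y Z\<rbrakk>
        \<Longrightarrow> g \<cdot> (scl C c f) = scl C c (g \<cdot> f)"

context
  fixes C :: "('k::field, 'o, 'a::ab_group_add, 'z) lcat_scheme" (structure)
begin

definition is_zero_obj :: "'o \<Rightarrow> bool" where
  "is_zero_obj Z \<longleftrightarrow> (\<forall>X. Hom C Z X = {0} \<and> Hom C X Z = {0})"

definition inverses :: "'o \<Rightarrow> 'o \<Rightarrow> 'a \<Rightarrow> 'a \<Rightarrow> bool" where
  "inverses X Y f g \<longleftrightarrow>
     f \<in> Hom C X Y \<and> g \<in> Hom C Y X \<and> g \<cdot> f = idm C X \<and> f \<cdot> g = idm C Y"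

definition is_iso :: "'o \<Rightarrow> 'o \<Rightarrow> 'a \<Rightarrow> bool" where
  "is_iso X Y f \<longleftrightarrow> (\<exists>g. inverses X Y f g)"

definition inv_arr :: "'o \<Rightarrow> 'o \<Rightarrow> 'a \<Rightarrow> 'a" where
  "inv_arr X Y f = (THE g. inverses X Y f g)"

definition isomorphic :: "'o \<Rightarrow> 'o \<Rightarrow> bool" where
  "isomorphic X Y \<longleftrightarrow> (\<exists>f. is_iso X Y f)"

definition is_mono :: "'o \<Rightarrow> 'o \<Rightarrow> 'a \<Rightarrow> bool" where
  "is_mono X Y f \<longleftrightarrow> f \<in> Hom C X Y \<and>
     (\<forall>W. \<forall>g\<in>Hom C W X. \<forall>h\<in>Hom C W X. f \<cdot> g = f \<cdot> h \<longrightarrow> g = h)"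

definition is_epi :: "'o \<Rightarrow> 'o \<Rightarrow> 'a \<Rightarrow> bool" where
  "is_epi X Y f \<longleftrightarrow> f \<in> Hom C X Y \<and>
     (\<forall>Z. \<forall>g\<in>Hom C Y Z. \<forall>h\<in>Hom C Y Z. g \<cdot> f = h \<cdot> f \<longrightarrow> g = h)"

text \<open>\<open>k : K \<rightarrow> X\<close> is a kernel of \<open>f : X \<rightarrow> Y\<close>; \<open>q : Y \<rightarrow> Q\<close> is a cokernel of \<open>f : X \<rightarrow> Y\<close>.\<close>

definition is_kernel :: "'o \<Rightarrow> 'o \<Rightarrow> 'o \<Rightarrow> 'a \<Rightarrow> 'a \<Rightarrow> bool" where
  "is_kernel K X Y k f \<longleftrightarrow>
     k \<in> Hom C K X \<and> f \<in> Hom C X Y \<and> f \<cdot> k = 0 \<and>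
     (\<forall>W. \<forall>g\<in>Hom C W X. f \<cdot> g = 0 \<longrightarrow> (\<exists>!h. h \<in> Hom C W K \<and> k \<cdot> h = g))"

definition is_cokernel :: "'o \<Rightarrow> 'o \<Rightarrow> 'o \<Rightarrow> 'a \<Rightarrow> 'a \<Rightarrow> bool" where
  "is_cokernel X Y Q f q \<longleftrightarrow>
     f \<in> Hom C X Y \<and> q \<in> Hom C Y Q \<and> q \<cdot> f = 0 \<and>
     (\<forall>W. \<forall>g\<in>Hom C Y W. g \<cdot> f = 0 \<longrightarrow> (\<exists>!h. h \<in> Hom C Q W \<and> h \<cdot> q = g))"

definition short_exact :: "'o \<Rightarrow> 'o \<Rightarrow> 'o \<Rightarrow> 'a \<Rightarrow> 'a \<Rightarrow> bool" where
  "short_exact X Y Z i p \<longleftrightarrow> is_kernel X Y Z i p \<and> is_cokernel X Y Z i p"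

text \<open>\<open>Y\<close> is the direct sum of \<open>Xs 0, \<dots>, Xs (n - 1)\<close> with inclusions \<open>i j\<close> and projections \<open>p j\<close>.\<close>

definition direct_sum :: "'o \<Rightarrow> nat \<Rightarrow> (nat \<Rightarrow> 'o) \<Rightarrow> (nat \<Rightarrow> 'a) \<Rightarrow> (nat \<Rightarrow> 'a) \<Rightarrow> bool" where
  "direct_sum Y n Xs i p \<longleftrightarrow>
     (\<forall>j<n. i j \<in> Hom C (Xs j) Y \<and> p j \<in> Hom C Y (Xs j)) \<and>
     (\<forall>j<n. \<forall>l<n. p j \<cdot> i l = (if j = l then idm C (Xs j) else 0)) \<and>
     (\<Sum>j<n. i j \<cdot> p j) = idm C Y"

definition is_direct_sum :: "'o \<Rightarrow> nat \<Rightarrow> (nat \<Rightarrow> 'o) \<Rightarrow> bool" where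
  "is_direct_sum Y n Xs \<longleftrightarrow> (\<exists>i p. direct_sum Y n Xs i p)"

definition is_simple :: "'o \<Rightarrow> bool" where
  "is_simple X \<longleftrightarrow> \<not> is_zero_obj X \<and>
     (\<forall>W f. is_mono W X f \<longrightarrow> is_zero_obj W \<or> is_iso W X f)"

inductive finite_length :: "'o \<Rightarrow> bool" where
  zero: "is_zero_obj X \<Longrightarrow> finite_length X"
| extend: "\<lbrakk>finite_length Y; short_exact Y X S i p; is_simple S\<rbrakk> \<Longrightarrow> finite_length X"

definition is_projective :: "'o \<Rightarrow> bool" where
  "is_projective P \<longleftrightarrow>
     (\<forall>X Y e. \<forall>g\<in>Hom C P Y. is_epi X Y e \<longrightarrow> (\<exists>h\<in>Hom C P X. e \<cdot> h = g))"

text \<open>A complete list of pairwise non-isomorphic simple objects \<open>S i\<close>, indexed by \<open>i \<in> I\<close>.\<close>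

definition simple_representatives :: "'i set \<Rightarrow> ('i \<Rightarrow> 'o) \<Rightarrow> bool" where
  "simple_representatives I S \<longleftrightarrow>
     (\<forall>i\<in>I. is_simple (S i)) \<and>
     (\<forall>i\<in>I. \<forall>j\<in>I. isomorphic (S i) (S j) \<longrightarrow> i = j) \<and>
     (\<forall>X. is_simple X \<longrightarrow> (\<exists>i\<in>I. isomorphic X (S i)))"

text \<open>The \<open>c\<close> with \<open>e = c id\<^sub>X\<close>, for an endomorphism \<open>e\<close> of an object with \<open>End(X) = k\<close>.\<close>

definition scalar_of :: "'o \<Rightarrow> 'a \<Rightarrow> 'k" where
  "scalar_of X e = (THE c. e = scl C c (idm C X))"

end

locale abelian_category = linear_category +
  assumes zero_obj: "\<exists>Z. is_zero_obj C Z"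
    and biproducts: "\<exists>Y. is_direct_sum C Y 2 (\<lambda>j. if j = 0 then X1 else X2)"
    and kernels: "f \<in> Hom C X Y \<Longrightarrow> \<exists>K k. is_kernel C K X Y k f"
    and cokernels: "f \<in> Hom C X Y \<Longrightarrow> \<exists>Q q. is_cokernel C X Y Q f q"
    and mono_is_kernel: "is_mono C X Y f \<Longrightarrow> \<exists>Z g. is_kernel C X Y Z f g"
    and epi_is_cokernel: "is_epi C X Y f \<Longrightarrow> \<exists>W g. is_cokernel C W X Y g f"

locale finite_abelian_category = abelian_category +
  assumes Hom_finite_dim: "\<exists>B. finite B \<and> span B = Hom C X Y"
    and finite_length: "finite_length C X"
    and enough_projectives: "\<exists>P e. is_projective C P \<and> is_epi C P X e"
    and finitely_many_simples:
      "\<exists>F. finite F \<and> (\<forall>X. is_simple C X \<longrightarrow> (\<exists>Y\<in>F. isomorphic C X Y))"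

locale finite_semisimple_category = finite_abelian_category +
  assumes semisimple: "\<exists>n Xs. (\<forall>j<n. is_simple C (Xs j)) \<and> is_direct_sum C X n Xs"


section \<open>Finite tensor categories\<close>

text \<open>
  \<open>asc X Y Z : (X \<otimes> Y) \<otimes> Z \<rightarrow> X \<otimes> (Y \<otimes> Z)\<close>, \<open>lun X : 1 \<otimes> X \<rightarrow> X\<close>, \<open>run X : X \<otimes> 1 \<rightarrow> X\<close>. The fields \<open>dual\<close>, \<open>ev\<close>
  and \<open>coev\<close> are a choice of left duals, \<open>ev X : X* \<otimes> X \<rightarrow> 1\<close> and \<open>coev X : 1 \<rightarrow> X \<otimes> X*\<close>.
\<close>

record ('k, 'o, 'a) tensor_cat = "('k, 'o, 'a) lcat" +
  tob :: "'o \<Rightarrow> 'o \<Rightarrow> 'o" (infixr "\<otimes>\<index>" 70)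
  tar :: "'a \<Rightarrow> 'a \<Rightarrow> 'a" (infixr "\<boxtimes>\<index>" 70)
  unt :: "'o" ("\<one>\<index>")
  asc :: "'o \<Rightarrow> 'o \<Rightarrow> 'o \<Rightarrow> 'a"
  lun :: "'o \<Rightarrow> 'a"
  run :: "'o \<Rightarrow> 'a"
  dual :: "'o \<Rightarrow> 'o"
  ev :: "'o \<Rightarrow> 'a"
  coev :: "'o \<Rightarrow> 'a"

context
  fixes C :: "('k::field, 'o, 'a::ab_group_add, 'z) tensor_cat_scheme" (structure)
begin

definition inv_asc :: "'o \<Rightarrow> 'o \<Rightarrow> 'o \<Rightarrow> 'a" where
  "inv_asc X Y Z = inv_arr C ((X \<otimes> Y) \<otimes> Z) (X \<otimes> (Y \<otimes> Z)) (asc C X Y Z)"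

definition inv_lun :: "'o \<Rightarrow> 'a" where
  "inv_lun X = inv_arr C (\<one> \<otimes> X) X (lun C X)"

definition inv_run :: "'o \<Rightarrow> 'a" where
  "inv_run X = inv_arr C (X \<otimes> \<one>) X (run C X)"

text \<open>\<open>Y\<close> is a left dual of \<open>X\<close>, equivalently \<open>X\<close> is a right dual of \<open>Y\<close>.\<close>

definition is_left_dual :: "'o \<Rightarrow> 'o \<Rightarrow> 'a \<Rightarrow> 'a \<Rightarrow> bool" where
  "is_left_dual Y X e c \<longleftrightarrow>
     e \<in> Hom C (Y \<otimes> X) \<one> \<and> c \<in> Hom C \<one> (X \<otimes> Y) \<and>
     run C X \<cdot> (idm C X \<boxtimes> e) \<cdot> asc C X Y X \<cdot> (c \<boxtimes> idm C X) \<cdot> inv_lun X = idm C X \<and>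
     lun C Y \<cdot> (e \<boxtimes> idm C Y) \<cdot> inv_asc Y X Y \<cdot> (idm C Y \<boxtimes> c) \<cdot> inv_run Y = idm C Y"

text \<open>The morphism \<open>W \<rightarrow> Z*\<close> that corresponds to a pairing \<open>p : W \<otimes> Z \<rightarrow> 1\<close>.\<close>

definition mate :: "'o \<Rightarrow> 'o \<Rightarrow> 'a \<Rightarrow> 'a" where
  "mate W Z p =
     lun C (dual C Z) \<cdot> (p \<boxtimes> idm C (dual C Z)) \<cdot> inv_asc W Z (dual C Z)
       \<cdot> (idm C W \<boxtimes> coev C Z) \<cdot> inv_run W"

text \<open>\<open>f* : Y* \<rightarrow> X*\<close> for \<open>f : X \<rightarrow> Y\<close>.\<close>

definition dual_arr :: "'o \<Rightarrow> 'o \<Rightarrow> 'a \<Rightarrow> 'a" where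
  "dual_arr X Y f = mate (dual C Y) X (ev C Y \<cdot> (idm C (dual C Y) \<boxtimes> f))"

definition ddual :: "'o \<Rightarrow> 'o" where
  "ddual X = dual C (dual C X)"

definition ddual_arr :: "'o \<Rightarrow> 'o \<Rightarrow> 'a \<Rightarrow> 'a" where
  "ddual_arr X Y f = dual_arr (dual C Y) (dual C X) (dual_arr X Y f)"

text \<open>The canonical isomorphism \<open>Y* \<otimes> X* \<rightarrow> (X \<otimes> Y)*\<close>.\<close>

definition dual_tensor :: "'o \<Rightarrow> 'o \<Rightarrow> 'a" where
  "dual_tensor X Y =
     mate (dual C Y \<otimes> dual C X) (X \<otimes> Y)
       (ev C Y
         \<cdot> (idm C (dual C Y) \<boxtimes> lun C Y)
         \<cdot> (idm C (dual C Y) \<boxtimes> (ev C X \<boxtimes> idm C Y))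
         \<cdot> (idm C (dual C Y) \<boxtimes> inv_asc (dual C X) X Y)
         \<cdot> asc C (dual C Y) (dual C X) (X \<otimes> Y))"

text \<open>The tensor structure \<open>X** \<otimes> Y** \<rightarrow> (X \<otimes> Y)**\<close> of the functor \<open>**\<close>.\<close>

definition ddual_tensor :: "'o \<Rightarrow> 'o \<Rightarrow> 'a" where
  "ddual_tensor X Y =
     inv_arr C (ddual (X \<otimes> Y)) (dual C (dual C Y \<otimes> dual C X))
         (dual_arr (dual C Y \<otimes> dual C X) (dual C (X \<otimes> Y)) (dual_tensor X Y))
       \<cdot> dual_tensor (dual C Y) (dual C X)"

definition pivotal_structure :: "('o \<Rightarrow> 'a) \<Rightarrow> bool" where
  "pivotal_structure a \<longleftrightarrow>
     (\<forall>X. is_iso C X (ddual X) (a X)) \<and>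
     (\<forall>X Y. \<forall>f\<in>Hom C X Y. a Y \<cdot> f = ddual_arr X Y f \<cdot> a X) \<and>
     (\<forall>X Y. a (X \<otimes> Y) = ddual_tensor X Y \<cdot> (a X \<boxtimes> a Y))"

end

locale finite_tensor_category = finite_abelian_category C
  for C :: "('k::field, 'o, 'a::ab_group_add, 'z) tensor_cat_scheme" (structure) +
  assumes tar_in: "\<lbrakk>f \<in> Hom C X X'; g \<in> Hom C Y Y'\<rbrakk> \<Longrightarrow> f \<boxtimes> g \<in> Hom C (X \<otimes> Y) (X' \<otimes> Y')"
    and tar_id: "idm C X \<boxtimes> idm C Y = idm C (X \<otimes> Y)"
    and tar_cmp: "\<lbrakk>f \<in> Hom C X X'; f' \<in> Hom C X' X''; g \<in> Hom C Y Y'; g' \<in> Hom C Y' Y''\<rbrakk>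
        \<Longrightarrow> (f' \<cdot> f) \<boxtimes> (g' \<cdot> g) = (f' \<boxtimes> g') \<cdot> (f \<boxtimes> g)"
    and tar_add_left: "\<lbrakk>f \<in> Hom C X X'; f' \<in> Hom C X X'; g \<in> Hom C Y Y'\<rbrakk>
        \<Longrightarrow> (f + f') \<boxtimes> g = (f \<boxtimes> g) + (f' \<boxtimes> g)"
    and tar_add_right: "\<lbrakk>f \<in> Hom C X X'; g \<in> Hom C Y Y'; g' \<in> Hom C Y Y'\<rbrakk>
        \<Longrightarrow> f \<boxtimes> (g + g') = (f \<boxtimes> g) + (f \<boxtimes> g')"
    and tar_scl_left: "\<lbrakk>f \<in> Hom C X X'; g \<in> Hom C Y Y'\<rbrakk>
        \<Longrightarrow> (scl C c f) \<boxtimes> g = scl C c (f \<boxtimes> g)"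
    and tar_scl_right: "\<lbrakk>f \<in> Hom C X X'; g \<in> Hom C Y Y'\<rbrakk>
        \<Longrightarrow> f \<boxtimes> (scl C c g) = scl C c (f \<boxtimes> g)"
    and asc_iso: "is_iso C ((X \<otimes> Y) \<otimes> Z) (X \<otimes> (Y \<otimes> Z)) (asc C X Y Z)"
    and asc_natural: "\<lbrakk>f \<in> Hom C X X'; g \<in> Hom C Y Y'; h \<in> Hom C Z Z'\<rbrakk>
        \<Longrightarrow> asc C X' Y' Z' \<cdot> ((f \<boxtimes> g) \<boxtimes> h) = (f \<boxtimes> (g \<boxtimes> h)) \<cdot> asc C X Y Z"
    and lun_iso: "is_iso C (\<one> \<otimes> X) X (lun C X)"
    and lun_natural: "f \<in> Hom C X Y \<Longrightarrow> lun C Y \<cdot> (idm C \<one> \<boxtimes> f) = f \<cdot> lun C X"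
    and run_iso: "is_iso C (X \<otimes> \<one>) X (run C X)"
    and run_natural: "f \<in> Hom C X Y \<Longrightarrow> run C Y \<cdot> (f \<boxtimes> idm C \<one>) = f \<cdot> run C X"
    and pentagon: "asc C W X (Y \<otimes> Z) \<cdot> asc C (W \<otimes> X) Y Z =
        (idm C W \<boxtimes> asc C X Y Z) \<cdot> asc C W (X \<otimes> Y) Z \<cdot> (asc C W X Y \<boxtimes> idm C Z)"
    and triangle: "(idm C X \<boxtimes> lun C Y) \<cdot> asc C X \<one> Y = run C X \<boxtimes> idm C Y"
    and End_unt: "f \<in> Hom C \<one> \<one> \<Longrightarrow> \<exists>!c. f = scl C c (idm C \<one>)"
    and left_dual: "is_left_dual C (dual C X) X (ev C X) (coev C X)"
    and right_dual: "\<exists>Y e c. is_left_dual C X Y e c"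


section \<open>Module categories and module functors\<close>

text \<open>\<open>mas X Y N : (X \<otimes> Y) \<rhd> N \<rightarrow> X \<rhd> (Y \<rhd> N)\<close> and \<open>mun N : 1 \<rhd> N \<rightarrow> N\<close>.\<close>

record ('k, 'o, 'a, 'p, 'b) mod_cat = "('k, 'p, 'b) lcat" +
  act :: "'o \<Rightarrow> 'p \<Rightarrow> 'p" (infixr "\<rhd>\<index>" 70)
  actm :: "'a \<Rightarrow> 'b \<Rightarrow> 'b" (infixr "\<unrhd>\<index>" 70)
  mas :: "'o \<Rightarrow> 'o \<Rightarrow> 'p \<Rightarrow> 'b"
  mun :: "'p \<Rightarrow> 'b"

locale module_category = C: finite_tensor_category C + M: finite_abelian_category M
  for C :: "('k::field, 'o, 'a::ab_group_add, 'z) tensor_cat_scheme"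
    and M :: "('k, 'o, 'a, 'p, 'b::ab_group_add, 'y) mod_cat_scheme" (structure) +
  assumes actm_in: "\<lbrakk>f \<in> Hom C X X'; h \<in> Hom M N N'\<rbrakk> \<Longrightarrow> f \<unrhd> h \<in> Hom M (X \<rhd> N) (X' \<rhd> N')"
    and actm_id: "idm C X \<unrhd> idm M N = idm M (X \<rhd> N)"
    and actm_cmp: "\<lbrakk>f \<in> Hom C X X'; f' \<in> Hom C X' X''; h \<in> Hom M N N'; h' \<in> Hom M N' N''\<rbrakk>
        \<Longrightarrow> (f' \<cdot>\<^bsub>C\<^esub> f) \<unrhd> (h' \<cdot> h) = (f' \<unrhd> h') \<cdot> (f \<unrhd> h)"
    and actm_add_left: "\<lbrakk>f \<in> Hom C X X'; f' \<in> Hom C X X'; h \<in> Hom M N N'\<rbrakk>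
        \<Longrightarrow> (f + f') \<unrhd> h = (f \<unrhd> h) + (f' \<unrhd> h)"
    and actm_add_right: "\<lbrakk>f \<in> Hom C X X'; h \<in> Hom M N N'; h' \<in> Hom M N N'\<rbrakk>
        \<Longrightarrow> f \<unrhd> (h + h') = (f \<unrhd> h) + (f \<unrhd> h')"
    and actm_scl_left: "\<lbrakk>f \<in> Hom C X X'; h \<in> Hom M N N'\<rbrakk>
        \<Longrightarrow> (scl C c f) \<unrhd> h = scl M c (f \<unrhd> h)"
    and actm_scl_right: "\<lbrakk>f \<in> Hom C X X'; h \<in> Hom M N N'\<rbrakk>
        \<Longrightarrow> f \<unrhd> (scl M c h) = scl M c (f \<unrhd> h)"
    and mas_iso: "is_iso M ((X \<otimes>\<^bsub>C\<^esub> Y) \<rhd> N) (X \<rhd> (Y \<rhd> N)) (mas M X Y N)"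
    and mas_natural: "\<lbrakk>f \<in> Hom C X X'; g \<in> Hom C Y Y'; h \<in> Hom M N N'\<rbrakk>
        \<Longrightarrow> mas M X' Y' N' \<cdot> ((f \<boxtimes>\<^bsub>C\<^esub> g) \<unrhd> h) = (f \<unrhd> (g \<unrhd> h)) \<cdot> mas M X Y N"
    and mun_iso: "is_iso M (\<one>\<^bsub>C\<^esub> \<rhd> N) N (mun M N)"
    and mun_natural: "h \<in> Hom M N N' \<Longrightarrow> mun M N' \<cdot> (idm C \<one>\<^bsub>C\<^esub> \<unrhd> h) = h \<cdot> mun M N"
    and mod_pentagon: "mas M X Y (Z \<rhd> N) \<cdot> mas M (X \<otimes>\<^bsub>C\<^esub> Y) Z N =
        (idm C X \<unrhd> mas M Y Z N) \<cdot> mas M X (Y \<otimes>\<^bsub>C\<^esub> Z) N \<cdot> (asc C X Y Z \<unrhd> idm M N)"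
    and mod_triangle: "(idm C X \<unrhd> mun M N) \<cdot> mas M X \<one>\<^bsub>C\<^esub> N = run C X \<unrhd> idm M N"
    and act_exact: "short_exact C X Y Z i p
        \<Longrightarrow> short_exact M (X \<rhd> N) (Y \<rhd> N) (Z \<rhd> N) (i \<unrhd> idm M N) (p \<unrhd> idm M N)"

text \<open>An endofunctor of a module category with its structure morphisms \<open>fstr X N : F(X \<rhd> N) \<rightarrow> X \<rhd> F(N)\<close>.\<close>

record ('o, 'p, 'b) mod_fun =
  fob :: "'p \<Rightarrow> 'p"
  far :: "'b \<Rightarrow> 'b"
  fstr :: "'o \<Rightarrow> 'p \<Rightarrow> 'b"

context
  fixes C :: "('k::field, 'o, 'a::ab_group_add, 'z) tensor_cat_scheme"
    and M :: "('k, 'o, 'a, 'p, 'b::ab_group_add, 'y) mod_cat_scheme" (structure)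
begin

text \<open>
  \<open>M\<close> is nonzero and is not the direct sum of two nonzero module subcategories. A decomposition of \<open>M\<close>
  as a direct sum of two module categories amounts to two full subcategories, with objects given by \<open>P\<close>
  and \<open>Q\<close>, that are stable under the action, have no nonzero morphisms between them in either
  direction, and together generate \<open>M\<close> under direct sums.
\<close>

definition indecomposable_module :: bool where
  "indecomposable_module \<longleftrightarrow>
     (\<exists>N. \<not> is_zero_obj M N) \<and>
     \<not> (\<exists>P Q :: 'p \<Rightarrow> bool.
          (\<exists>N. P N \<and> \<not> is_zero_obj M N) \<and> (\<exists>N. Q N \<and> \<not> is_zero_obj M N) \<and>
          (\<forall>X N. P N \<longrightarrow> P (X \<rhd> N)) \<and> (\<forall>X N. Q N \<longrightarrow> Q (X \<rhd> N)) \<and>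
          (\<forall>N L. P N \<and> Q L \<longrightarrow> Hom M N L = {0} \<and> Hom M L N = {0}) \<and>
          (\<forall>N. \<exists>N1 N2. P N1 \<and> Q N2 \<and>
             is_direct_sum M N 2 (\<lambda>j. if j = 0 then N1 else N2)))"

definition is_module_functor :: "('o, 'p, 'b) mod_fun \<Rightarrow> bool" where
  "is_module_functor F \<longleftrightarrow>
     (\<forall>N N'. \<forall>h\<in>Hom M N N'. far F h \<in> Hom M (fob F N) (fob F N')) \<and>
     (\<forall>N. far F (idm M N) = idm M (fob F N)) \<and>
     (\<forall>N N' N''. \<forall>h\<in>Hom M N N'. \<forall>h'\<in>Hom M N' N''. far F (h' \<cdot> h) = far F h' \<cdot> far F h) \<and>
     (\<forall>N N'. \<forall>h\<in>Hom M N N'. \<forall>h'\<in>Hom M N N'. far F (h + h') = far F h + far F h') \<and>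
     (\<forall>N N' c. \<forall>h\<in>Hom M N N'. far F (scl M c h) = scl M c (far F h)) \<and>
     (\<forall>X N. is_iso M (fob F (X \<rhd> N)) (X \<rhd> fob F N) (fstr F X N)) \<and>
     (\<forall>X X' N N'. \<forall>f\<in>Hom C X X'. \<forall>h\<in>Hom M N N'.
        fstr F X' N' \<cdot> far F (f \<unrhd> h) = (f \<unrhd> far F h) \<cdot> fstr F X N) \<and>
     (\<forall>X Y N. mas M X Y (fob F N) \<cdot> fstr F (X \<otimes>\<^bsub>C\<^esub> Y) N =
        (idm C X \<unrhd> fstr F Y N) \<cdot> fstr F X (Y \<rhd> N) \<cdot> far F (mas M X Y N)) \<and>
     (\<forall>N. mun M (fob F N) \<cdot> fstr F \<one>\<^bsub>C\<^esub> N = far F (mun M N))"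

text \<open>\<open>F\<close> and \<open>G\<close> are isomorphic objects of the category of module functors from \<open>M\<close> to \<open>M\<close>.\<close>

definition module_functors_isomorphic ::
  "('o, 'p, 'b) mod_fun \<Rightarrow> ('o, 'p, 'b) mod_fun \<Rightarrow> bool" where
  "module_functors_isomorphic F G \<longleftrightarrow>
     is_module_functor F \<and> is_module_functor G \<and>
     (\<exists>\<eta>. (\<forall>N. is_iso M (fob F N) (fob G N) (\<eta> N)) \<and>
          (\<forall>N N'. \<forall>h\<in>Hom M N N'. \<eta> N' \<cdot> far F h = far G h \<cdot> \<eta> N) \<and>
          (\<forall>X N. fstr G X N \<cdot> \<eta> (X \<rhd> N) = (idm C X \<unrhd> \<eta> N) \<cdot> fstr F X N))"

definition identity_module_functor :: "('o, 'p, 'b) mod_fun" where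
  "identity_module_functor =
     \<lparr>fob = (\<lambda>N. N), far = (\<lambda>h. h), fstr = (\<lambda>X N. idm M (X \<rhd> N))\<rparr>"


section \<open>Matched pivotal structures\<close>

text \<open>\<open>X* \<rhd> (X \<rhd> L) \<rightarrow> L\<close> induced by \<open>ev X\<close>, and \<open>L \<rightarrow> X \<rhd> (X* \<rhd> L)\<close> induced by \<open>coev X\<close>.\<close>

definition act_ev :: "'o \<Rightarrow> 'p \<Rightarrow> 'b" where
  "act_ev X L =
     mun M L \<cdot> (ev C X \<unrhd> idm M L)
       \<cdot> inv_arr M ((dual C X \<otimes>\<^bsub>C\<^esub> X) \<rhd> L) (dual C X \<rhd> (X \<rhd> L)) (mas M (dual C X) X L)"

definition act_coev :: "'o \<Rightarrow> 'p \<Rightarrow> 'b" where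
  "act_coev X L =
     mas M X (dual C X) L \<cdot> (coev C X \<unrhd> idm M L) \<cdot> inv_arr M (\<one>\<^bsub>C\<^esub> \<rhd> L) L (mun M L)"

text \<open>
  Let \<open>F : C \<rightarrow> End(M)\<close> be the action and let \<open>S i\<close> (\<open>i \<in> I\<close>) be the simple objects of \<open>M\<close>. The functor
  \<open>F(X)\<close> corresponds to the bimodule with components \<open>V\<^sub>i\<^sub>j = Hom(S i, X \<rhd> S j)\<close>. Since \<open>F(X*)\<close> is
  dual to \<open>F(X)\<close> by means of \<open>ev X\<close>, the pairing of \<open>g : L \<rightarrow> X* \<rhd> N\<close> with \<open>f : N \<rightarrow> X \<rhd> L\<close> below, for
  \<open>N = S i\<close> and \<open>L = S j\<close>, identifies
  \<open>Hom(S j, X* \<rhd> S i)\<close> with the dual vector space of \<open>V\<^sub>i\<^sub>j\<close>.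
\<close>

definition duality_pairing :: "'o \<Rightarrow> 'p \<Rightarrow> 'b \<Rightarrow> 'b \<Rightarrow> 'k" where
  "duality_pairing X L g f =
     scalar_of M L (act_ev X L \<cdot> (idm C (dual C X) \<unrhd> f) \<cdot> g)"

text \<open>
  The canonical identification of \<open>F(X)\<close> with \<open>F(X)** = F(X**)\<close>. It is the isomorphism of functors whose
  component \<open>V\<^sub>i\<^sub>j \<rightarrow> V\<^sub>i\<^sub>j**\<close> is the usual map to the double dual vector space: \<open>f\<close> is sent to
  evaluation at \<open>f\<close>. Here \<open>V\<^sub>i\<^sub>j**\<close> is \<open>Hom(S i, X** \<rhd> S j)\<close>, by the pairing for \<open>X*\<close>.
\<close>

definition is_double_dual_identification ::
  "'i set \<Rightarrow> ('i \<Rightarrow> 'p) \<Rightarrow> ('o \<Rightarrow> 'p \<Rightarrow> 'b) \<Rightarrow> bool" where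
  "is_double_dual_identification I S \<phi> \<longleftrightarrow>
     (\<forall>X N. is_iso M (X \<rhd> N) (ddual C X \<rhd> N) (\<phi> X N)) \<and>
     (\<forall>X N N'. \<forall>h\<in>Hom M N N'.
        \<phi> X N' \<cdot> (idm C X \<unrhd> h) = (idm C (ddual C X) \<unrhd> h) \<cdot> \<phi> X N) \<and>
     (\<forall>X. \<forall>i\<in>I. \<forall>j\<in>I. \<forall>f\<in>Hom M (S i) (X \<rhd> S j). \<forall>g\<in>Hom M (S j) (dual C X \<rhd> S i).
        duality_pairing (dual C X) (S i) (\<phi> X (S j) \<cdot> f) g =
        duality_pairing X (S j) g f)"

definition double_dual_identification :: "'i set \<Rightarrow> ('i \<Rightarrow> 'p) \<Rightarrow> 'o \<Rightarrow> 'p \<Rightarrow> 'b" where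
  "double_dual_identification I S = (THE \<phi>. is_double_dual_identification I S \<phi>)"

text \<open>\<open>\<chi>(a, M)\<close>: the identity functor with the structure \<open>X \<rhd> N \<rightarrow> X** \<rhd> N = X \<rhd> N\<close> given by \<open>a X\<close>.\<close>

definition chi :: "'i set \<Rightarrow> ('i \<Rightarrow> 'p) \<Rightarrow> ('o \<Rightarrow> 'a) \<Rightarrow> ('o, 'p, 'b) mod_fun" where
  "chi I S a =
     \<lparr>fob = (\<lambda>N. N), far = (\<lambda>h. h),
      fstr = (\<lambda>X N. inv_arr M (X \<rhd> N) (ddual C X \<rhd> N) (double_dual_identification I S X N)
                      \<cdot> (a X \<unrhd> idm M N))\<rparr>"

definition matched :: "'i set \<Rightarrow> ('i \<Rightarrow> 'p) \<Rightarrow> ('o \<Rightarrow> 'a) \<Rightarrow> bool" where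
  "matched I S a \<longleftrightarrow> module_functors_isomorphic (chi I S a) identity_module_functor"


section \<open>Module traces\<close>

text \<open>The weighted sum over \<open>i \<in> I\<close> of the traces of \<open>f\<close> on the vector spaces \<open>Hom(S i, N)\<close>.\<close>

definition weighted_trace :: "'i set \<Rightarrow> ('i \<Rightarrow> 'p) \<Rightarrow> ('i \<Rightarrow> 'k) \<Rightarrow> 'p \<Rightarrow> 'b \<Rightarrow> 'k" where
  "weighted_trace I S m N f =
     (\<Sum>i\<in>I. m i * vector_space.trace_on (scl M) (Hom M (S i) N) (\<lambda>g. f \<cdot> g))"

text \<open>
  The composite \<open>N \<rightarrow> X* \<rhd> (X** \<rhd> N) \<rightarrow> X* \<rhd> (X \<rhd> N) \<rightarrow> X* \<rhd> (X \<rhd> N) \<rightarrow> N\<close> of the coevaluation of \<open>X*\<close>, the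
  inverse of \<open>a X\<close>, the morphism \<open>f\<close>, and the evaluation of \<open>X\<close>. An endomorphism \<open>f\<close> of \<open>X \<rhd> N\<close> can be
  applied only when \<open>X\<close> stands next to \<open>N\<close>, so the strand of \<open>X\<close> is closed up on the left.
\<close>

definition partial_trace :: "('o \<Rightarrow> 'a) \<Rightarrow> 'o \<Rightarrow> 'p \<Rightarrow> 'b \<Rightarrow> 'b" where
  "partial_trace a X N f =
     act_ev X N
       \<cdot> (idm C (dual C X) \<unrhd> f)
       \<cdot> (idm C (dual C X) \<unrhd> (inv_arr C X (ddual C X) (a X) \<unrhd> idm M N))
       \<cdot> act_coev (dual C X) N"

definition is_module_trace :: "'i set \<Rightarrow> ('i \<Rightarrow> 'p) \<Rightarrow> ('o \<Rightarrow> 'a) \<Rightarrow> ('i \<Rightarrow> 'k) \<Rightarrow> bool" where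
  "is_module_trace I S a m \<longleftrightarrow>
     (\<forall>X N. \<forall>f\<in>Hom M (X \<rhd> N) (X \<rhd> N).
        weighted_trace I S m (X \<rhd> N) f = weighted_trace I S m N (partial_trace a X N f))"

end

end

theory Submission
  imports Defs
begin

text \<open>
  Everything is expressed through a single trace on the semisimple category \<open>M\<close>: the weighted trace
  \<open>tr\<close> with all weights 1. It is cyclic, and it pairs \<open>Hom(A,B)\<close> with \<open>Hom(B,A)\<close> perfectly, so a linear
  functional on \<open>Hom(A,B)\<close> is the same thing as a morphism \<open>B \<rightarrow> A\<close> (\<open>tr_eqI\<close>, \<open>trace_dual\<close>). The data of
  the theorem become morphisms in this way.

  \<^item> A family of weights \<open>m\<close> is a natural endomorphism \<open>scaling m\<close> of the identity functor, which is \<open>m i\<close> on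
    \<open>S i\<close>; all natural endomorphisms arise like this, and the trace with weights \<open>m\<close> is
    \<open>f \<mapsto> tr(scaling m \<cdot> f)\<close>.
  \<^item> Closing up the strand of \<open>X\<close> turns \<open>h : X** \<rhd> N \<rightarrow> X \<rhd> N\<close> into an endomorphism \<open>close h\<close> of \<open>N\<close>. The
    functional \<open>h \<mapsto> tr(close h)\<close> is represented by a morphism \<open>double_dual : X \<rhd> N \<rightarrow> X** \<rhd> N\<close>. It is
    natural because \<open>tr\<close> is cyclic, it is invertible by the zigzag identities, and on simple objects its
    defining equation is the formula for the usual map of a vector space to its double dual. Hence it is
    the canonical identification of \<open>F(X)\<close> with \<open>F(X**)\<close>.
  \<^item> The partial trace of \<open>f\<close> is \<open>close (f \<cdot> (a\<^sub>X\<inverse> \<rhd> 1))\<close>.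

  So \<open>m\<close> is a module trace iff, for all \<open>f\<close>, the pairings with \<open>f\<close> of \<open>scaling m\<close> on \<open>X \<rhd> N\<close> and of
  \<open>(a\<^sub>X\<inverse> \<rhd> 1) \<cdot> double_dual \<cdot> (1 \<rhd> scaling m)\<close> agree, that is, by nondegeneracy, iff
  \<open>(a\<^sub>X \<rhd> 1) \<cdot> scaling m = double_dual \<cdot> (1 \<rhd> scaling m)\<close> (\<open>module_trace_iff_intertwines\<close>).
  On the other side, an isomorphism \<open>\<eta>\<close> from \<open>\<chi>(a,M)\<close> to the identity is a natural automorphism of the identity
  functor with \<open>\<eta> = (1 \<rhd> \<eta>) \<cdot> double_dual\<inverse> \<cdot> (a\<^sub>X \<rhd> 1)\<close> on \<open>X \<rhd> N\<close>, and this is the same equation for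
  the weights of \<open>\<eta>\<inverse>\<close> (\<open>matched_iff_intertwines\<close>).

  What remains is that a solution \<open>m \<noteq> 0\<close> of this equation has no zeros. The objects on which \<open>scaling m\<close> is
  invertible and those on which it vanishes are both stable under the action, because the equation carries
  either property from \<open>N\<close> to \<open>X \<rhd> N\<close>. They decompose \<open>M\<close>, so one of the two kinds is trivial
  (\<open>intertwines_nonvanishing\<close>). Uniqueness follows: a combination \<open>m' - c m\<close> of two module traces that
  vanishes at one simple object vanishes at all of them.
\<close>

section \<open>Traces and linear relations in vector spaces\<close>

context vector_space
begin

text \<open>
  The sum over \<open>b \<in> B'\<close> and \<open>d \<in> B\<close> of (coefficient of \<open>d\<close> in \<open>b\<close>) times (coefficient of \<open>b\<close> in \<open>T d\<close>) is
  the trace with respect to either basis: summing over \<open>d\<close> first gives the diagonal coefficients of \<open>T\<close> in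
  \<open>B'\<close>, summing over \<open>b\<close> first gives those in \<open>B\<close>. So the basis chosen by \<^const>\<open>trace_on\<close> does not matter.
\<close>

lemma trace_on_basis:
  assumes B: "finite B" "independent B" "span B = V"
    and maps: "\<And>x. x \<in> V \<Longrightarrow> T x \<in> V"
    and add: "\<And>x y. \<lbrakk>x \<in> V; y \<in> V\<rbrakk> \<Longrightarrow> T (x + y) = T x + T y"
    and scale: "\<And>c x. x \<in> V \<Longrightarrow> T (scale c x) = scale c (T x)"
  shows "trace_on V T = (\<Sum>b\<in>B. representation B (T b) b)"
proof -
  define B' where "B' = (SOME B. B \<subseteq> V \<and> independent B \<and> span B = V)"
  have "\<exists>B. B \<subseteq> V \<and> independent B \<and> span B = V"
    using B span_superset[of B] by auto
  then have B': "B' \<subseteq> V" "independent B'" "span B' = V"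
    unfolding B'_def by (rule someI2_ex, simp)+
  have "finite B'"
    using independent_span_bound[OF B(1) B'(2)] B'(1) B(3) by blast
  have T0: "T 0 = 0"
    using scale[of 0 0] span_zero[of B] B(3) by simp
  have T_sum: "T (\<Sum>b\<in>A. scale (c b) b) = (\<Sum>b\<in>A. scale (c b) (T b))"
    if "finite A" "A \<subseteq> V" for A c
    using that
  proof (induction A rule: finite_induct)
    case (insert x A)
    have "(\<Sum>b\<in>A. scale (c b) b) \<in> V"
      using insert.prems B(3) by (auto intro!: span_sum span_scale)
    moreover have "scale (c x) x \<in> V"
      using insert.prems B(3) by (auto intro!: span_scale)
    ultimately show ?case
      using insert by (simp add: add scale)
  qed (simp add: T0)
  have BV: "B \<subseteq> V"
    using span_superset[of B] B(3) by simp
  have "(\<Sum>b\<in>B'. representation B' (T b) b)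
      = (\<Sum>b\<in>B'. \<Sum>d\<in>B. representation B b d * representation B' (T d) b)"
  proof (rule sum.cong[OF refl])
    fix b assume b: "b \<in> B'"
    have "T b = T (\<Sum>d\<in>B. scale (representation B b d) d)"
      using sum_representation_eq[OF B(2) _ B(1) order_refl, of b] b B' B(3) by auto
    also have "\<dots> = (\<Sum>d\<in>B. scale (representation B b d) (T d))"
      using T_sum[OF B(1) BV] .
    finally have "representation B' (T b) b
        = representation B' (\<Sum>d\<in>B. scale (representation B b d) (T d)) b"
      by simp
    also have "\<dots> = (\<Sum>d\<in>B. representation B b d * representation B' (T d) b)"
      using BV B' maps
      by (subst representation_sum) (auto intro!: span_scale sum.cong simp: representation_scale subset_iff)
    finally show "representation B' (T b) b
        = (\<Sum>d\<in>B. representation B b d * representation B' (T d) b)" .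
  qed
  also have "\<dots> = (\<Sum>d\<in>B. \<Sum>b\<in>B'. representation B' (T d) b * representation B b d)"
    by (subst sum.swap) (simp add: mult.commute)
  also have "\<dots> = (\<Sum>d\<in>B. representation B (T d) d)"
  proof (rule sum.cong[OF refl])
    fix d assume d: "d \<in> B"
    have "T d = (\<Sum>b\<in>B'. scale (representation B' (T d) b) b)"
      using sum_representation_eq[OF B'(2) _ \<open>finite B'\<close> order_refl, of "T d"] d B' BV maps by auto
    then have "representation B (T d) d
        = representation B (\<Sum>b\<in>B'. scale (representation B' (T d) b) b) d"
      by simp
    also have "\<dots> = (\<Sum>b\<in>B'. representation B' (T d) b * representation B b d)"
      using B' B
      by (subst representation_sum) (auto intro!: span_scale sum.cong simp: representation_scale subset_iff)
    finally show "(\<Sum>b\<in>B'. representation B' (T d) b * representation B b d)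
        = representation B (T d) d" by simp
  qed
  finally show ?thesis
    unfolding trace_on_def B'_def by (simp add: Let_def)
qed

text \<open>
  The basis of \<open>Hom(S i, N)\<close> that computes the trace consists of the inclusions of the summands \<open>S i\<close> of \<open>N\<close>,
  and these come with indices.
\<close>

lemma trace_on_indexed_basis:
  assumes J: "finite J" "inj_on v J"
    and indep: "\<And>c. (\<Sum>j\<in>J. scale (c j) (v j)) = 0 \<Longrightarrow> \<forall>j\<in>J. c j = 0"
    and span: "span (v ` J) = V"
    and T: "\<And>l. l \<in> J \<Longrightarrow> T (v l) = (\<Sum>j\<in>J. scale (t j l) (v j))"
    and add: "\<And>x y. \<lbrakk>x \<in> V; y \<in> V\<rbrakk> \<Longrightarrow> T (x + y) = T x + T y"
    and scale: "\<And>c x. x \<in> V \<Longrightarrow> T (scale c x) = scale c (T x)"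
    and maps: "\<And>x. x \<in> V \<Longrightarrow> T x \<in> V"
  shows "trace_on V T = (\<Sum>l\<in>J. t l l)"
proof -
  have ind: "independent (v ` J)"
  proof (rule independent_if_scalars_zero)
    fix f x assume "(\<Sum>x\<in>v ` J. scale (f x) x) = 0" "x \<in> v ` J"
    then show "f x = 0"
      using indep[of "f \<circ> v"] by (auto simp: sum.reindex[OF J(2)])
  qed (simp add: J)
  have "representation (v ` J) (T (v l)) (v l) = t l l" if l: "l \<in> J" for l
  proof -
    have "representation (v ` J) (T (v l)) (v l)
        = (\<Sum>j\<in>J. t j l * representation (v ` J) (v j) (v l))"
      unfolding T[OF l]
      by (subst representation_sum[OF ind])
        (auto intro: span_scale span_base sum.cong simp: representation_scale[OF ind] span_base)
    also have "\<dots> = (\<Sum>j\<in>J. if j = l then t j l else 0)"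
      using J(2) l
      by (intro sum.cong refl) (auto simp: representation_basis[OF ind] inj_on_eq_iff)
    finally show ?thesis
      using J(1) l by simp
  qed
  moreover have "trace_on V T = (\<Sum>b\<in>v ` J. representation (v ` J) (T b) b)"
    using J(1) by (intro trace_on_basis ind span maps add scale) auto
  ultimately show ?thesis
    by (simp add: sum.reindex[OF J(2)])
qed

text \<open>
  This is applied to the powers of an endomorphism, where repetitions are possible; a repetition
  \<open>v k = v l\<close> is itself a linear relation of the family.
\<close>

lemma linear_relation_in_finite_span:
  assumes "finite B" "\<And>k::nat. v k \<in> span B"
  shows "\<exists>n c. (\<Sum>k\<le>n. scale (c k) (v k)) = 0 \<and> (\<exists>k\<le>n. c k \<noteq> 0)"
proof (cases "inj v")
  case False
  then obtain k l where kl: "k \<noteq> l" "v k = v l" by (auto simp: inj_def)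
  define c where "c = (\<lambda>j. if j = k then 1 else if j = l then - 1 else (0::'a))"
  have "(\<Sum>j\<le>max k l. scale (c j) (v j))
      = (\<Sum>j\<le>max k l. (if j = k then v k else 0) + (if j = l then - v l else 0))"
    by (rule sum.cong) (use kl in \<open>auto simp: c_def\<close>)
  also have "\<dots> = 0"
    using kl by (simp add: sum.distrib)
  finally have "(\<Sum>j\<le>max k l. scale (c j) (v j)) = 0" .
  moreover have "k \<le> max k l" "c k \<noteq> 0"
    by (auto simp: c_def)
  ultimately show ?thesis by blast
next
  case True
  let ?n = "card B"
  have inj: "inj_on v {..?n}" using True by (rule inj_on_subset) simp
  have "\<not> independent (v ` {..?n})"
  proof
    assume "independent (v ` {..?n})"
    from independent_span_bound[OF assms(1) this] have "card (v ` {..?n}) \<le> ?n"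
      using assms(2) by auto
    then show False using card_image[OF inj] by simp
  qed
  then obtain u where u: "\<exists>x\<in>v ` {..?n}. u x \<noteq> 0" "(\<Sum>x\<in>v ` {..?n}. scale (u x) x) = 0"
    using dependent_finite[of "v ` {..?n}"] by auto
  then show ?thesis
    by (intro exI[of _ ?n] exI[of _ "u \<circ> v"]) (auto simp: sum.reindex[OF inj])
qed

end

section \<open>Linear and abelian categories\<close>

context linear_category
begin

lemma zero_in: "0 \<in> Hom C X Y"
  using Hom_subspace by (rule subspace_0)

lemma add_in: "\<lbrakk>f \<in> Hom C X Y; g \<in> Hom C X Y\<rbrakk> \<Longrightarrow> f + g \<in> Hom C X Y"
  using Hom_subspace by (rule subspace_add)

lemma diff_in: "\<lbrakk>f \<in> Hom C X Y; g \<in> Hom C X Y\<rbrakk> \<Longrightarrow> f - g \<in> Hom C X Y"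
  using Hom_subspace by (rule subspace_diff)

lemma scl_in: "f \<in> Hom C X Y \<Longrightarrow> scl C c f \<in> Hom C X Y"
  using Hom_subspace by (rule subspace_scale)

lemma sum_in: "(\<And>j. j \<in> J \<Longrightarrow> f j \<in> Hom C X Y) \<Longrightarrow> (\<Sum>j\<in>J. f j) \<in> Hom C X Y"
  using Hom_subspace by (rule subspace_sum)

lemma cmp_zero_left: "f \<in> Hom C X Y \<Longrightarrow> 0 \<cdot> f = 0"
  using cmp_scl_left[of f X Y 0 Y 0] zero_in by simp

lemma cmp_zero_right: "g \<in> Hom C Y Z \<Longrightarrow> g \<cdot> 0 = 0"
  using cmp_scl_right[of 0 Y Y g Z 0] zero_in by simp

lemma cmp_diff_left:
  "\<lbrakk>f \<in> Hom C X Y; g \<in> Hom C Y Z; g' \<in> Hom C Y Z\<rbrakk> \<Longrightarrow> (g - g') \<cdot> f = (g \<cdot> f) - (g' \<cdot> f)"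
  using cmp_add_left[of f X Y "g - g'" Z g'] diff_in[of g Y Z g'] by simp

lemma cmp_diff_right:
  "\<lbrakk>f \<in> Hom C X Y; f' \<in> Hom C X Y; g \<in> Hom C Y Z\<rbrakk> \<Longrightarrow> g \<cdot> (f - f') = (g \<cdot> f) - (g \<cdot> f')"
  using cmp_add_right[of "f - f'" X Y f' g Z] diff_in[of f X Y f'] by simp

lemma cmp_sum_left:
  assumes "f \<in> Hom C X Y" "\<And>j. j \<in> J \<Longrightarrow> g j \<in> Hom C Y Z"
  shows "(\<Sum>j\<in>J. g j) \<cdot> f = (\<Sum>j\<in>J. g j \<cdot> f)"
  using assms(2)
proof (induction J rule: infinite_finite_induct)
  case (insert x F)
  then show ?case
    using cmp_add_left[OF assms(1), of "g x" Z "\<Sum>j\<in>F. g j"] by (simp add: sum_in)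
qed (simp_all add: cmp_zero_left[OF assms(1)])

lemma cmp_sum_right:
  assumes "g \<in> Hom C Y Z" "\<And>j. j \<in> J \<Longrightarrow> f j \<in> Hom C X Y"
  shows "g \<cdot> (\<Sum>j\<in>J. f j) = (\<Sum>j\<in>J. g \<cdot> f j)"
  using assms(2)
proof (induction J rule: infinite_finite_induct)
  case (insert x F)
  then show ?case
    using cmp_add_right[of "f x" X Y "\<Sum>j\<in>F. f j" g Z] assms(1) by (simp add: sum_in)
qed (simp_all add: cmp_zero_right[OF assms(1)])

text \<open>
  Composition is associative only for arrows with matching sources and targets. This rule replaces the first
  two arrows of a longer composite and asks for the types that justify it.
\<close>

lemma extend_square:
  assumes "a \<cdot> b = c \<cdot> d" and "y \<in> Hom C W X"
    and "b \<in> Hom C X Y" "a \<in> Hom C Y Z" "d \<in> Hom C X Y'" "c \<in> Hom C Y' Z"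
  shows "a \<cdot> b \<cdot> y = c \<cdot> d \<cdot> y"
  using cmp_assoc[OF assms(2-4)] cmp_assoc[OF assms(2,5,6)] assms(1) by simp

lemma is_iso_in: "is_iso C X Y f \<Longrightarrow> f \<in> Hom C X Y"
  by (auto simp: is_iso_def inverses_def)

lemma inverses_unique:
  assumes "inverses C X Y f g" "inverses C X Y f g'"
  shows "g = g'"
proof -
  have f: "f \<in> Hom C X Y" "g \<in> Hom C Y X" "g' \<in> Hom C Y X" "g \<cdot> f = idm C X" "f \<cdot> g' = idm C Y"
    using assms by (auto simp: inverses_def)
  show ?thesis
    using cmp_assoc[OF f(3,1,2)] f by (simp add: id_left id_right)
qed

lemma inv_arr_eqI: "inverses C X Y f g \<Longrightarrow> inv_arr C X Y f = g"
  unfolding inv_arr_def using inverses_unique by blast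

lemma inverses_inv_arr: "is_iso C X Y f \<Longrightarrow> inverses C X Y f (inv_arr C X Y f)"
  unfolding is_iso_def using inv_arr_eqI by auto

lemma inv_arr_in: "is_iso C X Y f \<Longrightarrow> inv_arr C X Y f \<in> Hom C Y X"
  and inv_arr_left: "is_iso C X Y f \<Longrightarrow> inv_arr C X Y f \<cdot> f = idm C X"
  and inv_arr_right: "is_iso C X Y f \<Longrightarrow> f \<cdot> inv_arr C X Y f = idm C Y"
  using inverses_inv_arr[of X Y f] by (auto simp: inverses_def)

lemma is_iso_inv_arr: "is_iso C X Y f \<Longrightarrow> is_iso C Y X (inv_arr C X Y f)"
  using inverses_inv_arr[of X Y f] by (auto simp: is_iso_def inverses_def)

lemma is_iso_id: "is_iso C X X (idm C X)"
  unfolding is_iso_def inverses_def using id_in id_left by blast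

lemma is_iso_cmp:
  assumes "is_iso C X Y f" "is_iso C Y Z g"
  shows "is_iso C X Z (g \<cdot> f)"
proof -
  obtain f' g' where f: "f \<in> Hom C X Y" "f' \<in> Hom C Y X" "f' \<cdot> f = idm C X" "f \<cdot> f' = idm C Y"
    and g: "g \<in> Hom C Y Z" "g' \<in> Hom C Z Y" "g' \<cdot> g = idm C Y" "g \<cdot> g' = idm C Z"
    using assms by (auto simp: is_iso_def inverses_def)
  have "(f' \<cdot> g') \<cdot> g \<cdot> f = f' \<cdot> (g' \<cdot> g) \<cdot> f"
    using cmp_assoc[OF cmp_in[OF f(1) g(1)] g(2) f(2)] cmp_assoc[OF f(1) g(1,2)] by simp
  moreover have "(g \<cdot> f) \<cdot> f' \<cdot> g' = g \<cdot> (f \<cdot> f') \<cdot> g'"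
    using cmp_assoc[OF cmp_in[OF g(2) f(2)] f(1) g(1)] cmp_assoc[OF g(2) f(2,1)] by simp
  ultimately have "inverses C X Z (g \<cdot> f) (f' \<cdot> g')"
    unfolding inverses_def using f g cmp_in[OF f(1) g(1)] cmp_in[OF g(2) f(2)] by (simp add: id_left)
  then show ?thesis by (auto simp: is_iso_def)
qed

lemma cancel_iso_right:
  assumes "is_iso C W X e" "f \<in> Hom C X Y" "g \<in> Hom C X Y" "f \<cdot> e = g \<cdot> e"
  shows "f = g"
proof -
  note e = is_iso_in[OF assms(1)] inv_arr_in[OF assms(1)]
  have "f \<cdot> e \<cdot> inv_arr C W X e = g \<cdot> e \<cdot> inv_arr C W X e"
    using cmp_assoc[OF e(2,1) assms(2)] cmp_assoc[OF e(2,1) assms(3)] assms(4) by simp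
  then show ?thesis
    using assms by (simp add: inv_arr_right id_right)
qed

lemma cancel_iso_left:
  assumes "is_iso C Y Z e" "f \<in> Hom C X Y" "g \<in> Hom C X Y" "e \<cdot> f = e \<cdot> g"
  shows "f = g"
proof -
  note e = is_iso_in[OF assms(1)] inv_arr_in[OF assms(1)]
  have "(inv_arr C Y Z e \<cdot> e) \<cdot> f = (inv_arr C Y Z e \<cdot> e) \<cdot> g"
    using cmp_assoc[OF assms(2) e(1,2)] cmp_assoc[OF assms(3) e(1,2)] assms(4) by simp
  then show ?thesis
    using assms by (simp add: inv_arr_left id_left)
qed

lemma isomorphic_sym: "isomorphic C X Y \<Longrightarrow> isomorphic C Y X"
  unfolding isomorphic_def using is_iso_inv_arr by blast

lemma isomorphic_trans: "\<lbrakk>isomorphic C X Y; isomorphic C Y Z\<rbrakk> \<Longrightarrow> isomorphic C X Z"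
  unfolding isomorphic_def using is_iso_cmp by blast

lemma zero_obj_if_id_zero:
  assumes "idm C X = 0"
  shows "is_zero_obj C X"
proof -
  have "f = 0" if "f \<in> Hom C X Y" for f Y
    using id_right[OF that] cmp_zero_right[OF that] assms by simp
  moreover have "f = 0" if "f \<in> Hom C Y X" for f Y
    using id_left[OF that] cmp_zero_left[OF that] assms by simp
  ultimately show ?thesis
    unfolding is_zero_obj_def using zero_in by blast
qed

lemma kernel_mono:
  assumes "is_kernel C K X Y k f"
  shows "is_mono C K X k"
proof -
  have k: "k \<in> Hom C K X" "f \<in> Hom C X Y" "f \<cdot> k = 0"
    and univ: "\<And>W g. \<lbrakk>g \<in> Hom C W X; f \<cdot> g = 0\<rbrakk> \<Longrightarrow> \<exists>!h. h \<in> Hom C W K \<and> k \<cdot> h = g"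
    using assms unfolding is_kernel_def by auto
  have "g = h" if "g \<in> Hom C W K" "h \<in> Hom C W K" "k \<cdot> g = k \<cdot> h" for W g h
  proof -
    have "f \<cdot> k \<cdot> g = 0"
      using cmp_assoc[OF that(1) k(1,2)] k(3) cmp_zero_left[OF that(1)] by simp
    then show ?thesis
      using univ[OF cmp_in[OF that(1) k(1)]] that by auto
  qed
  then show ?thesis
    unfolding is_mono_def using k by blast
qed

end

context abelian_category
begin

text \<open>
  Schur's lemma. The kernel of \<open>f\<close> is a subobject of \<open>X\<close>. If it were all of \<open>X\<close>, then \<open>f\<close> would be zero; so it
  is zero and \<open>f\<close> is a nonzero subobject of \<open>Y\<close>.
\<close>

lemma simple_arrow_zero_or_iso:
  assumes X: "is_simple C X" and Y: "is_simple C Y" and f: "f \<in> Hom C X Y" "f \<noteq> 0"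
  shows "is_iso C X Y f"
proof -
  obtain K k where K: "is_kernel C K X Y k f"
    using kernels[OF f(1)] by blast
  have k: "k \<in> Hom C K X" "f \<cdot> k = 0"
    using K unfolding is_kernel_def by auto
  have "\<not> is_iso C K X k"
  proof
    assume iso: "is_iso C K X k"
    have "f \<cdot> k = 0 \<cdot> k"
      using k cmp_zero_left by simp
    with f(2) show False
      using cancel_iso_right[OF iso f(1) zero_in] by blast
  qed
  then have "is_zero_obj C K"
    using X kernel_mono[OF K] unfolding is_simple_def by blast
  have "g = h" if gh: "g \<in> Hom C W X" "h \<in> Hom C W X" "f \<cdot> g = f \<cdot> h" for W g h
  proof -
    have "f \<cdot> (g - h) = 0"
      using gh cmp_diff_right[OF gh(1,2) f(1)] by simp
    then obtain u where "u \<in> Hom C W K" "k \<cdot> u = g - h"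
      using K diff_in[OF gh(1,2)] unfolding is_kernel_def by blast
    moreover have "Hom C W K = {0}"
      using \<open>is_zero_obj C K\<close> by (simp add: is_zero_obj_def)
    ultimately show ?thesis
      using cmp_zero_right[OF k(1)] by simp
  qed
  then have "is_mono C X Y f"
    unfolding is_mono_def using f by blast
  then show ?thesis
    using X Y unfolding is_simple_def by blast
qed

text \<open>
  A mono \<open>f\<close> is the kernel of some \<open>g\<close>. As \<open>f\<close> is epi, \<open>g \<cdot> f = 0\<close> forces \<open>g = 0\<close>, and then the identity of
  \<open>Y\<close> factors through \<open>f\<close>.
\<close>

lemma iso_if_mono_epi:
  assumes "is_mono C X Y f" "is_epi C X Y f"
  shows "is_iso C X Y f"
proof -
  obtain Z g where "is_kernel C X Y Z f g"
    using mono_is_kernel[OF assms(1)] by blast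
  then have g: "f \<in> Hom C X Y" "g \<in> Hom C Y Z" "g \<cdot> f = 0"
    and univ: "\<And>W h. \<lbrakk>h \<in> Hom C W Y; g \<cdot> h = 0\<rbrakk> \<Longrightarrow> \<exists>!u. u \<in> Hom C W X \<and> f \<cdot> u = h"
    unfolding is_kernel_def by auto
  have "g \<cdot> f = 0 \<cdot> f"
    using g cmp_zero_left by simp
  then have "g = 0"
    using assms(2) g zero_in unfolding is_epi_def by blast
  then obtain u where u: "u \<in> Hom C Y X" "f \<cdot> u = idm C Y"
    using univ[OF id_in[of Y]] cmp_zero_left[OF id_in] by blast
  have "f \<cdot> u \<cdot> f = f \<cdot> idm C X"
    using cmp_assoc[OF g(1) u(1) g(1)] u g by (simp add: id_left id_right)
  then have "u \<cdot> f = idm C X"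
    using assms(1) cmp_in[OF g(1) u(1)] id_in unfolding is_mono_def by blast
  then show ?thesis
    unfolding is_iso_def inverses_def using u g by blast
qed

text \<open>
  The image of the idempotent \<open>e\<close> is the kernel of \<open>1 - e\<close>.
\<close>

lemma idempotent_splits:
  assumes e: "e \<in> Hom C X X" "e \<cdot> e = e"
  obtains K k r where "k \<in> Hom C K X" "r \<in> Hom C X K" "r \<cdot> k = idm C K" "k \<cdot> r = e"
proof -
  let ?d = "idm C X - e"
  have d: "?d \<in> Hom C X X"
    using e id_in diff_in by blast
  obtain K k where K: "is_kernel C K X X k ?d"
    using kernels[OF d] by blast
  have k: "k \<in> Hom C K X" "?d \<cdot> k = 0"
    using K unfolding is_kernel_def by auto
  have ek: "e \<cdot> k = k"
    using k cmp_diff_left[OF k(1) id_in e(1)] by (simp add: id_left)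
  have "?d \<cdot> e = 0"
    using cmp_diff_left[OF e(1) id_in e(1)] e by (simp add: id_left)
  then obtain r where r: "r \<in> Hom C X K" "k \<cdot> r = e"
    using K e(1) unfolding is_kernel_def by blast
  have "k \<cdot> r \<cdot> k = k \<cdot> idm C K"
    using cmp_assoc[OF k(1) r(1) k(1)] r ek k by (simp add: id_right)
  then have "r \<cdot> k = idm C K"
    using kernel_mono[OF K] cmp_in[OF k(1) r(1)] id_in unfolding is_mono_def by blast
  with k r that show ?thesis by blast
qed

end

section \<open>Simple objects and decompositions\<close>

locale based_semisimple_category = finite_semisimple_category M
  for M :: "('k::alg_closed_field, 'p, 'b::ab_group_add, 'z) lcat_scheme" (structure) +
  fixes I :: "'i set" and S :: "'i \<Rightarrow> 'p"
  assumes representatives: "simple_representatives M I S"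
begin

text \<open>
  The value of a polynomial at the endomorphism \<open>e\<close>, by Horner's rule.
\<close>

definition poly_endo :: "'p \<Rightarrow> 'b \<Rightarrow> 'k poly \<Rightarrow> 'b" where
  "poly_endo X e p = fold_coeffs (\<lambda>c v. scl M c (idm M X) + (e \<cdot> v)) p 0"

context
  fixes X e assumes e: "e \<in> Hom M X X"
begin

lemma poly_endo_0: "poly_endo X e 0 = 0"
  by (simp add: poly_endo_def)

lemma poly_endo_pCons: "poly_endo X e (pCons c p) = scl M c (idm M X) + (e \<cdot> poly_endo X e p)"
  by (cases "c = 0 \<and> p = 0") (auto simp: poly_endo_def cmp_zero_right[OF e])

lemma poly_endo_in: "poly_endo X e p \<in> Hom M X X"
  by (induction p) (auto simp: poly_endo_0 poly_endo_pCons intro: zero_in add_in scl_in id_in cmp_in[OF _ e])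

lemma poly_endo_add: "poly_endo X e (p + q) = poly_endo X e p + poly_endo X e q"
  by (induction p q rule: poly_induct2)
    (simp_all add: poly_endo_0 poly_endo_pCons cmp_add_right[OF poly_endo_in poly_endo_in e]
      scale_left_distrib algebra_simps)

lemma poly_endo_smult: "poly_endo X e (smult c p) = scl M c (poly_endo X e p)"
  by (induction p)
    (simp_all add: poly_endo_0 poly_endo_pCons cmp_scl_right[OF poly_endo_in e] scale_right_distrib)

lemma poly_endo_sum: "poly_endo X e (\<Sum>k\<in>K. p k) = (\<Sum>k\<in>K. poly_endo X e (p k))"
  by (induction K rule: infinite_finite_induct) (simp_all add: poly_endo_0 poly_endo_add)

lemma poly_endo_monom: "poly_endo X e (monom c k) = scl M c (((\<lambda>v. e \<cdot> v) ^^ k) (idm M X))"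
proof (induction k)
  case 0
  then show ?case by (simp add: monom_0 poly_endo_pCons poly_endo_0 cmp_zero_right[OF e])
next
  case (Suc k)
  have "((\<lambda>v. e \<cdot> v) ^^ k) (idm M X) \<in> Hom M X X"
    by (induction k) (auto intro: id_in cmp_in[OF _ e])
  with Suc show ?case by (simp add: monom_Suc poly_endo_pCons cmp_scl_right[OF _ e])
qed

lemma endo_annihilated_by_polynomial: "\<exists>p. p \<noteq> 0 \<and> poly_endo X e p = 0"
proof -
  obtain B where B: "finite B" "span B = Hom M X X"
    using Hom_finite_dim by blast
  let ?v = "\<lambda>k. ((\<lambda>v. e \<cdot> v) ^^ k) (idm M X)"
  have v: "?v k \<in> span B" for k
    unfolding B(2) by (induction k) (auto intro: id_in cmp_in[OF _ e])
  from linear_relation_in_finite_span[of B ?v, OF B(1) v]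
  obtain n c k where c: "(\<Sum>k\<le>n. scl M (c k) (?v k)) = 0" and k: "k \<le> n" "c k \<noteq> 0"
    by blast
  let ?p = "\<Sum>k\<le>n. monom (c k) k"
  have "coeff ?p k = c k"
    using k by (simp add: coeff_sum)
  then have "?p \<noteq> 0"
    using k by (metis coeff_0)
  moreover have "poly_endo X e ?p = 0"
    using c by (simp add: poly_endo_sum poly_endo_monom)
  ultimately show ?thesis by blast
qed

end

lemma id_nonzero_if_simple: "is_simple M X \<Longrightarrow> idm M X \<noteq> 0"
  using zero_obj_if_id_zero unfolding is_simple_def by blast

text \<open>
  Let \<open>p\<close> be a nonzero polynomial of least degree with \<open>p(e) = 0\<close>. It has a root \<open>x\<close>, so that
  \<open>(e - x) \<cdot> q(e) = 0\<close> with \<open>q\<close> of smaller degree. By minimality \<open>q(e)\<close> is not zero, hence it is invertible by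
  Schur's lemma, and \<open>e = x\<close>.
\<close>

lemma simple_endo_scalar:
  assumes X: "is_simple M X" and e: "e \<in> Hom M X X"
  shows "\<exists>c. e = scl M c (idm M X)"
proof -
  obtain p where p: "p \<noteq> 0" "poly_endo X e p = 0"
    and minimal: "\<And>q. \<lbrakk>q \<noteq> 0; poly_endo X e q = 0\<rbrakk> \<Longrightarrow> degree p \<le> degree q"
    using ex_has_least_nat[of "\<lambda>p. p \<noteq> 0 \<and> poly_endo X e p = 0" _ degree]
      endo_annihilated_by_polynomial[OF e] by blast
  have "degree p > 0"
  proof (rule ccontr)
    assume "\<not> degree p > 0"
    then obtain c where "p = [:c:]" using degree_0_id by (metis neq0_conv)
    then show False
      using p id_nonzero_if_simple[OF X] by (simp add: poly_endo_pCons[OF e] poly_endo_0[OF e] cmp_zero_right[OF e])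
  qed
  then obtain x where "poly p x = 0"
    using alg_closed_imp_poly_has_root by blast
  then obtain q where q: "p = [:- x, 1:] * q"
    using poly_eq_0_iff_dvd by blast
  then have "q \<noteq> 0" "degree q < degree p"
    using p(1) by (auto simp: degree_mult_eq simp del: mult_pCons_left)
  then have "poly_endo X e q \<noteq> 0"
    using minimal by (meson not_less)
  then have iso: "is_iso M X X (poly_endo X e q)"
    using simple_arrow_zero_or_iso[OF X X] poly_endo_in[OF e] by blast
  have "p = smult (- x) q + pCons 0 q"
    using q by simp
  then have "poly_endo X e p = scl M (- x) (poly_endo X e q) + (e \<cdot> poly_endo X e q)"
    by (simp only: poly_endo_add[OF e] poly_endo_smult[OF e] poly_endo_pCons[OF e] scale_zero_left add_0)
  then have "e \<cdot> poly_endo X e q = scl M x (idm M X) \<cdot> poly_endo X e q"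
    using p(2) by (simp add: cmp_scl_left[OF poly_endo_in[OF e] id_in] id_left[OF poly_endo_in[OF e]])
  then show ?thesis
    using cancel_iso_right[OF iso e scl_in[OF id_in]] by blast
qed

lemma simple_S: "i \<in> I \<Longrightarrow> is_simple M (S i)"
  and nonisomorphic_S: "\<lbrakk>i \<in> I; j \<in> I; isomorphic M (S i) (S j)\<rbrakk> \<Longrightarrow> i = j"
  and simple_isomorphic_S: "is_simple M X \<Longrightarrow> \<exists>i\<in>I. isomorphic M X (S i)"
  using representatives unfolding simple_representatives_def by blast+

lemma finite_I: "finite I"
proof -
  obtain F where F: "finite F" "\<And>X. is_simple M X \<Longrightarrow> \<exists>Y\<in>F. isomorphic M X Y"
    using finitely_many_simples by blast
  have "\<forall>i\<in>I. \<exists>Y. Y \<in> F \<and> isomorphic M (S i) Y"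
    using F(2) simple_S by blast
  from bchoice[OF this] obtain t where t: "\<And>i. i \<in> I \<Longrightarrow> t i \<in> F \<and> isomorphic M (S i) (t i)"
    by blast
  have "inj_on t I"
  proof (rule inj_onI)
    fix i j assume ij: "i \<in> I" "j \<in> I" "t i = t j"
    then have "isomorphic M (S i) (t i)" "isomorphic M (t i) (S j)"
      using t[of i] t[of j] isomorphic_sym by auto
    then show "i = j"
      using isomorphic_trans nonisomorphic_S[OF ij(1,2)] by blast
  qed
  moreover have "t ` I \<subseteq> F" using t by blast
  ultimately show ?thesis
    using F(1) by (rule inj_on_finite)
qed

lemma Hom_S_zero: "\<lbrakk>i \<in> I; j \<in> I; i \<noteq> j; f \<in> Hom M (S i) (S j)\<rbrakk> \<Longrightarrow> f = 0"
  using simple_arrow_zero_or_iso[OF simple_S simple_S] nonisomorphic_S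
  unfolding isomorphic_def by blast

abbreviation sc :: "'i \<Rightarrow> 'b \<Rightarrow> 'k" where
  "sc i \<equiv> scalar_of M (S i)"

lemma sc_id:
  assumes "i \<in> I"
  shows "sc i (scl M c (idm M (S i))) = c"
  unfolding scalar_of_def
  using id_nonzero_if_simple[OF simple_S[OF assms]] by (auto simp: scale_right_imp_eq)

lemma scl_sc: "\<lbrakk>i \<in> I; e \<in> Hom M (S i) (S i)\<rbrakk> \<Longrightarrow> scl M (sc i e) (idm M (S i)) = e"
  using simple_endo_scalar[OF simple_S] sc_id by metis

lemma sc_add:
  assumes "i \<in> I" "e \<in> Hom M (S i) (S i)" "e' \<in> Hom M (S i) (S i)"
  shows "sc i (e + e') = sc i e + sc i e'"
  using sc_id[OF assms(1), of "sc i e + sc i e'"] scl_sc[OF assms(1,2)] scl_sc[OF assms(1,3)]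
  by (simp add: scale_left_distrib)

lemma sc_zero: "i \<in> I \<Longrightarrow> sc i 0 = 0"
  using sc_id[of i 0] by simp

lemma sc_scl:
  assumes "i \<in> I" "e \<in> Hom M (S i) (S i)"
  shows "sc i (scl M c e) = c * sc i e"
  using sc_id[OF assms(1), of "c * sc i e"] scl_sc[OF assms] by (simp flip: scale_scale)

lemma sc_sum:
  assumes "i \<in> I" "\<And>j. j \<in> J \<Longrightarrow> e j \<in> Hom M (S i) (S i)"
  shows "sc i (\<Sum>j\<in>J. e j) = (\<Sum>j\<in>J. sc i (e j))"
  using assms(2)
  by (induction J rule: infinite_finite_induct) (simp_all add: sc_zero sc_add sum_in assms(1))

lemma sc_cmp:
  assumes "i \<in> I" "e \<in> Hom M (S i) (S i)" "e' \<in> Hom M (S i) (S i)"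
  shows "sc i (e \<cdot> e') = sc i e * sc i e'"
proof -
  have "e \<cdot> e' = scl M (sc i e) (idm M (S i)) \<cdot> e'"
    using scl_sc assms by simp
  also have "\<dots> = scl M (sc i e) e'"
    using cmp_scl_left[OF assms(3) id_in] id_left[OF assms(3)] by simp
  finally show ?thesis
    using sc_scl assms by simp
qed

text \<open>
  The source of the cyclicity of all weighted traces: composites through a different simple object vanish, and
  scalars commute.
\<close>

lemma sc_swap:
  assumes "i \<in> I" "j \<in> I" "x \<in> Hom M (S j) (S i)" "y \<in> Hom M (S i) (S j)"
  shows "m i * sc i (x \<cdot> y) = m j * sc j (y \<cdot> x)"
proof (cases "i = j")
  case True
  then show ?thesis using assms by (simp add: sc_cmp mult.commute)
next
  case False
  then have "x = 0" "y = 0"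
    using Hom_S_zero assms by auto
  then show ?thesis
    using assms sc_zero cmp_zero_left by (simp add: cmp_zero_left[OF zero_in])
qed

text \<open>
  The summands are the representatives \<open>S i\<close> themselves and not only isomorphic to them, so that matrix entries
  between two summands are scalars or zero.
\<close>

definition decomposes :: "'p \<Rightarrow> nat \<Rightarrow> (nat \<Rightarrow> 'i) \<Rightarrow> (nat \<Rightarrow> 'b) \<Rightarrow> (nat \<Rightarrow> 'b) \<Rightarrow> bool" where
  "decomposes N n \<sigma> inc prj \<longleftrightarrow>
     (\<forall>l<n. \<sigma> l \<in> I) \<and> direct_sum M N n (\<lambda>l. S (\<sigma> l)) inc prj"

lemma decomposesD:
  assumes "decomposes N n \<sigma> inc prj"
  shows "l < n \<Longrightarrow> \<sigma> l \<in> I"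
    and "l < n \<Longrightarrow> inc l \<in> Hom M (S (\<sigma> l)) N"
    and "l < n \<Longrightarrow> prj l \<in> Hom M N (S (\<sigma> l))"
    and "\<lbrakk>l < n; k < n\<rbrakk> \<Longrightarrow> prj l \<cdot> inc k = (if l = k then idm M (S (\<sigma> l)) else 0)"
    and "(\<Sum>l<n. inc l \<cdot> prj l) = idm M N"
  using assms unfolding decomposes_def direct_sum_def by auto

lemma decomposition_exists: "\<exists>n \<sigma> inc prj. decomposes N n \<sigma> inc prj"
proof -
  obtain n Xs i p where simple: "\<And>l. l < n \<Longrightarrow> is_simple M (Xs l)"
    and ds: "direct_sum M N n Xs i p"
    using semisimple[of N] unfolding is_direct_sum_def by blast
  have "\<forall>l. \<exists>i f. l < n \<longrightarrow> i \<in> I \<and> is_iso M (Xs l) (S i) f"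
    using simple_isomorphic_S[OF simple] unfolding isomorphic_def by blast
  from choice[OF this] obtain \<sigma> where "\<forall>l. \<exists>f. l < n \<longrightarrow> \<sigma> l \<in> I \<and> is_iso M (Xs l) (S (\<sigma> l)) f"
    by blast
  from choice[OF this] obtain f where \<sigma>: "\<And>l. l < n \<Longrightarrow> \<sigma> l \<in> I \<and> is_iso M (Xs l) (S (\<sigma> l)) (f l)"
    by blast
  define g where "g l = inv_arr M (Xs l) (S (\<sigma> l)) (f l)" for l
  have f: "f l \<in> Hom M (Xs l) (S (\<sigma> l))" "g l \<in> Hom M (S (\<sigma> l)) (Xs l)"
    "g l \<cdot> f l = idm M (Xs l)" "f l \<cdot> g l = idm M (S (\<sigma> l))" if "l < n" for l
    using \<sigma>[OF that] is_iso_in inv_arr_in inv_arr_left inv_arr_right unfolding g_def by auto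
  have ip: "i l \<in> Hom M (Xs l) N" "p l \<in> Hom M N (Xs l)" if "l < n" for l
    using ds that unfolding direct_sum_def by auto
  have pi: "p l \<cdot> i k = (if l = k then idm M (Xs l) else 0)" if "l < n" "k < n" for l k
    using ds that unfolding direct_sum_def by auto
  have 1: "(i l \<cdot> g l) \<cdot> (f l \<cdot> p l) = i l \<cdot> p l" if l: "l < n" for l
  proof -
    note t = ip[OF l] f[OF l]
    have "(i l \<cdot> g l) \<cdot> (f l \<cdot> p l) = i l \<cdot> (g l \<cdot> f l) \<cdot> p l"
      using cmp_assoc[OF cmp_in[OF t(2,3)] t(4,1)] cmp_assoc[OF t(2-4)] by simp
    then show ?thesis using t by (simp add: id_left)
  qed
  have 2: "(f l \<cdot> p l) \<cdot> (i k \<cdot> g k) = (if l = k then idm M (S (\<sigma> l)) else 0)"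
    if l: "l < n" and k: "k < n" for l k
  proof -
    note t = ip[OF l] f[OF l] and t' = ip[OF k] f[OF k]
    have "(f l \<cdot> p l) \<cdot> (i k \<cdot> g k) = f l \<cdot> (p l \<cdot> i k) \<cdot> g k"
      using cmp_assoc[OF cmp_in[OF t'(4,1)] t(2,3)] cmp_assoc[OF t'(4,1) t(2)] by simp
    then show ?thesis
      using pi[OF l k] t t' by (auto simp: id_left cmp_zero_left cmp_zero_right)
  qed
  have "(\<Sum>l<n. (i l \<cdot> g l) \<cdot> f l \<cdot> p l) = idm M N"
    using 1 ds by (simp add: direct_sum_def)
  moreover have "i l \<cdot> g l \<in> Hom M (S (\<sigma> l)) N" "f l \<cdot> p l \<in> Hom M N (S (\<sigma> l))" if "l < n" for l
    using cmp_in[OF f(2)[OF that] ip(1)[OF that]] cmp_in[OF ip(2)[OF that] f(1)[OF that]] .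
  moreover have "\<sigma> l \<in> I" if "l < n" for l
    using \<sigma>[OF that] by blast
  ultimately have "decomposes N n \<sigma> (\<lambda>l. i l \<cdot> g l) (\<lambda>l. f l \<cdot> p l)"
    unfolding decomposes_def direct_sum_def using 2 by (intro conjI allI impI)
  then show ?thesis by blast
qed

lemma cmp_through:
  assumes D: "decomposes L n \<sigma> inc prj" and x: "x \<in> Hom M L A" and y: "y \<in> Hom M B L"
  shows "x \<cdot> y = (\<Sum>l<n. (x \<cdot> inc l) \<cdot> prj l \<cdot> y)"
proof -
  note D' = decomposesD[OF D]
  have "x \<cdot> y = x \<cdot> (\<Sum>l<n. inc l \<cdot> prj l) \<cdot> y"
    using D'(5) id_left[OF y] by simp
  also have "\<dots> = (\<Sum>l<n. x \<cdot> (inc l \<cdot> prj l) \<cdot> y)"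
  proof -
    have e: "inc l \<cdot> prj l \<in> Hom M L L" if "l \<in> {..<n}" for l
      using cmp_in[OF D'(3) D'(2)] that by simp
    have "(\<Sum>l<n. inc l \<cdot> prj l) \<cdot> y = (\<Sum>l<n. (inc l \<cdot> prj l) \<cdot> y)"
      using e by (rule cmp_sum_left[OF y])
    moreover have "x \<cdot> (\<Sum>l<n. (inc l \<cdot> prj l) \<cdot> y) = (\<Sum>l<n. x \<cdot> (inc l \<cdot> prj l) \<cdot> y)"
      using cmp_in[OF y e] by (rule cmp_sum_right[OF x])
    ultimately show ?thesis by simp
  qed
  also have "\<dots> = (\<Sum>l<n. (x \<cdot> inc l) \<cdot> prj l \<cdot> y)"
  proof (rule sum.cong[OF refl])
    fix l assume "l \<in> {..<n}"
    then have l: "l < n" by simp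
    show "x \<cdot> (inc l \<cdot> prj l) \<cdot> y = (x \<cdot> inc l) \<cdot> prj l \<cdot> y"
      using cmp_assoc[OF y D'(3)[OF l] D'(2)[OF l]] cmp_assoc[OF cmp_in[OF y D'(3)[OF l]] D'(2)[OF l] x]
      by simp
  qed
  finally show ?thesis .
qed

lemma expand_target:
  assumes D: "decomposes L n \<sigma> inc prj" and y: "y \<in> Hom M B L"
  shows "y = (\<Sum>l<n. inc l \<cdot> prj l \<cdot> y)"
  using cmp_through[OF D id_in y] id_left[OF y] id_left[OF decomposesD(2)[OF D]] by simp

lemma expand_source:
  assumes D: "decomposes L n \<sigma> inc prj" and x: "x \<in> Hom M L A"
  shows "x = (\<Sum>l<n. (x \<cdot> inc l) \<cdot> prj l)"
  using cmp_through[OF D x id_in] id_right[OF x] id_right[OF decomposesD(3)[OF D]] by simp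

section \<open>Weighted traces\<close>

text \<open>
  The inclusions of those summands of \<open>N\<close> that are equal to \<open>S k\<close> form a basis of \<open>Hom(S k, N)\<close>, because a
  morphism from \<open>S k\<close> has zero components in the other summands. The trace is the sum of the diagonal entries.
\<close>

lemma trace_on_Hom_S:
  assumes D: "decomposes N n \<sigma> inc prj" and f: "f \<in> Hom M N N" and k: "k \<in> I"
  shows "trace_on (Hom M (S k) N) (\<lambda>g. f \<cdot> g)
    = (\<Sum>l\<in>{l. l < n \<and> \<sigma> l = k}. sc k (prj l \<cdot> f \<cdot> inc l))"
proof (rule trace_on_indexed_basis[where v = inc and t = "\<lambda>j l. sc k (prj j \<cdot> f \<cdot> inc l)"])
  note D' = decomposesD[OF D]
  let ?J = "{l. l < n \<and> \<sigma> l = k}"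
  let ?t = "\<lambda>j l. sc k (prj j \<cdot> f \<cdot> inc l)"
  show "finite ?J" by simp
  have coord: "prj l \<cdot> (\<Sum>j\<in>?J. scl M (c j) (inc j)) = scl M (c l) (idm M (S k))" if l: "l \<in> ?J" for c l
  proof -
    have "prj l \<cdot> (\<Sum>j\<in>?J. scl M (c j) (inc j)) = (\<Sum>j\<in>?J. scl M (c j) (prj l \<cdot> inc j))"
    proof -
      have p: "prj l \<in> Hom M N (S k)" and i: "inc j \<in> Hom M (S k) N" if "j \<in> ?J" for j
        using l that D'(2)[of j] D'(3)[of l] by auto
      show ?thesis
        using cmp_sum_right[OF p[OF l] scl_in[OF i], of ?J "\<lambda>j. j" c] cmp_scl_right[OF i p[OF l]] by simp
    qed
    also have "\<dots> = (\<Sum>j\<in>?J. if j = l then scl M (c j) (idm M (S k)) else 0)"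
      using l by (intro sum.cong) (auto simp: D'(4))
    finally show ?thesis using l by simp
  qed
  show indep: "\<forall>j\<in>?J. c j = 0" if "(\<Sum>j\<in>?J. scl M (c j) (inc j)) = 0" for c
    using coord[of _ c] that cmp_zero_right[OF D'(3)] id_nonzero_if_simple[OF simple_S[OF k]] by auto
  show "inj_on inc ?J"
  proof (rule inj_onI)
    fix j l assume jl: "j \<in> ?J" "l \<in> ?J" "inc j = inc l"
    then have "prj j \<cdot> inc l = idm M (S k)" using D'(4)[of j j] by auto
    then show "j = l"
      using jl D'(4)[of j l] id_nonzero_if_simple[OF simple_S[OF k]] by (auto split: if_splits)
  qed
  have comb: "g = (\<Sum>l\<in>?J. scl M (sc k (prj l \<cdot> g)) (inc l))" if g: "g \<in> Hom M (S k) N" for g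
  proof -
    have "inc l \<cdot> prj l \<cdot> g = (if l \<in> ?J then scl M (sc k (prj l \<cdot> g)) (inc l) else 0)" if l: "l < n" for l
    proof (cases "\<sigma> l = k")
      case True
      have e: "prj l \<cdot> g \<in> Hom M (S k) (S k)"
        using D'(3)[OF l] g True cmp_in by auto
      have i: "inc l \<in> Hom M (S k) N"
        using D'(2)[OF l] True by simp
      have "inc l \<cdot> prj l \<cdot> g = inc l \<cdot> scl M (sc k (prj l \<cdot> g)) (idm M (S k))"
        using scl_sc[OF k e] by simp
      also have "\<dots> = scl M (sc k (prj l \<cdot> g)) (inc l)"
        using cmp_scl_right[OF id_in i] id_right[OF i] by simp
      finally show ?thesis using l True by simp
    next
      case False
      then have "prj l \<cdot> g = 0"
        using Hom_S_zero[OF k D'(1)[OF l] _ cmp_in[OF g D'(3)[OF l]]] by auto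
      then show ?thesis
        using False cmp_zero_right[OF D'(2)[OF l]] by simp
    qed
    then have "(\<Sum>l<n. inc l \<cdot> prj l \<cdot> g)
        = (\<Sum>l<n. if l \<in> ?J then scl M (sc k (prj l \<cdot> g)) (inc l) else 0)"
      by (intro sum.cong) auto
    also have "\<dots> = (\<Sum>l\<in>?J. scl M (sc k (prj l \<cdot> g)) (inc l))"
      by (intro sum.mono_neutral_cong_right) auto
    finally show ?thesis
      using expand_target[OF D g] by simp
  qed
  show "span (inc ` ?J) = Hom M (S k) N"
  proof
    show "span (inc ` ?J) \<subseteq> Hom M (S k) N"
      using D'(2) by (intro span_minimal Hom_subspace) auto
    show "Hom M (S k) N \<subseteq> span (inc ` ?J)"
    proof
      fix g assume "g \<in> Hom M (S k) N"
      from comb[OF this] show "g \<in> span (inc ` ?J)"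
        by (subst \<open>g = _\<close>) (intro span_sum span_scale span_base, simp)
    qed
  qed
  show "f \<cdot> inc l = (\<Sum>j\<in>?J. scl M (?t j l) (inc j))" if "l \<in> ?J" for l
    using comb[OF cmp_in[OF _ f], of "inc l"] that D'(2)[of l] by auto
  show "f \<cdot> (x + y) = (f \<cdot> x) + (f \<cdot> y)" if "x \<in> Hom M (S k) N" "y \<in> Hom M (S k) N" for x y
    using cmp_add_right that f by blast
  show "f \<cdot> scl M c x = scl M c (f \<cdot> x)" if "x \<in> Hom M (S k) N" for c x
    using cmp_scl_right that f by blast
  show "f \<cdot> x \<in> Hom M (S k) N" if "x \<in> Hom M (S k) N" for x
    using cmp_in that f by blast
qed

text \<open>
  The weighted trace of a module category depends only on the underlying linear category; this is its formula
  there.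
\<close>

definition wtrace :: "('i \<Rightarrow> 'k) \<Rightarrow> 'p \<Rightarrow> 'b \<Rightarrow> 'k" where
  "wtrace m N f = (\<Sum>i\<in>I. m i * trace_on (Hom M (S i) N) (\<lambda>g. f \<cdot> g))"

text \<open>
  Each summand of \<open>N\<close> is counted once, with the weight of its isomorphism class.
\<close>

lemma wtrace_decomposition:
  assumes D: "decomposes N n \<sigma> inc prj" and f: "f \<in> Hom M N N"
  shows "wtrace m N f = (\<Sum>l<n. m (\<sigma> l) * sc (\<sigma> l) (prj l \<cdot> f \<cdot> inc l))"
proof -
  have "wtrace m N f
      = (\<Sum>k\<in>I. \<Sum>l\<in>{l. l \<in> {..<n} \<and> \<sigma> l = k}. m (\<sigma> l) * sc (\<sigma> l) (prj l \<cdot> f \<cdot> inc l))"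
    unfolding wtrace_def
    by (intro sum.cong refl) (auto simp: trace_on_Hom_S[OF D f] sum_distrib_left)
  also have "\<dots> = (\<Sum>l<n. m (\<sigma> l) * sc (\<sigma> l) (prj l \<cdot> f \<cdot> inc l))"
    using decomposesD(1)[OF D] by (intro sum.group finite_I) auto
  finally show ?thesis .
qed

lemma wtrace_add:
  assumes "f \<in> Hom M N N" "g \<in> Hom M N N"
  shows "wtrace m N (f + g) = wtrace m N f + wtrace m N g"
proof -
  obtain n \<sigma> inc prj where D: "decomposes N n \<sigma> inc prj"
    using decomposition_exists by blast
  note D' = decomposesD[OF D]
  have "sc (\<sigma> l) (prj l \<cdot> (f + g) \<cdot> inc l) = sc (\<sigma> l) (prj l \<cdot> f \<cdot> inc l) + sc (\<sigma> l) (prj l \<cdot> g \<cdot> inc l)"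
    if l: "l < n" for l
  proof -
    note t = D'(1-3)[OF l] cmp_in[OF D'(2)[OF l] assms(1)] cmp_in[OF D'(2)[OF l] assms(2)]
    show ?thesis
      using cmp_add_left[OF t(2) assms] cmp_add_right[OF t(4,5,3)]
        sc_add[OF t(1) cmp_in[OF t(4,3)] cmp_in[OF t(5,3)]] by simp
  qed
  then show ?thesis
    using assms by (simp add: wtrace_decomposition[OF D] add_in algebra_simps flip: sum.distrib)
qed

lemma wtrace_scl:
  assumes "f \<in> Hom M N N"
  shows "wtrace m N (scl M c f) = c * wtrace m N f"
proof -
  obtain n \<sigma> inc prj where D: "decomposes N n \<sigma> inc prj"
    using decomposition_exists by blast
  note D' = decomposesD[OF D]
  have "sc (\<sigma> l) (prj l \<cdot> scl M c f \<cdot> inc l) = c * sc (\<sigma> l) (prj l \<cdot> f \<cdot> inc l)"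
    if l: "l < n" for l
  proof -
    note t = D'(1-3)[OF l] cmp_in[OF D'(2)[OF l] assms(1)]
    show ?thesis
      using cmp_scl_left[OF t(2) assms] cmp_scl_right[OF t(4,3)] sc_scl[OF t(1) cmp_in[OF t(4,3)]] by simp
  qed
  then show ?thesis
    using assms by (simp add: wtrace_decomposition[OF D] scl_in sum_distrib_left mult.left_commute)
qed

text \<open>
  With decompositions of both objects, the two sides are double sums over pairs of summands, and they agree
  term by term by \<open>sc_swap\<close>.
\<close>

lemma wtrace_cyclic:
  assumes u: "u \<in> Hom M L N" and v: "v \<in> Hom M N L"
  shows "wtrace m N (u \<cdot> v) = wtrace m L (v \<cdot> u)"
proof -
  obtain n \<sigma> inc prj where D: "decomposes N n \<sigma> inc prj"
    using decomposition_exists by blast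
  obtain n' \<sigma>' inc' prj' where E: "decomposes L n' \<sigma>' inc' prj'"
    using decomposition_exists by blast
  note D' = decomposesD[OF D] and E' = decomposesD[OF E]
  let ?a = "\<lambda>l k. prj l \<cdot> u \<cdot> inc' k"
  let ?b = "\<lambda>l k. prj' k \<cdot> v \<cdot> inc l"
  have a: "?a l k \<in> Hom M (S (\<sigma>' k)) (S (\<sigma> l))" and b: "?b l k \<in> Hom M (S (\<sigma> l)) (S (\<sigma>' k))"
    if "l < n" "k < n'" for l k
    using that D'(2,3) E'(2,3) u v by (blast intro: cmp_in)+
  have uv: "prj l \<cdot> (u \<cdot> v) \<cdot> inc l = (\<Sum>k<n'. ?a l k \<cdot> ?b l k)" if l: "l < n" for l
  proof -
    note t = D'(2,3)[OF l]
    have "prj l \<cdot> (u \<cdot> v) \<cdot> inc l = (prj l \<cdot> u) \<cdot> v \<cdot> inc l"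
      using cmp_assoc[OF t(1) v u] cmp_assoc[OF cmp_in[OF t(1) v] u t(2)] by simp
    also have "\<dots> = (\<Sum>k<n'. ?a l k \<cdot> ?b l k)"
      unfolding cmp_through[OF E cmp_in[OF u t(2)] cmp_in[OF t(1) v]]
      using cmp_assoc[OF E'(2) u t(2)] by (intro sum.cong) auto
    finally show ?thesis .
  qed
  have vu: "prj' k \<cdot> (v \<cdot> u) \<cdot> inc' k = (\<Sum>l<n. ?b l k \<cdot> ?a l k)" if k: "k < n'" for k
  proof -
    note t = E'(2,3)[OF k]
    have "prj' k \<cdot> (v \<cdot> u) \<cdot> inc' k = (prj' k \<cdot> v) \<cdot> u \<cdot> inc' k"
      using cmp_assoc[OF t(1) u v] cmp_assoc[OF cmp_in[OF t(1) u] v t(2)] by simp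
    also have "\<dots> = (\<Sum>l<n. ?b l k \<cdot> ?a l k)"
      unfolding cmp_through[OF D cmp_in[OF v t(2)] cmp_in[OF t(1) u]]
      using cmp_assoc[OF D'(2) v t(2)] by (intro sum.cong) auto
    finally show ?thesis .
  qed
  have "wtrace m N (u \<cdot> v)
      = (\<Sum>l<n. m (\<sigma> l) * sc (\<sigma> l) (\<Sum>k<n'. ?a l k \<cdot> ?b l k))"
    by (simp add: wtrace_decomposition[OF D cmp_in[OF v u]] uv)
  also have "\<dots> = (\<Sum>l<n. \<Sum>k<n'. m (\<sigma> l) * sc (\<sigma> l) (?a l k \<cdot> ?b l k))"
  proof (rule sum.cong[OF refl])
    fix l assume l: "l \<in> {..<n}"
    then have "sc (\<sigma> l) (\<Sum>k<n'. ?a l k \<cdot> ?b l k) = (\<Sum>k<n'. sc (\<sigma> l) (?a l k \<cdot> ?b l k))"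
      by (intro sc_sum) (auto intro: D'(1) cmp_in[OF b a])
    then show "m (\<sigma> l) * sc (\<sigma> l) (\<Sum>k<n'. ?a l k \<cdot> ?b l k)
        = (\<Sum>k<n'. m (\<sigma> l) * sc (\<sigma> l) (?a l k \<cdot> ?b l k))"
      by (simp add: sum_distrib_left)
  qed
  also have "\<dots> = (\<Sum>l<n. \<Sum>k<n'. m (\<sigma>' k) * sc (\<sigma>' k) (?b l k \<cdot> ?a l k))"
    by (intro sum.cong refl sc_swap) (auto simp: D'(1) E'(1) a b)
  also have "\<dots> = (\<Sum>k<n'. \<Sum>l<n. m (\<sigma>' k) * sc (\<sigma>' k) (?b l k \<cdot> ?a l k))"
    by (rule sum.swap)
  also have "\<dots> = (\<Sum>k<n'. m (\<sigma>' k) * sc (\<sigma>' k) (\<Sum>l<n. ?b l k \<cdot> ?a l k))"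
  proof (rule sum.cong[OF refl])
    fix k assume k: "k \<in> {..<n'}"
    then have "sc (\<sigma>' k) (\<Sum>l<n. ?b l k \<cdot> ?a l k) = (\<Sum>l<n. sc (\<sigma>' k) (?b l k \<cdot> ?a l k))"
      by (intro sc_sum) (auto intro: E'(1) cmp_in[OF a b])
    then show "(\<Sum>l<n. m (\<sigma>' k) * sc (\<sigma>' k) (?b l k \<cdot> ?a l k))
        = m (\<sigma>' k) * sc (\<sigma>' k) (\<Sum>l<n. ?b l k \<cdot> ?a l k)"
      by (simp add: sum_distrib_left)
  qed
  also have "\<dots> = wtrace m L (v \<cdot> u)"
    by (simp add: wtrace_decomposition[OF E cmp_in[OF u v]] vu)
  finally show ?thesis .
qed

lemma decomposes_S: "i \<in> I \<Longrightarrow> decomposes (S i) 1 (\<lambda>_. i) (\<lambda>_. idm M (S i)) (\<lambda>_. idm M (S i))"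
  unfolding decomposes_def direct_sum_def by (auto simp: id_in id_left[OF id_in])

lemma wtrace_S:
  assumes "i \<in> I" "e \<in> Hom M (S i) (S i)"
  shows "wtrace m (S i) e = m i * sc i e"
  using wtrace_decomposition[OF decomposes_S[OF assms(1)] assms(2)] assms
  by (simp add: id_left id_right)

section \<open>The trace pairing\<close>

abbreviation tr :: "'p \<Rightarrow> 'b \<Rightarrow> 'k" where
  "tr \<equiv> wtrace (\<lambda>_. 1)"

lemma wtrace_zero: "wtrace m N 0 = 0"
  using wtrace_scl[OF zero_in, of m N 0] by simp

lemma wtrace_sum:
  assumes "\<And>j. j \<in> J \<Longrightarrow> f j \<in> Hom M N N"
  shows "wtrace m N (\<Sum>j\<in>J. f j) = (\<Sum>j\<in>J. wtrace m N (f j))"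
  using assms
  by (induction J rule: infinite_finite_induct) (simp_all add: wtrace_zero wtrace_add sum_in)

text \<open>
  Matrix units: a basis of \<open>Hom(A,B)\<close> consists of the maps from a summand of \<open>A\<close> to an equal summand of \<open>B\<close>, and
  its dual basis for the trace pairing consists of the maps in the opposite direction. Nondegeneracy and the
  representation of functionals both follow from this expansion.
\<close>

lemma dual_bases:
  obtains P :: "(nat \<times> nat) set" and b d where "finite P"
    and "\<And>x. x \<in> P \<Longrightarrow> b x \<in> Hom M A B" and "\<And>x. x \<in> P \<Longrightarrow> d x \<in> Hom M B A"
    and "\<And>h. h \<in> Hom M A B \<Longrightarrow> h = (\<Sum>x\<in>P. scl M (tr A (d x \<cdot> h)) (b x))"
proof -
  obtain n \<sigma> inc prj where D: "decomposes A n \<sigma> inc prj"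
    using decomposition_exists by blast
  obtain n' \<sigma>' inc' prj' where E: "decomposes B n' \<sigma>' inc' prj'"
    using decomposition_exists by blast
  note D' = decomposesD[OF D] and E' = decomposesD[OF E]
  \<comment> \<open>The first component indexes the summands of \<open>B\<close>, the second those of \<open>A\<close>.\<close>
  define P where "P = {x \<in> {..<n'} \<times> {..<n}. \<sigma>' (fst x) = \<sigma> (snd x)}"
  define b where "b x = inc' (fst x) \<cdot> prj (snd x)" for x
  define d where "d x = inc (snd x) \<cdot> prj' (fst x)" for x
  have x: "fst x < n'" "snd x < n" "\<sigma>' (fst x) = \<sigma> (snd x)" if "x \<in> P" for x
    using that by (auto simp: P_def)
  have b: "b x \<in> Hom M A B" if "x \<in> P" for x
    unfolding b_def using cmp_in[OF D'(3)[OF x(2)[OF that]]] E'(2)[OF x(1)[OF that]] x(3)[OF that] by simp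
  have d: "d x \<in> Hom M B A" if "x \<in> P" for x
    unfolding d_def using cmp_in[OF E'(3)[OF x(1)[OF that]]] D'(2)[OF x(2)[OF that]] x(3)[OF that] by simp
  have expand: "h = (\<Sum>x\<in>P. scl M (tr A (d x \<cdot> h)) (b x))" if h: "h \<in> Hom M A B" for h
  proof -
    have step: "inc' k \<cdot> ((prj' k \<cdot> h) \<cdot> inc l) \<cdot> prj l
        = (if (k, l) \<in> P then scl M (tr A (d (k, l) \<cdot> h)) (b (k, l)) else 0)"
      if k: "k < n'" and l: "l < n" for k l
    proof -
      note e = cmp_in[OF D'(2)[OF l] cmp_in[OF h E'(3)[OF k]]]
      show ?thesis
      proof (cases "\<sigma>' k = \<sigma> l")
        case True
        note i = D'(1,2,3)[OF l] and i' = E'(2,3)[OF k, unfolded True]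
        note e' = e[unfolded True]
        have "tr A (d (k, l) \<cdot> h) = tr A (inc l \<cdot> (prj' k \<cdot> h))"
          using cmp_assoc[OF h i'(2) i(2)] by (simp add: d_def)
        also have "\<dots> = sc (\<sigma> l) ((prj' k \<cdot> h) \<cdot> inc l)"
          using wtrace_cyclic[OF i(2) cmp_in[OF h i'(2)]] wtrace_S[OF i(1) e'] by simp
        finally have "scl M (tr A (d (k, l) \<cdot> h)) (idm M (S (\<sigma> l))) = (prj' k \<cdot> h) \<cdot> inc l"
          using scl_sc[OF i(1) e'] by simp
        then have "inc' k \<cdot> ((prj' k \<cdot> h) \<cdot> inc l) \<cdot> prj l = scl M (tr A (d (k, l) \<cdot> h)) (inc' k \<cdot> prj l)"
          using cmp_scl_left[OF i(3) id_in] id_left[OF i(3)] cmp_scl_right[OF i(3) i'(1)]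
          by (metis i(1))
        then show ?thesis using True k l by (simp add: P_def b_def)
      next
        case False
        then have "(prj' k \<cdot> h) \<cdot> inc l = 0"
          using Hom_S_zero[OF D'(1)[OF l] E'(1)[OF k] _ e] by metis
        then show ?thesis
          using False cmp_zero_left[OF D'(3)[OF l]] cmp_zero_right[OF E'(2)[OF k]] by (simp add: P_def)
      qed
    qed
    have "h = (\<Sum>k<n'. inc' k \<cdot> prj' k \<cdot> h)"
      by (rule expand_target[OF E h])
    also have "\<dots> = (\<Sum>k<n'. \<Sum>l<n. inc' k \<cdot> ((prj' k \<cdot> h) \<cdot> inc l) \<cdot> prj l)"
    proof (rule sum.cong[OF refl])
      fix k assume "k \<in> {..<n'}"
      then have k: "k < n'" by simp
      note p = cmp_in[OF h E'(3)[OF k]]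
      have "inc' k \<cdot> prj' k \<cdot> h = inc' k \<cdot> (\<Sum>l<n. ((prj' k \<cdot> h) \<cdot> inc l) \<cdot> prj l)"
        using expand_source[OF D p] by simp
      also have "\<dots> = (\<Sum>l<n. inc' k \<cdot> ((prj' k \<cdot> h) \<cdot> inc l) \<cdot> prj l)"
        using cmp_in[OF D'(3) cmp_in[OF D'(2) p]] by (intro cmp_sum_right[OF E'(2)[OF k]]) simp
      finally show "inc' k \<cdot> prj' k \<cdot> h = (\<Sum>l<n. inc' k \<cdot> ((prj' k \<cdot> h) \<cdot> inc l) \<cdot> prj l)" .
    qed
    also have "\<dots> = (\<Sum>x\<in>{..<n'} \<times> {..<n}. if x \<in> P then scl M (tr A (d x \<cdot> h)) (b x) else 0)"
      unfolding sum.cartesian_product by (rule sum.cong) (auto simp: step)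
    also have "\<dots> = (\<Sum>x\<in>P. scl M (tr A (d x \<cdot> h)) (b x))"
      by (rule sum.mono_neutral_cong_right) (auto simp: P_def)
    finally show ?thesis .
  qed
  have "finite P" by (simp add: P_def)
  from that[OF this b d expand] show ?thesis .
qed

lemma tr_nondegenerate:
  assumes u: "u \<in> Hom M B A" and zero: "\<And>h. h \<in> Hom M A B \<Longrightarrow> tr A (u \<cdot> h) = 0"
  shows "u = 0"
proof (rule dual_bases[of B A])
  fix P :: "(nat \<times> nat) set" and b d
  assume d: "\<And>x. x \<in> P \<Longrightarrow> d x \<in> Hom M A B"
    and u_eq: "\<And>h. h \<in> Hom M B A \<Longrightarrow> h = (\<Sum>x\<in>P. scl M (tr B (d x \<cdot> h)) (b x))"
  have "tr B (d x \<cdot> u) = 0" if "x \<in> P" for x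
    using wtrace_cyclic[OF d[OF that] u] zero[OF d[OF that]] by simp
  then show ?thesis
    using u_eq[OF u] by simp
qed

lemma tr_eqI:
  assumes "u \<in> Hom M B A" "u' \<in> Hom M B A"
    and eq: "\<And>h. h \<in> Hom M A B \<Longrightarrow> tr A (u \<cdot> h) = tr A (u' \<cdot> h)"
  shows "u = u'"
proof -
  have "u - u' = 0"
  proof (rule tr_nondegenerate[OF diff_in[OF assms(1,2)]])
    fix h assume h: "h \<in> Hom M A B"
    have "tr A ((u - u') \<cdot> h) + tr A (u' \<cdot> h) = tr A (((u - u') \<cdot> h) + (u' \<cdot> h))"
      using wtrace_add[OF cmp_in[OF h diff_in[OF assms(1,2)]] cmp_in[OF h assms(2)]] by simp
    also have "\<dots> = tr A (u \<cdot> h)"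
      using cmp_diff_left[OF h assms(1,2)] by simp
    finally show "tr A ((u - u') \<cdot> h) = 0"
      using eq[OF h] by simp
  qed
  then show ?thesis by simp
qed

text \<open>
  Riesz representation for the trace pairing; for linear \<open>phi\<close> the choice is unique by \<open>tr_eqI\<close>.
\<close>

definition trace_dual :: "'p \<Rightarrow> 'p \<Rightarrow> ('b \<Rightarrow> 'k) \<Rightarrow> 'b" where
  "trace_dual A B phi = (SOME u. u \<in> Hom M B A \<and> (\<forall>h\<in>Hom M A B. tr A (u \<cdot> h) = phi h))"

lemma trace_dual:
  assumes add: "\<And>h h'. \<lbrakk>h \<in> Hom M A B; h' \<in> Hom M A B\<rbrakk> \<Longrightarrow> phi (h + h') = phi h + phi h'"
    and scl: "\<And>c h. h \<in> Hom M A B \<Longrightarrow> phi (scl M c h) = c * phi h"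
  shows "trace_dual A B phi \<in> Hom M B A"
    and "h \<in> Hom M A B \<Longrightarrow> tr A (trace_dual A B phi \<cdot> h) = phi h"
proof (atomize (full), rule dual_bases[of A B])
  fix P :: "(nat \<times> nat) set" and b d
  assume P: "finite P"
    and b: "\<And>x. x \<in> P \<Longrightarrow> b x \<in> Hom M A B" and d: "\<And>x. x \<in> P \<Longrightarrow> d x \<in> Hom M B A"
    and expand: "\<And>h. h \<in> Hom M A B \<Longrightarrow> h = (\<Sum>x\<in>P. scl M (tr A (d x \<cdot> h)) (b x))"
  define u where "u = (\<Sum>x\<in>P. scl M (phi (b x)) (d x))"
  have u: "u \<in> Hom M B A"
    unfolding u_def by (intro sum_in scl_in d)
  have phi_sum: "phi (\<Sum>x\<in>Q. scl M (c x) (b x)) = (\<Sum>x\<in>Q. c x * phi (b x))" if "Q \<subseteq> P" for Q c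
    using finite_subset[OF that P] that
  proof (induction Q rule: finite_induct)
    case empty
    then show ?case using scl[OF zero_in, of 0] by simp
  next
    case (insert x Q)
    then have "(\<Sum>x\<in>Q. scl M (c x) (b x)) \<in> Hom M A B"
      using b by (intro sum_in scl_in) auto
    with insert show ?case
      using add[OF scl_in[OF b[of x]], of "\<Sum>x\<in>Q. scl M (c x) (b x)" "c x"] scl[OF b[of x]] by simp
  qed
  have "tr A (u \<cdot> h) = phi h" if h: "h \<in> Hom M A B" for h
  proof -
    have "u \<cdot> h = (\<Sum>x\<in>P. scl M (phi (b x)) (d x) \<cdot> h)"
      unfolding u_def by (rule cmp_sum_left[OF h scl_in[OF d]])
    also have "\<dots> = (\<Sum>x\<in>P. scl M (phi (b x)) (d x \<cdot> h))"
      by (intro sum.cong refl cmp_scl_left[OF h d])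
    finally have "tr A (u \<cdot> h) = (\<Sum>x\<in>P. tr A (scl M (phi (b x)) (d x \<cdot> h)))"
      using wtrace_sum[OF scl_in[OF cmp_in[OF h d]], of P "\<lambda>x. x" "\<lambda>_. 1" "\<lambda>x. phi (b x)"] by simp
    also have "\<dots> = (\<Sum>x\<in>P. tr A (d x \<cdot> h) * phi (b x))"
      by (intro sum.cong refl) (simp add: wtrace_scl[OF cmp_in[OF h d]] mult.commute)
    also have "\<dots> = phi h"
      using phi_sum[OF order_refl, of "\<lambda>x. tr A (d x \<cdot> h)"] arg_cong[OF expand[OF h], of phi] by simp
    finally show ?thesis .
  qed
  with u have "\<exists>u. u \<in> Hom M B A \<and> (\<forall>h\<in>Hom M A B. tr A (u \<cdot> h) = phi h)"
    by blast
  from someI_ex[OF this]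
  show "trace_dual A B phi \<in> Hom M B A
      \<and> (h \<in> Hom M A B \<longrightarrow> tr A (trace_dual A B phi \<cdot> h) = phi h)"
    unfolding trace_dual_def by blast
qed

section \<open>Natural endomorphisms of the identity functor\<close>

definition natural_endo :: "('p \<Rightarrow> 'b) \<Rightarrow> bool" where
  "natural_endo \<eta> \<longleftrightarrow>
     (\<forall>N. \<eta> N \<in> Hom M N N) \<and> (\<forall>N N'. \<forall>h\<in>Hom M N N'. \<eta> N' \<cdot> h = h \<cdot> \<eta> N)"

lemma natural_endo_eqI:
  assumes \<eta>: "natural_endo \<eta>" and \<theta>: "natural_endo \<theta>" and eq: "\<And>i. i \<in> I \<Longrightarrow> \<eta> (S i) = \<theta> (S i)"
  shows "\<eta> N = \<theta> N"
proof -
  obtain n \<sigma> inc prj where D: "decomposes N n \<sigma> inc prj"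
    using decomposition_exists by blast
  note D' = decomposesD[OF D]
  have "\<eta> N \<cdot> inc l = \<theta> N \<cdot> inc l" if l: "l < n" for l
    using \<eta> \<theta> eq[OF D'(1)[OF l]] D'(2)[OF l] unfolding natural_endo_def by auto
  then have "(\<Sum>l<n. (\<eta> N \<cdot> inc l) \<cdot> prj l) = (\<Sum>l<n. (\<theta> N \<cdot> inc l) \<cdot> prj l)"
    by simp
  then show ?thesis
    using expand_source[OF D] \<eta> \<theta> unfolding natural_endo_def by metis
qed

text \<open>
  The natural endomorphism of the identity functor with eigenvalue \<open>m i\<close> on \<open>S i\<close>. Defining it as the
  representative of the trace with weights \<open>m\<close> makes the relation to weighted traces immediate, and the
  eigenvalues are found in \<open>scaling_S\<close>.
\<close>

definition scaling :: "('i \<Rightarrow> 'k) \<Rightarrow> 'p \<Rightarrow> 'b" where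
  "scaling m N = trace_dual N N (wtrace m N)"

lemma scaling_in: "scaling m N \<in> Hom M N N"
  and wtrace_eq_tr_scaling: "f \<in> Hom M N N \<Longrightarrow> wtrace m N f = tr N (scaling m N \<cdot> f)"
  unfolding scaling_def using trace_dual[of N N "wtrace m N"] by (simp_all add: wtrace_add wtrace_scl)

text \<open>
  Both sides have the same pairing with every \<open>k : N' \<rightarrow> N\<close>: cyclicity holds for the trace with weights \<open>m\<close> and
  for \<open>tr\<close>, and moves \<open>k\<close> to the other side of \<open>h\<close>.
\<close>

lemma scaling_natural:
  assumes h: "h \<in> Hom M N N'"
  shows "scaling m N' \<cdot> h = h \<cdot> scaling m N"
proof (rule tr_eqI[OF cmp_in[OF h scaling_in] cmp_in[OF scaling_in h]])
  fix k assume k: "k \<in> Hom M N' N"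
  have "tr N' ((scaling m N' \<cdot> h) \<cdot> k) = wtrace m N' (h \<cdot> k)"
    using wtrace_eq_tr_scaling[OF cmp_in[OF k h]] cmp_assoc[OF k h scaling_in] by simp
  also have "\<dots> = tr N ((scaling m N \<cdot> k) \<cdot> h)"
    using wtrace_cyclic[OF h k] wtrace_eq_tr_scaling[OF cmp_in[OF h k]] cmp_assoc[OF h k scaling_in] by simp
  also have "\<dots> = tr N' ((h \<cdot> scaling m N) \<cdot> k)"
    using wtrace_cyclic[OF cmp_in[OF k scaling_in] h] cmp_assoc[OF k scaling_in h] by simp
  finally show "tr N' ((scaling m N' \<cdot> h) \<cdot> k) = tr N' ((h \<cdot> scaling m N) \<cdot> k)" .
qed

lemma natural_endo_scaling: "natural_endo (scaling m)"
  unfolding natural_endo_def using scaling_in scaling_natural by blast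

lemma scaling_S:
  assumes i: "i \<in> I"
  shows "scaling m (S i) = scl M (m i) (idm M (S i))"
proof (rule tr_eqI[OF scaling_in scl_in[OF id_in]])
  fix f assume f: "f \<in> Hom M (S i) (S i)"
  then show "tr (S i) (scaling m (S i) \<cdot> f) = tr (S i) (scl M (m i) (idm M (S i)) \<cdot> f)"
    using wtrace_eq_tr_scaling[OF f, of m] cmp_scl_left[OF f id_in] id_left[OF f]
    by (simp add: wtrace_S[OF i] wtrace_scl)
qed

lemma scaling_mult: "scaling m N \<cdot> scaling m' N = scaling (\<lambda>i. m i * m' i) N"
proof (rule natural_endo_eqI)
  show "natural_endo (\<lambda>N. scaling m N \<cdot> scaling m' N)"
    unfolding natural_endo_def
  proof (intro conjI allI ballI)
    show "scaling m N \<cdot> scaling m' N \<in> Hom M N N" for N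
      using cmp_in scaling_in by blast
    fix N N' h assume h: "h \<in> Hom M N N'"
    have "(scaling m N' \<cdot> scaling m' N') \<cdot> h = (scaling m N' \<cdot> h) \<cdot> scaling m' N"
      using cmp_assoc[OF h scaling_in scaling_in] cmp_assoc[OF scaling_in h scaling_in] scaling_natural[OF h] by simp
    then show "(scaling m N' \<cdot> scaling m' N') \<cdot> h = h \<cdot> scaling m N \<cdot> scaling m' N"
      using cmp_assoc[OF scaling_in scaling_in h] scaling_natural[OF h] by simp
  qed
  show "scaling m (S i) \<cdot> scaling m' (S i) = scaling (\<lambda>i. m i * m' i) (S i)" if "i \<in> I" for i
    using that cmp_scl_left[OF scl_in[OF id_in] id_in] id_left[OF scl_in[OF id_in]] by (simp add: scaling_S)
qed (rule natural_endo_scaling)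

lemma scaling_cong: "(\<And>i. i \<in> I \<Longrightarrow> m i = m' i) \<Longrightarrow> scaling m N = scaling m' N"
  by (rule natural_endo_eqI[OF natural_endo_scaling natural_endo_scaling]) (simp add: scaling_S)

lemma scaling_one: "scaling (\<lambda>_. 1) N = idm M N"
proof (rule natural_endo_eqI[OF natural_endo_scaling])
  have "idm M N' \<cdot> h = h \<cdot> idm M N" if "h \<in> Hom M N N'" for N N' h
    using id_left[OF that] id_right[OF that] by simp
  then show "natural_endo (idm M)"
    unfolding natural_endo_def using id_in by blast
qed (simp add: scaling_S)

lemma natural_endo_is_scaling:
  assumes \<eta>: "natural_endo \<eta>"
  shows "\<eta> N = scaling (\<lambda>i. sc i (\<eta> (S i))) N"
proof (rule natural_endo_eqI[OF \<eta> natural_endo_scaling])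
  have "\<eta> (S i) \<in> Hom M (S i) (S i)" for i
    using \<eta> unfolding natural_endo_def by blast
  then show "\<eta> (S i) = scaling (\<lambda>i. sc i (\<eta> (S i))) (S i)" if "i \<in> I" for i
    using that by (simp add: scaling_S scl_sc)
qed

lemma inverses_scaling:
  assumes "\<And>i. i \<in> I \<Longrightarrow> m i \<noteq> 0"
  shows "inverses M N N (scaling m N) (scaling (\<lambda>i. inverse (m i)) N)"
proof -
  have "scaling (\<lambda>i. inverse (m i) * m i) N = scaling (\<lambda>_. 1) N" "scaling (\<lambda>i. m i * inverse (m i)) N = scaling (\<lambda>_. 1) N"
    using assms by (intro scaling_cong; simp)+
  then show ?thesis
    unfolding inverses_def by (simp add: scaling_in scaling_mult scaling_one)
qed

lemma simple_exists:
  assumes "\<not> is_zero_obj M N"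
  shows "I \<noteq> {}"
proof -
  obtain n \<sigma> inc prj where D: "decomposes N n \<sigma> inc prj"
    using decomposition_exists by blast
  have "n \<noteq> 0"
    using decomposesD(5)[OF D] zero_obj_if_id_zero[of N] assms by (intro notI) simp
  then show ?thesis using decomposesD(1)[OF D, of 0] by auto
qed

end

section \<open>Coherence in module categories\<close>

context module_category
begin

lemmas arrow_types = C.id_in M.id_in C.zero_in M.zero_in
  C.is_iso_in[OF C.asc_iso] C.is_iso_in[OF C.lun_iso] C.is_iso_in[OF C.run_iso]
  M.is_iso_in[OF mas_iso] M.is_iso_in[OF mun_iso] actm_in C.tar_in C.cmp_in M.cmp_in

lemma ev_in: "ev C X \<in> Hom C (dual C X \<otimes>\<^bsub>C\<^esub> X) \<one>\<^bsub>C\<^esub>"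
  and coev_in: "coev C X \<in> Hom C \<one>\<^bsub>C\<^esub> (X \<otimes>\<^bsub>C\<^esub> dual C X)"
  using C.left_dual unfolding is_left_dual_def by blast+

lemma act_cmp_right:
  "\<lbrakk>h \<in> Hom M N N'; h' \<in> Hom M N' N''\<rbrakk>
    \<Longrightarrow> idm C X \<unrhd> (h' \<cdot> h) = (idm C X \<unrhd> h') \<cdot> (idm C X \<unrhd> h)"
  using actm_cmp[OF C.id_in C.id_in, of h N N' h' N'' X] C.id_left[OF C.id_in, of X] by simp

lemma act_cmp_left:
  "\<lbrakk>f \<in> Hom C X X'; f' \<in> Hom C X' X''\<rbrakk>
    \<Longrightarrow> (f' \<cdot>\<^bsub>C\<^esub> f) \<unrhd> idm M N = (f' \<unrhd> idm M N) \<cdot> (f \<unrhd> idm M N)"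
  using actm_cmp[OF _ _ M.id_in M.id_in, of f X X' f' X'' N] M.id_left[OF M.id_in, of N] by simp

lemma act_interchange:
  assumes "f \<in> Hom C X X'" "h \<in> Hom M N N'"
  shows "(f \<unrhd> idm M N') \<cdot> (idm C X \<unrhd> h) = (idm C X' \<unrhd> h) \<cdot> (f \<unrhd> idm M N)"
  using actm_cmp[OF C.id_in assms(1) assms(2) M.id_in] actm_cmp[OF assms(1) C.id_in M.id_in assms(2)]
    C.id_left[OF assms(1)] C.id_right[OF assms(1)] M.id_left[OF assms(2)] M.id_right[OF assms(2)]
  by simp

lemma is_iso_act:
  assumes f: "is_iso C X X' f" and h: "is_iso M N N' h"
  shows "is_iso M (X \<rhd> N) (X' \<rhd> N') (f \<unrhd> h)"
proof -
  note f' = C.is_iso_in[OF f] C.inv_arr_in[OF f] and h' = M.is_iso_in[OF h] M.inv_arr_in[OF h]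
  have "inverses M (X \<rhd> N) (X' \<rhd> N') (f \<unrhd> h) (inv_arr C X X' f \<unrhd> inv_arr M N N' h)"
    unfolding inverses_def
    using actm_in[OF f'(1) h'(1)] actm_in[OF f'(2) h'(2)]
      actm_cmp[OF f' h'] actm_cmp[OF f'(2,1) h'(2,1)]
      C.inv_arr_left[OF f] C.inv_arr_right[OF f] M.inv_arr_left[OF h] M.inv_arr_right[OF h]
    by (simp add: actm_id)
  then show ?thesis unfolding is_iso_def by blast
qed

lemma mas_natural_object:
  assumes "h \<in> Hom M N N'"
  shows "mas M X Y N' \<cdot> (idm C (X \<otimes>\<^bsub>C\<^esub> Y) \<unrhd> h) = (idm C X \<unrhd> (idm C Y \<unrhd> h)) \<cdot> mas M X Y N"
  using mas_natural[OF C.id_in C.id_in assms, of X Y] by (simp add: C.tar_id)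

lemma unit_action_faithful:
  assumes f: "f \<in> Hom M N N'" and g: "g \<in> Hom M N N'"
    and eq: "idm C \<one>\<^bsub>C\<^esub> \<unrhd> f = idm C \<one>\<^bsub>C\<^esub> \<unrhd> g"
  shows "f = g"
proof (rule M.cancel_iso_right[OF mun_iso f g])
  show "f \<cdot> mun M N = g \<cdot> mun M N"
    using mun_natural[OF f] mun_natural[OF g] eq by simp
qed

text \<open>
  Kelly's argument for the unit constraint: the action of \<open>1\<close> is faithful, so it suffices to compare the two
  sides after acting by \<open>1\<close>. There the pentagon and the two triangles identify both with
  \<open>run \<one> \<unrhd> 1\<close>, up to associativity isomorphisms.
\<close>

lemma mun_act: "mun M (X \<rhd> N) \<cdot> mas M \<one>\<^bsub>C\<^esub> X N = lun C X \<unrhd> idm M N"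
proof (rule unit_action_faithful)
  let ?u = "\<one>\<^bsub>C\<^esub>"
  let ?e = "mas M ?u (?u \<otimes>\<^bsub>C\<^esub> X) N \<cdot> (asc C ?u ?u X \<unrhd> idm M N)"
  have asc: "is_iso M (((?u \<otimes>\<^bsub>C\<^esub> ?u) \<otimes>\<^bsub>C\<^esub> X) \<rhd> N) ((?u \<otimes>\<^bsub>C\<^esub> (?u \<otimes>\<^bsub>C\<^esub> X)) \<rhd> N)
      (asc C ?u ?u X \<unrhd> idm M N)"
    by (rule is_iso_act[OF C.asc_iso M.is_iso_id])
  have e: "is_iso M (((?u \<otimes>\<^bsub>C\<^esub> ?u) \<otimes>\<^bsub>C\<^esub> X) \<rhd> N) (?u \<rhd> ((?u \<otimes>\<^bsub>C\<^esub> X) \<rhd> N)) ?e"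
    by (rule M.is_iso_cmp[OF asc mas_iso])
  show t1: "mun M (X \<rhd> N) \<cdot> mas M ?u X N \<in> Hom M ((?u \<otimes>\<^bsub>C\<^esub> X) \<rhd> N) (X \<rhd> N)"
    by (rule arrow_types)+
  show t2: "lun C X \<unrhd> idm M N \<in> Hom M ((?u \<otimes>\<^bsub>C\<^esub> X) \<rhd> N) (X \<rhd> N)"
    by (rule arrow_types)+
  have "(idm C ?u \<unrhd> (mun M (X \<rhd> N) \<cdot> mas M ?u X N)) \<cdot> ?e
      = (idm C ?u \<unrhd> mun M (X \<rhd> N)) \<cdot> (idm C ?u \<unrhd> mas M ?u X N) \<cdot> ?e"
    by (subst act_cmp_right, (rule arrow_types)+, rule M.cmp_assoc, (rule arrow_types)+)
  also have "\<dots> = (idm C ?u \<unrhd> mun M (X \<rhd> N)) \<cdot> mas M ?u ?u (X \<rhd> N) \<cdot> mas M (?u \<otimes>\<^bsub>C\<^esub> ?u) X N"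
    by (simp add: mod_pentagon)
  also have "\<dots> = ((idm C ?u \<unrhd> mun M (X \<rhd> N)) \<cdot> mas M ?u ?u (X \<rhd> N)) \<cdot> mas M (?u \<otimes>\<^bsub>C\<^esub> ?u) X N"
    by (rule M.cmp_assoc[symmetric], (rule arrow_types)+)
  also have "\<dots> = (run C ?u \<unrhd> idm M (X \<rhd> N)) \<cdot> mas M (?u \<otimes>\<^bsub>C\<^esub> ?u) X N"
    by (simp add: mod_triangle)
  also have "\<dots> = mas M ?u X N \<cdot> ((run C ?u \<boxtimes>\<^bsub>C\<^esub> idm C X) \<unrhd> idm M N)"
    using mas_natural[OF C.is_iso_in[OF C.run_iso] C.id_in M.id_in, of ?u X N] by (simp add: actm_id)
  also have "\<dots> = mas M ?u X N \<cdot> (((idm C ?u \<boxtimes>\<^bsub>C\<^esub> lun C X) \<cdot>\<^bsub>C\<^esub> asc C ?u ?u X) \<unrhd> idm M N)"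
    by (simp add: C.triangle)
  also have "\<dots> = mas M ?u X N \<cdot> ((idm C ?u \<boxtimes>\<^bsub>C\<^esub> lun C X) \<unrhd> idm M N) \<cdot> (asc C ?u ?u X \<unrhd> idm M N)"
    by (subst act_cmp_left, (rule arrow_types)+, rule refl)
  also have "\<dots> = (idm C ?u \<unrhd> (lun C X \<unrhd> idm M N)) \<cdot> ?e"
    by (rule M.extend_square, rule mas_natural, (rule arrow_types)+)
  finally show "idm C ?u \<unrhd> (mun M (X \<rhd> N) \<cdot> mas M ?u X N) = idm C ?u \<unrhd> (lun C X \<unrhd> idm M N)"
    by (rule M.cancel_iso_right[OF e actm_in[OF C.id_in t1] actm_in[OF C.id_in t2]])
qed

text \<open>
  This form of the definition, with the inverse moved to the other side, is the one used for rewriting; the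
  same holds for \<open>act_coev_mun\<close>.
\<close>

lemma act_ev_mas:
  "act_ev C M X L \<cdot> mas M (dual C X) X L = mun M L \<cdot> (ev C X \<unrhd> idm M L)"
  and act_ev_in: "act_ev C M X L \<in> Hom M (dual C X \<rhd> (X \<rhd> L)) L"
proof -
  let ?a = "mas M (dual C X) X L"
  note a = mas_iso[of "dual C X" X L]
  note i = M.inv_arr_in[OF a] M.is_iso_in[OF a]
  have e: "ev C X \<unrhd> idm M L \<in> Hom M ((dual C X \<otimes>\<^bsub>C\<^esub> X) \<rhd> L) (\<one>\<^bsub>C\<^esub> \<rhd> L)"
    by (rule actm_in[OF ev_in M.id_in])
  note m = M.is_iso_in[OF mun_iso[of L]]
  show "act_ev C M X L \<in> Hom M (dual C X \<rhd> (X \<rhd> L)) L"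
    unfolding act_ev_def by (rule M.cmp_in i e m)+
  show "act_ev C M X L \<cdot> ?a = mun M L \<cdot> (ev C X \<unrhd> idm M L)"
    unfolding act_ev_def
    using M.cmp_assoc[OF i(2) M.cmp_in[OF i(1) e] m] M.cmp_assoc[OF i(2,1) e]
      M.inv_arr_left[OF a] M.id_right[OF e] by simp
qed

lemma act_coev_mun:
  "act_coev C M X L \<cdot> mun M L = mas M X (dual C X) L \<cdot> (coev C X \<unrhd> idm M L)"
  and act_coev_in: "act_coev C M X L \<in> Hom M L (X \<rhd> (dual C X \<rhd> L))"
proof -
  note m = mun_iso[of L]
  note i = M.inv_arr_in[OF m] M.is_iso_in[OF m]
  have e: "coev C X \<unrhd> idm M L \<in> Hom M (\<one>\<^bsub>C\<^esub> \<rhd> L) ((X \<otimes>\<^bsub>C\<^esub> dual C X) \<rhd> L)"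
    by (rule actm_in[OF coev_in M.id_in])
  note a = M.is_iso_in[OF mas_iso[of X "dual C X" L]]
  show "act_coev C M X L \<in> Hom M L (X \<rhd> (dual C X \<rhd> L))"
    unfolding act_coev_def by (rule M.cmp_in i e a)+
  show "act_coev C M X L \<cdot> mun M L = mas M X (dual C X) L \<cdot> (coev C X \<unrhd> idm M L)"
    unfolding act_coev_def
    using M.cmp_assoc[OF i(2) M.cmp_in[OF i(1) e] a] M.cmp_assoc[OF i(2,1) e]
      M.inv_arr_left[OF m] M.id_right[OF e] by simp
qed

lemma act_ev_natural:
  assumes h: "h \<in> Hom M L L'"
  shows "act_ev C M X L' \<cdot> (idm C (dual C X) \<unrhd> (idm C X \<unrhd> h)) = h \<cdot> act_ev C M X L"
proof (rule M.cancel_iso_right[OF mas_iso])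
  let ?D = "dual C X" and ?u = "\<one>\<^bsub>C\<^esub>"
  note types = h act_ev_in ev_in arrow_types
  show "act_ev C M X L' \<cdot> (idm C ?D \<unrhd> (idm C X \<unrhd> h)) \<in> Hom M (?D \<rhd> (X \<rhd> L)) L'"
    by (rule types)+
  show "h \<cdot> act_ev C M X L \<in> Hom M (?D \<rhd> (X \<rhd> L)) L'"
    by (rule types)+
  have "(act_ev C M X L' \<cdot> (idm C ?D \<unrhd> (idm C X \<unrhd> h))) \<cdot> mas M ?D X L
      = act_ev C M X L' \<cdot> (idm C ?D \<unrhd> (idm C X \<unrhd> h)) \<cdot> mas M ?D X L"
    by (rule M.cmp_assoc, (rule types)+)
  also have "\<dots> = act_ev C M X L' \<cdot> mas M ?D X L' \<cdot> (idm C (?D \<otimes>\<^bsub>C\<^esub> X) \<unrhd> h)"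
    by (simp add: mas_natural_object[OF h])
  also have "\<dots> = mun M L' \<cdot> (ev C X \<unrhd> idm M L') \<cdot> (idm C (?D \<otimes>\<^bsub>C\<^esub> X) \<unrhd> h)"
    by (rule M.extend_square[OF act_ev_mas], (rule types)+)
  also have "\<dots> = mun M L' \<cdot> (idm C ?u \<unrhd> h) \<cdot> (ev C X \<unrhd> idm M L)"
    by (simp add: act_interchange[OF ev_in h])
  also have "\<dots> = h \<cdot> mun M L \<cdot> (ev C X \<unrhd> idm M L)"
    by (rule M.extend_square[OF mun_natural[OF h]], (rule types)+)
  also have "\<dots> = (h \<cdot> act_ev C M X L) \<cdot> mas M ?D X L"
    unfolding act_ev_mas[symmetric] by (rule M.cmp_assoc[symmetric], (rule types)+)
  finally show "(act_ev C M X L' \<cdot> (idm C ?D \<unrhd> (idm C X \<unrhd> h))) \<cdot> mas M ?D X L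
      = (h \<cdot> act_ev C M X L) \<cdot> mas M ?D X L" .
qed

lemma act_coev_natural:
  assumes h: "h \<in> Hom M L L'"
  shows "act_coev C M X L' \<cdot> h = (idm C X \<unrhd> (idm C (dual C X) \<unrhd> h)) \<cdot> act_coev C M X L"
proof (rule M.cancel_iso_right[OF mun_iso])
  let ?D = "dual C X" and ?u = "\<one>\<^bsub>C\<^esub>"
  note types = h act_coev_in coev_in arrow_types
  show "act_coev C M X L' \<cdot> h \<in> Hom M L (X \<rhd> (?D \<rhd> L'))"
    by (rule types)+
  show "(idm C X \<unrhd> (idm C ?D \<unrhd> h)) \<cdot> act_coev C M X L \<in> Hom M L (X \<rhd> (?D \<rhd> L'))"
    by (rule types)+
  have "(act_coev C M X L' \<cdot> h) \<cdot> mun M L = act_coev C M X L' \<cdot> h \<cdot> mun M L"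
    by (rule M.cmp_assoc, (rule types)+)
  also have "\<dots> = act_coev C M X L' \<cdot> mun M L' \<cdot> (idm C ?u \<unrhd> h)"
    by (simp add: mun_natural[OF h])
  also have "\<dots> = mas M X ?D L' \<cdot> (coev C X \<unrhd> idm M L') \<cdot> (idm C ?u \<unrhd> h)"
    by (rule M.extend_square[OF act_coev_mun], (rule types)+)
  also have "\<dots> = mas M X ?D L' \<cdot> (idm C (X \<otimes>\<^bsub>C\<^esub> ?D) \<unrhd> h) \<cdot> (coev C X \<unrhd> idm M L)"
    by (simp add: act_interchange[OF coev_in h])
  also have "\<dots> = (idm C X \<unrhd> (idm C ?D \<unrhd> h)) \<cdot> mas M X ?D L \<cdot> (coev C X \<unrhd> idm M L)"
    by (rule M.extend_square[OF mas_natural_object[OF h]], (rule types)+)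
  also have "\<dots> = ((idm C X \<unrhd> (idm C ?D \<unrhd> h)) \<cdot> act_coev C M X L) \<cdot> mun M L"
    unfolding act_coev_mun[symmetric] by (rule M.cmp_assoc[symmetric], (rule types)+)
  finally show "(act_coev C M X L' \<cdot> h) \<cdot> mun M L
      = ((idm C X \<unrhd> (idm C ?D \<unrhd> h)) \<cdot> act_coev C M X L) \<cdot> mun M L" .
qed

text \<open>
  The zigzag identities for \<open>X*\<close> and \<open>X\<close>, freed of the inverse unit constraints.
\<close>

lemma left_dual_unfolded:
  "run C X \<cdot>\<^bsub>C\<^esub> (idm C X \<boxtimes>\<^bsub>C\<^esub> ev C X) \<cdot>\<^bsub>C\<^esub> asc C X (dual C X) X \<cdot>\<^bsub>C\<^esub> (coev C X \<boxtimes>\<^bsub>C\<^esub> idm C X) = lun C X"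
    (is "?l1 = _")
  "lun C (dual C X) \<cdot>\<^bsub>C\<^esub> (ev C X \<boxtimes>\<^bsub>C\<^esub> idm C (dual C X)) \<cdot>\<^bsub>C\<^esub> inv_asc C (dual C X) X (dual C X)
      \<cdot>\<^bsub>C\<^esub> (idm C (dual C X) \<boxtimes>\<^bsub>C\<^esub> coev C X) = run C (dual C X)"
    (is "?l2 = _")
proof -
  let ?D = "dual C X" and ?u = "\<one>\<^bsub>C\<^esub>"
  note inv = C.inv_arr_in[OF C.lun_iso[of X], folded inv_lun_def]
    C.inv_arr_in[OF C.run_iso[of ?D], folded inv_run_def]
    C.inv_arr_in[OF C.asc_iso[of ?D X ?D], folded inv_asc_def]
  note types = inv ev_in coev_in arrow_types
  have t1: "?l1 \<in> Hom C (?u \<otimes>\<^bsub>C\<^esub> X) X"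
    by (rule types)+
  have t2: "?l2 \<in> Hom C (?D \<otimes>\<^bsub>C\<^esub> ?u) ?D"
    by (rule types)+
  have "?l1 \<cdot>\<^bsub>C\<^esub> inv_lun C X = run C X \<cdot>\<^bsub>C\<^esub> (idm C X \<boxtimes>\<^bsub>C\<^esub> ev C X) \<cdot>\<^bsub>C\<^esub> asc C X ?D X
      \<cdot>\<^bsub>C\<^esub> (coev C X \<boxtimes>\<^bsub>C\<^esub> idm C X) \<cdot>\<^bsub>C\<^esub> inv_lun C X"
    by (subst C.cmp_assoc, (rule types)+)+ (rule refl)
  then have 1: "?l1 \<cdot>\<^bsub>C\<^esub> inv_lun C X = lun C X \<cdot>\<^bsub>C\<^esub> inv_lun C X"
    using C.left_dual[of X] C.inv_arr_right[OF C.lun_iso[of X]]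
    unfolding is_left_dual_def inv_lun_def by simp
  show "?l1 = lun C X"
    by (rule C.cancel_iso_right[OF C.is_iso_inv_arr[OF C.lun_iso[of X], folded inv_lun_def] t1 _ 1])
      (rule arrow_types)
  have "?l2 \<cdot>\<^bsub>C\<^esub> inv_run C ?D = lun C ?D \<cdot>\<^bsub>C\<^esub> (ev C X \<boxtimes>\<^bsub>C\<^esub> idm C ?D) \<cdot>\<^bsub>C\<^esub> inv_asc C ?D X ?D
      \<cdot>\<^bsub>C\<^esub> (idm C ?D \<boxtimes>\<^bsub>C\<^esub> coev C X) \<cdot>\<^bsub>C\<^esub> inv_run C ?D"
    by (subst C.cmp_assoc, (rule types)+)+ (rule refl)
  then have 2: "?l2 \<cdot>\<^bsub>C\<^esub> inv_run C ?D = run C ?D \<cdot>\<^bsub>C\<^esub> inv_run C ?D"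
    using C.left_dual[of X] C.inv_arr_right[OF C.run_iso[of ?D]]
    unfolding is_left_dual_def inv_run_def by simp
  show "?l2 = run C ?D"
    by (rule C.cancel_iso_right[OF C.is_iso_inv_arr[OF C.run_iso[of ?D], folded inv_run_def] t2 _ 2])
      (rule arrow_types)
qed

text \<open>
  This and the next lemma say that \<open>X* \<rhd> -\<close> is left adjoint to \<open>X \<rhd> -\<close>. After composition with the unit and
  associativity constraints, moving all constraints to one side turns the composite into the zigzag of
  \<open>C\<close> acting on \<open>L\<close>.
\<close>

lemma act_zigzag_object:
  "(idm C X \<unrhd> act_ev C M X L) \<cdot> act_coev C M X (X \<rhd> L) = idm M (X \<rhd> L)"
proof (rule M.cancel_iso_right)
  let ?D = "dual C X" and ?u = "\<one>\<^bsub>C\<^esub>"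
  \<comment> \<open>By \<open>mun_act\<close> this isomorphism is also \<open>lun X \<unrhd> 1\<close>, the value of the zigzag of \<open>C\<close>.\<close>
  let ?e = "mun M (X \<rhd> L) \<cdot> mas M ?u X L"
  let ?Q = "((coev C X \<boxtimes>\<^bsub>C\<^esub> idm C X) \<unrhd> idm M L)"
  note types = act_ev_in act_coev_in ev_in coev_in arrow_types
  show "is_iso M ((?u \<otimes>\<^bsub>C\<^esub> X) \<rhd> L) (X \<rhd> L) ?e"
    by (rule M.is_iso_cmp[OF mas_iso mun_iso])
  show "(idm C X \<unrhd> act_ev C M X L) \<cdot> act_coev C M X (X \<rhd> L) \<in> Hom M (X \<rhd> L) (X \<rhd> L)"
    by (rule types)+
  show "idm M (X \<rhd> L) \<in> Hom M (X \<rhd> L) (X \<rhd> L)"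
    by (rule types)
  have "((idm C X \<unrhd> act_ev C M X L) \<cdot> act_coev C M X (X \<rhd> L)) \<cdot> ?e
      = (idm C X \<unrhd> act_ev C M X L) \<cdot> act_coev C M X (X \<rhd> L) \<cdot> ?e"
    by (rule M.cmp_assoc, (rule types)+)
  also have "\<dots> = (idm C X \<unrhd> act_ev C M X L)
      \<cdot> mas M X ?D (X \<rhd> L) \<cdot> (coev C X \<unrhd> idm M (X \<rhd> L)) \<cdot> mas M ?u X L"
    by (subst M.extend_square[OF act_coev_mun], (rule types)+) (rule refl)
  also have "\<dots> = (idm C X \<unrhd> act_ev C M X L)
      \<cdot> mas M X ?D (X \<rhd> L) \<cdot> mas M (X \<otimes>\<^bsub>C\<^esub> ?D) X L \<cdot> ?Q"
    using mas_natural[OF coev_in C.id_in M.id_in, of X X L] by (simp add: actm_id)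
  also have "\<dots> = (idm C X \<unrhd> act_ev C M X L)
      \<cdot> (idm C X \<unrhd> mas M ?D X L) \<cdot> (mas M X (?D \<otimes>\<^bsub>C\<^esub> X) L \<cdot> (asc C X ?D X \<unrhd> idm M L)) \<cdot> ?Q"
    by (subst M.extend_square[OF mod_pentagon], (rule types)+) (rule refl)
  also have "\<dots> = (idm C X \<unrhd> mun M L)
      \<cdot> (idm C X \<unrhd> (ev C X \<unrhd> idm M L)) \<cdot> (mas M X (?D \<otimes>\<^bsub>C\<^esub> X) L \<cdot> (asc C X ?D X \<unrhd> idm M L)) \<cdot> ?Q"
  proof (rule M.extend_square)
    show "(idm C X \<unrhd> act_ev C M X L) \<cdot> (idm C X \<unrhd> mas M ?D X L)
        = (idm C X \<unrhd> mun M L) \<cdot> (idm C X \<unrhd> (ev C X \<unrhd> idm M L))"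
      by (subst (1 2) act_cmp_right[symmetric], (rule types)+) (simp add: act_ev_mas)
  qed (rule types)+
  also have "\<dots> = (idm C X \<unrhd> mun M L)
      \<cdot> (idm C X \<unrhd> (ev C X \<unrhd> idm M L)) \<cdot> mas M X (?D \<otimes>\<^bsub>C\<^esub> X) L \<cdot> (asc C X ?D X \<unrhd> idm M L) \<cdot> ?Q"
    by (subst M.cmp_assoc, (rule types)+) (rule refl)
  also have "\<dots> = (idm C X \<unrhd> mun M L) \<cdot> mas M X ?u L
      \<cdot> ((idm C X \<boxtimes>\<^bsub>C\<^esub> ev C X) \<unrhd> idm M L) \<cdot> (asc C X ?D X \<unrhd> idm M L) \<cdot> ?Q"
    by (subst M.extend_square[OF mas_natural[OF C.id_in ev_in M.id_in, symmetric]], (rule types)+) (rule refl)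
  also have "\<dots> = ((idm C X \<unrhd> mun M L) \<cdot> mas M X ?u L)
      \<cdot> ((idm C X \<boxtimes>\<^bsub>C\<^esub> ev C X) \<unrhd> idm M L) \<cdot> (asc C X ?D X \<unrhd> idm M L) \<cdot> ?Q"
    by (rule M.cmp_assoc[symmetric], (rule types)+)
  also have "\<dots> = (run C X \<unrhd> idm M L)
      \<cdot> ((idm C X \<boxtimes>\<^bsub>C\<^esub> ev C X) \<unrhd> idm M L) \<cdot> (asc C X ?D X \<unrhd> idm M L) \<cdot> ?Q"
    by (simp add: mod_triangle)
  also have "\<dots> = (run C X \<cdot>\<^bsub>C\<^esub> (idm C X \<boxtimes>\<^bsub>C\<^esub> ev C X) \<cdot>\<^bsub>C\<^esub> asc C X ?D X
      \<cdot>\<^bsub>C\<^esub> (coev C X \<boxtimes>\<^bsub>C\<^esub> idm C X)) \<unrhd> idm M L"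
    by (subst act_cmp_left, (rule types)+)+ (rule refl)
  also have "\<dots> = idm M (X \<rhd> L) \<cdot> ?e"
    using M.id_left[OF actm_in[OF C.is_iso_in[OF C.lun_iso] M.id_in], of X L]
    by (simp add: left_dual_unfolded(1) mun_act)
  finally show "((idm C X \<unrhd> act_ev C M X L) \<cdot> act_coev C M X (X \<rhd> L)) \<cdot> ?e = idm M (X \<rhd> L) \<cdot> ?e" .
qed

lemma act_zigzag_dual:
  "act_ev C M X (dual C X \<rhd> L) \<cdot> (idm C (dual C X) \<unrhd> act_coev C M X L) = idm M (dual C X \<rhd> L)"
proof (rule M.cancel_iso_right)
  let ?D = "dual C X" and ?u = "\<one>\<^bsub>C\<^esub>"
  \<comment> \<open>By the triangle axiom this isomorphism is also \<open>run X* \<unrhd> 1\<close>, the value of the zigzag of \<open>C\<close>.\<close>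
  let ?e = "(idm C ?D \<unrhd> mun M L) \<cdot> mas M ?D ?u L"
  let ?Q = "((idm C ?D \<boxtimes>\<^bsub>C\<^esub> coev C X) \<unrhd> idm M L)"
  let ?b = "inv_asc C ?D X ?D"
  note asc = C.asc_iso[of ?D X ?D]
  note b = C.inv_arr_in[OF asc, folded inv_asc_def]
  note types = b act_ev_in act_coev_in ev_in coev_in arrow_types
  show "is_iso M ((?D \<otimes>\<^bsub>C\<^esub> ?u) \<rhd> L) (?D \<rhd> L) ?e"
    by (rule M.is_iso_cmp[OF mas_iso is_iso_act[OF C.is_iso_id mun_iso]])
  show "act_ev C M X (?D \<rhd> L) \<cdot> (idm C ?D \<unrhd> act_coev C M X L) \<in> Hom M (?D \<rhd> L) (?D \<rhd> L)"
    by (rule types)+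
  show "idm M (?D \<rhd> L) \<in> Hom M (?D \<rhd> L) (?D \<rhd> L)"
    by (rule types)
  have pentagon: "(idm C ?D \<unrhd> mas M X ?D L) \<cdot> mas M ?D (X \<otimes>\<^bsub>C\<^esub> ?D) L
      = mas M ?D X (?D \<rhd> L) \<cdot> mas M (?D \<otimes>\<^bsub>C\<^esub> X) ?D L \<cdot> (?b \<unrhd> idm M L)"
  proof -
    have "(mas M ?D X (?D \<rhd> L) \<cdot> mas M (?D \<otimes>\<^bsub>C\<^esub> X) ?D L) \<cdot> (?b \<unrhd> idm M L)
        = ((idm C ?D \<unrhd> mas M X ?D L) \<cdot> mas M ?D (X \<otimes>\<^bsub>C\<^esub> ?D) L)
          \<cdot> (asc C ?D X ?D \<unrhd> idm M L) \<cdot> (?b \<unrhd> idm M L)"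
      unfolding mod_pentagon
      by ((subst M.cmp_assoc, (rule types)+)+) (rule refl)
    also have "(asc C ?D X ?D \<unrhd> idm M L) \<cdot> (?b \<unrhd> idm M L) = idm M ((?D \<otimes>\<^bsub>C\<^esub> (X \<otimes>\<^bsub>C\<^esub> ?D)) \<rhd> L)"
      by (subst act_cmp_left[symmetric], (rule types)+)
        (simp add: inv_asc_def C.inv_arr_right[OF asc] actm_id)
    also have "((idm C ?D \<unrhd> mas M X ?D L) \<cdot> mas M ?D (X \<otimes>\<^bsub>C\<^esub> ?D) L) \<cdot> \<dots>
        = (idm C ?D \<unrhd> mas M X ?D L) \<cdot> mas M ?D (X \<otimes>\<^bsub>C\<^esub> ?D) L"
      by (rule M.id_right, (rule types)+)
    finally show ?thesis
      using M.cmp_assoc[OF actm_in[OF b M.id_in] M.is_iso_in[OF mas_iso] M.is_iso_in[OF mas_iso]] by simp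
  qed
  have "(act_ev C M X (?D \<rhd> L) \<cdot> (idm C ?D \<unrhd> act_coev C M X L)) \<cdot> ?e
      = act_ev C M X (?D \<rhd> L) \<cdot> (idm C ?D \<unrhd> act_coev C M X L) \<cdot> ?e"
    by (rule M.cmp_assoc, (rule types)+)
  also have "\<dots> = act_ev C M X (?D \<rhd> L)
      \<cdot> (idm C ?D \<unrhd> mas M X ?D L) \<cdot> (idm C ?D \<unrhd> (coev C X \<unrhd> idm M L)) \<cdot> mas M ?D ?u L"
  proof -
    have square: "(idm C ?D \<unrhd> act_coev C M X L) \<cdot> (idm C ?D \<unrhd> mun M L)
        = (idm C ?D \<unrhd> mas M X ?D L) \<cdot> (idm C ?D \<unrhd> (coev C X \<unrhd> idm M L))"
      by (subst (1 2) act_cmp_right[symmetric], (rule types)+) (simp add: act_coev_mun)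
    show ?thesis
      by (subst M.extend_square[OF square], (rule types)+) (rule refl)
  qed
  also have "\<dots> = act_ev C M X (?D \<rhd> L)
      \<cdot> (idm C ?D \<unrhd> mas M X ?D L) \<cdot> mas M ?D (X \<otimes>\<^bsub>C\<^esub> ?D) L \<cdot> ?Q"
    using mas_natural[OF C.id_in coev_in M.id_in, of ?D X L] by simp
  also have "\<dots> = act_ev C M X (?D \<rhd> L)
      \<cdot> mas M ?D X (?D \<rhd> L) \<cdot> (mas M (?D \<otimes>\<^bsub>C\<^esub> X) ?D L \<cdot> (?b \<unrhd> idm M L)) \<cdot> ?Q"
    by (subst M.extend_square[OF pentagon], (rule types)+) (rule refl)
  also have "\<dots> = mun M (?D \<rhd> L) \<cdot> (ev C X \<unrhd> idm M (?D \<rhd> L))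
      \<cdot> (mas M (?D \<otimes>\<^bsub>C\<^esub> X) ?D L \<cdot> (?b \<unrhd> idm M L)) \<cdot> ?Q"
    by (rule M.extend_square[OF act_ev_mas], (rule types)+)
  also have "\<dots> = mun M (?D \<rhd> L) \<cdot> (ev C X \<unrhd> idm M (?D \<rhd> L))
      \<cdot> mas M (?D \<otimes>\<^bsub>C\<^esub> X) ?D L \<cdot> (?b \<unrhd> idm M L) \<cdot> ?Q"
    by (subst M.cmp_assoc, (rule types)+) (rule refl)
  also have "\<dots> = mun M (?D \<rhd> L) \<cdot> mas M ?u ?D L
      \<cdot> ((ev C X \<boxtimes>\<^bsub>C\<^esub> idm C ?D) \<unrhd> idm M L) \<cdot> (?b \<unrhd> idm M L) \<cdot> ?Q"
  proof -
    have square: "(ev C X \<unrhd> idm M (?D \<rhd> L)) \<cdot> mas M (?D \<otimes>\<^bsub>C\<^esub> X) ?D L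
        = mas M ?u ?D L \<cdot> ((ev C X \<boxtimes>\<^bsub>C\<^esub> idm C ?D) \<unrhd> idm M L)"
      using mas_natural[OF ev_in C.id_in M.id_in, of ?D L X] by (simp add: actm_id)
    show ?thesis
      by (subst M.extend_square[OF square], (rule types)+) (rule refl)
  qed
  also have "\<dots> = (mun M (?D \<rhd> L) \<cdot> mas M ?u ?D L)
      \<cdot> ((ev C X \<boxtimes>\<^bsub>C\<^esub> idm C ?D) \<unrhd> idm M L) \<cdot> (?b \<unrhd> idm M L) \<cdot> ?Q"
    by (rule M.cmp_assoc[symmetric], (rule types)+)
  also have "\<dots> = (lun C ?D \<unrhd> idm M L)
      \<cdot> ((ev C X \<boxtimes>\<^bsub>C\<^esub> idm C ?D) \<unrhd> idm M L) \<cdot> (?b \<unrhd> idm M L) \<cdot> ?Q"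
    by (simp add: mun_act)
  also have "\<dots> = (lun C ?D \<cdot>\<^bsub>C\<^esub> (ev C X \<boxtimes>\<^bsub>C\<^esub> idm C ?D) \<cdot>\<^bsub>C\<^esub> ?b
      \<cdot>\<^bsub>C\<^esub> (idm C ?D \<boxtimes>\<^bsub>C\<^esub> coev C X)) \<unrhd> idm M L"
    by (subst act_cmp_left, (rule types)+)+ (rule refl)
  also have "\<dots> = idm M (?D \<rhd> L) \<cdot> ?e"
    unfolding left_dual_unfolded(2) mod_triangle
    by (rule M.id_left[OF actm_in[OF C.is_iso_in[OF C.run_iso] M.id_in], symmetric])
  finally show "(act_ev C M X (?D \<rhd> L) \<cdot> (idm C ?D \<unrhd> act_coev C M X L)) \<cdot> ?e = idm M (?D \<rhd> L) \<cdot> ?e" .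
qed

section \<open>Closing up a strand\<close>

text \<open>
  The left partial trace over the strand of \<open>X\<close>, before a pivotal structure identifies \<open>X**\<close> with \<open>X\<close>.
  Source and target of the result may differ, which lets naturality be stated separately in \<open>L\<close> and \<open>N\<close>.
\<close>

definition close :: "'o \<Rightarrow> 'p \<Rightarrow> 'p \<Rightarrow> 'b \<Rightarrow> 'b" where
  "close X N L h = act_ev C M X L \<cdot> (idm C (dual C X) \<unrhd> h) \<cdot> act_coev C M (dual C X) N"

lemma ddual_coev_in: "act_coev C M (dual C X) N \<in> Hom M N (dual C X \<rhd> (ddual C X \<rhd> N))"
  using act_coev_in[of "dual C X" N] by (simp add: ddual_def)

lemma close_in:
  "h \<in> Hom M (ddual C X \<rhd> N) (X \<rhd> L) \<Longrightarrow> close X N L h \<in> Hom M N L"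
  unfolding close_def by (rule M.cmp_in act_ev_in ddual_coev_in actm_in C.id_in | assumption)+

lemma close_add:
  assumes "h \<in> Hom M (ddual C X \<rhd> N) (X \<rhd> L)" "h' \<in> Hom M (ddual C X \<rhd> N) (X \<rhd> L)"
  shows "close X N L (h + h') = close X N L h + close X N L h'"
proof -
  note t = actm_in[OF C.id_in[of "dual C X"] assms(1)] actm_in[OF C.id_in[of "dual C X"] assms(2)]
  show ?thesis
    unfolding close_def
    using actm_add_right[OF C.id_in assms, of "dual C X"] M.cmp_add_left[OF ddual_coev_in t]
      M.cmp_add_right[OF M.cmp_in[OF ddual_coev_in t(1)] M.cmp_in[OF ddual_coev_in t(2)] act_ev_in]
    by simp
qed

lemma close_scl:
  assumes "h \<in> Hom M (ddual C X \<rhd> N) (X \<rhd> L)"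
  shows "close X N L (scl M c h) = scl M c (close X N L h)"
proof -
  note t = actm_in[OF C.id_in[of "dual C X"] assms]
  show ?thesis
    unfolding close_def
    using actm_scl_right[OF C.id_in assms, of "dual C X"] M.cmp_scl_left[OF ddual_coev_in t]
      M.cmp_scl_right[OF M.cmp_in[OF ddual_coev_in t] act_ev_in]
    by simp
qed

lemma close_left:
  assumes u: "u \<in> Hom M L L'" and h: "h \<in> Hom M (ddual C X \<rhd> N) (X \<rhd> L)"
  shows "close X N L' ((idm C X \<unrhd> u) \<cdot> h) = u \<cdot> close X N L h"
proof -
  let ?D = "dual C X"
  note types = u h act_ev_in ddual_coev_in actm_in C.id_in M.cmp_in
  have "close X N L' ((idm C X \<unrhd> u) \<cdot> h)
      = act_ev C M X L' \<cdot> ((idm C ?D \<unrhd> (idm C X \<unrhd> u)) \<cdot> (idm C ?D \<unrhd> h)) \<cdot> act_coev C M ?D N"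
    unfolding close_def by (subst act_cmp_right, (rule types)+) (rule refl)
  also have "\<dots> = act_ev C M X L' \<cdot> (idm C ?D \<unrhd> (idm C X \<unrhd> u)) \<cdot> (idm C ?D \<unrhd> h) \<cdot> act_coev C M ?D N"
    by (subst M.cmp_assoc, (rule types)+) (rule refl)
  also have "\<dots> = u \<cdot> act_ev C M X L \<cdot> (idm C ?D \<unrhd> h) \<cdot> act_coev C M ?D N"
    by (rule M.extend_square[OF act_ev_natural[OF u]], (rule types)+)
  finally show ?thesis unfolding close_def .
qed

lemma close_right:
  assumes v: "v \<in> Hom M N' N" and h: "h \<in> Hom M (ddual C X \<rhd> N) (X \<rhd> L)"
  shows "close X N' L (h \<cdot> (idm C (ddual C X) \<unrhd> v)) = close X N L h \<cdot> v"
proof -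
  let ?D = "dual C X"
  note types = v h act_ev_in ddual_coev_in actm_in C.id_in M.cmp_in
  have "close X N' L (h \<cdot> (idm C (ddual C X) \<unrhd> v))
      = act_ev C M X L \<cdot> ((idm C ?D \<unrhd> h) \<cdot> (idm C ?D \<unrhd> (idm C (ddual C X) \<unrhd> v))) \<cdot> act_coev C M ?D N'"
    unfolding close_def by (subst act_cmp_right, (rule types)+) (rule refl)
  also have "\<dots> = act_ev C M X L \<cdot> (idm C ?D \<unrhd> h) \<cdot> (idm C ?D \<unrhd> (idm C (ddual C X) \<unrhd> v)) \<cdot> act_coev C M ?D N'"
    by (subst M.cmp_assoc, (rule types)+) (rule refl)
  also have "\<dots> = act_ev C M X L \<cdot> (idm C ?D \<unrhd> h) \<cdot> act_coev C M ?D N \<cdot> v"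
    using act_coev_natural[OF v, of ?D] by (simp add: ddual_def)
  also have "\<dots> = close X N L h \<cdot> v"
    unfolding close_def by ((subst M.cmp_assoc, (rule types)+)+) (rule refl)
  finally show ?thesis .
qed

text \<open>
  The two directions of the adjunction bijection between \<open>Hom(W, X \<rhd> L)\<close> and \<open>Hom(X* \<rhd> W, L)\<close>.
\<close>

definition transpose_down :: "'o \<Rightarrow> 'p \<Rightarrow> 'b \<Rightarrow> 'b" where
  "transpose_down X L u = act_ev C M X L \<cdot> (idm C (dual C X) \<unrhd> u)"

definition transpose_up :: "'o \<Rightarrow> 'p \<Rightarrow> 'b \<Rightarrow> 'b" where
  "transpose_up X W w = (idm C X \<unrhd> w) \<cdot> act_coev C M X W"

lemma transpose_down_in: "u \<in> Hom M W (X \<rhd> L) \<Longrightarrow> transpose_down X L u \<in> Hom M (dual C X \<rhd> W) L"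
  unfolding transpose_down_def by (rule M.cmp_in[OF actm_in[OF C.id_in] act_ev_in])

lemma transpose_up_in: "w \<in> Hom M (dual C X \<rhd> W) L \<Longrightarrow> transpose_up X W w \<in> Hom M W (X \<rhd> L)"
  unfolding transpose_up_def by (rule M.cmp_in[OF act_coev_in actm_in[OF C.id_in]])

lemma transpose_up_down:
  assumes u: "u \<in> Hom M W (X \<rhd> L)"
  shows "transpose_up X W (transpose_down X L u) = u"
proof -
  note types = u act_ev_in act_coev_in actm_in C.id_in M.cmp_in
  have "transpose_up X W (transpose_down X L u)
      = (idm C X \<unrhd> act_ev C M X L) \<cdot> (idm C X \<unrhd> (idm C (dual C X) \<unrhd> u)) \<cdot> act_coev C M X W"
    unfolding transpose_up_def transpose_down_def
    by (subst act_cmp_right, (rule types)+, rule M.cmp_assoc, (rule types)+)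
  also have "\<dots> = (idm C X \<unrhd> act_ev C M X L) \<cdot> act_coev C M X (X \<rhd> L) \<cdot> u"
    by (simp add: act_coev_natural[OF u])
  also have "\<dots> = ((idm C X \<unrhd> act_ev C M X L) \<cdot> act_coev C M X (X \<rhd> L)) \<cdot> u"
    by (rule M.cmp_assoc[symmetric], (rule types)+)
  finally show ?thesis
    by (simp add: act_zigzag_object M.id_left[OF u])
qed

lemma transpose_down_up:
  assumes w: "w \<in> Hom M (dual C X \<rhd> W) L"
  shows "transpose_down X L (transpose_up X W w) = w"
proof -
  note types = w act_ev_in act_coev_in actm_in C.id_in M.cmp_in
  have "transpose_down X L (transpose_up X W w)
      = act_ev C M X L \<cdot> (idm C (dual C X) \<unrhd> (idm C X \<unrhd> w)) \<cdot> (idm C (dual C X) \<unrhd> act_coev C M X W)"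
    unfolding transpose_up_def transpose_down_def
    by (subst act_cmp_right, (rule types)+) (rule refl)
  also have "\<dots> = (act_ev C M X L \<cdot> (idm C (dual C X) \<unrhd> (idm C X \<unrhd> w))) \<cdot> (idm C (dual C X) \<unrhd> act_coev C M X W)"
    by (rule M.cmp_assoc[symmetric], (rule types)+)
  also have "\<dots> = (w \<cdot> act_ev C M X (dual C X \<rhd> W)) \<cdot> (idm C (dual C X) \<unrhd> act_coev C M X W)"
    by (simp add: act_ev_natural[OF w])
  also have "\<dots> = w \<cdot> act_ev C M X (dual C X \<rhd> W) \<cdot> (idm C (dual C X) \<unrhd> act_coev C M X W)"
    by (rule M.cmp_assoc, (rule types)+)
  finally show ?thesis
    by (simp add: act_zigzag_dual M.id_right[OF w])
qed

text \<open>
  The strand can be cut at \<open>W\<close>: the closure of a composite is a composite of transposes, one for \<open>X\<close> and one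
  for \<open>X*\<close>. As transposition is bijective, this transfers nondegeneracy from \<open>tr\<close> to \<open>tr (close _)\<close>.
\<close>

lemma close_cmp:
  assumes u: "u \<in> Hom M W (X \<rhd> L)" and t: "t \<in> Hom M (ddual C X \<rhd> N) W"
  shows "close X N L (u \<cdot> t) = transpose_down X L u \<cdot> transpose_up (dual C X) N t"
proof -
  note types = u t act_ev_in ddual_coev_in actm_in C.id_in M.cmp_in
  show ?thesis
    unfolding close_def transpose_down_def transpose_up_def
    by (subst act_cmp_right, (rule types)+, (subst M.cmp_assoc, (rule types)+)+) (rule refl)
qed

lemma act_zero: "idm C X \<unrhd> 0 = 0"
  using actm_scl_right[OF C.id_in M.zero_in, of X 0] by simp

lemma act_sum:
  assumes "\<And>j. j \<in> J \<Longrightarrow> h j \<in> Hom M N N'"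
  shows "idm C X \<unrhd> (\<Sum>j\<in>J. h j) = (\<Sum>j\<in>J. idm C X \<unrhd> h j)"
  using assms
proof (induction J rule: infinite_finite_induct)
  case (insert x F)
  then have "h x \<in> Hom M N N'" "(\<Sum>j\<in>F. h j) \<in> Hom M N N'"
    by (auto intro: M.sum_in)
  from actm_add_right[OF C.id_in this, of X] show ?case
    using insert by simp
qed (simp_all add: act_zero)

end

section \<open>The canonical identification with the double dual\<close>

locale semisimple_module_category = module_category C M + M: based_semisimple_category M I S
  for C :: "('k::alg_closed_field, 'o, 'a::ab_group_add, 'z) tensor_cat_scheme"
    and M :: "('k, 'o, 'a, 'p, 'b::ab_group_add, 'y) mod_cat_scheme" (structure)
    and I :: "'i set" and S :: "'i \<Rightarrow> 'p"
begin

text \<open>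
  The canonical isomorphism \<open>X \<rhd> N \<rightarrow> X** \<rhd> N\<close>, for all \<open>N\<close> at once. In terms of matrix entries, \<open>tr\<close> pairs
  \<open>Hom(S i, X** \<rhd> S j)\<close> with \<open>Hom(X** \<rhd> S j, S i)\<close>, and closing up the strand pairs the latter space with
  \<open>Hom(S i, X \<rhd> S j)\<close>.
\<close>

definition double_dual :: "'o \<Rightarrow> 'p \<Rightarrow> 'b" where
  "double_dual X N = M.trace_dual (ddual C X \<rhd> N) (X \<rhd> N) (\<lambda>h. M.tr N (close X N N h))"

lemma double_dual_in: "double_dual X N \<in> Hom M (X \<rhd> N) (ddual C X \<rhd> N)"
  and tr_double_dual: "h \<in> Hom M (ddual C X \<rhd> N) (X \<rhd> N)
    \<Longrightarrow> M.tr (ddual C X \<rhd> N) (double_dual X N \<cdot> h) = M.tr N (close X N N h)"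
  unfolding double_dual_def
  using M.trace_dual[of "ddual C X \<rhd> N" "X \<rhd> N" "\<lambda>h. M.tr N (close X N N h)"]
  by (simp_all add: close_add close_scl M.wtrace_add M.wtrace_scl close_in)

text \<open>
  Paired with \<open>k\<close>, both sides are the trace of a composite of \<open>h\<close> with the closure of \<open>k\<close>, in the two possible
  orders.
\<close>

lemma double_dual_natural:
  assumes h: "h \<in> Hom M N N'"
  shows "double_dual X N' \<cdot> (idm C X \<unrhd> h) = (idm C (ddual C X) \<unrhd> h) \<cdot> double_dual X N"
proof (rule M.tr_eqI)
  let ?X = "ddual C X"
  note types = h double_dual_in actm_in C.id_in M.cmp_in
  show 1: "double_dual X N' \<cdot> (idm C X \<unrhd> h) \<in> Hom M (X \<rhd> N) (?X \<rhd> N')"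
    and 2: "(idm C ?X \<unrhd> h) \<cdot> double_dual X N \<in> Hom M (X \<rhd> N) (?X \<rhd> N')"
    by (rule types)+
  fix k assume k: "k \<in> Hom M (?X \<rhd> N') (X \<rhd> N)"
  let ?q = "close X N' N k"
  note q = close_in[OF k]
  note hX = actm_in[OF C.id_in[of X] h] actm_in[OF C.id_in[of ?X] h]
  have "M.tr (?X \<rhd> N') ((double_dual X N' \<cdot> (idm C X \<unrhd> h)) \<cdot> k) = M.tr N' (h \<cdot> ?q)"
    using M.cmp_assoc[OF k hX(1) double_dual_in] tr_double_dual[OF M.cmp_in[OF k hX(1)]] close_left[OF h k] by simp
  also have "\<dots> = M.tr N (?q \<cdot> h)"
    by (rule M.wtrace_cyclic[OF h q])
  also have "\<dots> = M.tr (?X \<rhd> N) (double_dual X N \<cdot> k \<cdot> (idm C ?X \<unrhd> h))"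
    using close_right[OF h k] tr_double_dual[OF M.cmp_in[OF hX(2) k]] by simp
  also have "\<dots> = M.tr (?X \<rhd> N) ((double_dual X N \<cdot> k) \<cdot> (idm C ?X \<unrhd> h))"
    using M.cmp_assoc[OF hX(2) k double_dual_in] by simp
  also have "\<dots> = M.tr (?X \<rhd> N') ((idm C ?X \<unrhd> h) \<cdot> double_dual X N \<cdot> k)"
    by (rule M.wtrace_cyclic[OF M.cmp_in[OF k double_dual_in] hX(2)])
  also have "\<dots> = M.tr (?X \<rhd> N') (((idm C ?X \<unrhd> h) \<cdot> double_dual X N) \<cdot> k)"
    using M.cmp_assoc[OF k double_dual_in hX(2)] by simp
  finally show "M.tr (?X \<rhd> N') ((double_dual X N' \<cdot> (idm C X \<unrhd> h)) \<cdot> k)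
      = M.tr (?X \<rhd> N') (((idm C ?X \<unrhd> h) \<cdot> double_dual X N) \<cdot> k)" .
qed

lemma tr_double_dual_cmp:
  assumes u: "u \<in> Hom M W (X \<rhd> N)" and t: "t \<in> Hom M (ddual C X \<rhd> N) W"
  shows "M.tr W (t \<cdot> double_dual X N \<cdot> u) = M.tr N (transpose_down X N u \<cdot> transpose_up (dual C X) N t)"
  using M.wtrace_cyclic[OF t M.cmp_in[OF u double_dual_in]] M.cmp_assoc[OF t u double_dual_in]
    tr_double_dual[OF M.cmp_in[OF t u]] close_cmp[OF u t] by simp

text \<open>
  If \<open>double_dual \<cdot> u = 0\<close>, then the transpose of \<open>u\<close> pairs to zero with every transpose of a morphism \<open>t\<close>, that is,
  with everything. So the transpose of \<open>u\<close> is zero, and then so is \<open>u\<close>.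
\<close>

lemma double_dual_cancel_left:
  assumes u: "u \<in> Hom M W (X \<rhd> N)" and zero: "double_dual X N \<cdot> u = 0"
  shows "u = 0"
proof -
  let ?D = "dual C X"
  have "transpose_down X N u = 0"
  proof (rule M.tr_nondegenerate[OF transpose_down_in[OF u]])
    fix k assume k: "k \<in> Hom M N (?D \<rhd> W)"
    \<comment> \<open>The morphism whose transpose is the given \<open>k\<close>.\<close>
    let ?t = "transpose_down ?D W k"
    have t: "?t \<in> Hom M (ddual C X \<rhd> N) W"
      using transpose_down_in[OF k] by (simp add: ddual_def)
    have "M.tr N (transpose_down X N u \<cdot> k) = M.tr W (?t \<cdot> double_dual X N \<cdot> u)"
      using tr_double_dual_cmp[OF u t] transpose_up_down[OF k] by simp
    then show "M.tr N (transpose_down X N u \<cdot> k) = 0"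
      using zero M.cmp_zero_right[OF t] M.wtrace_zero by simp
  qed
  then have "transpose_up X W 0 = u"
    using transpose_up_down[OF u] by simp
  then show ?thesis
    using M.cmp_zero_left[OF act_coev_in] by (simp add: transpose_up_def act_zero)
qed

lemma double_dual_cancel_right:
  assumes t: "t \<in> Hom M (ddual C X \<rhd> N) W" and zero: "t \<cdot> double_dual X N = 0"
  shows "t = 0"
proof -
  let ?D = "dual C X"
  note t' = t[unfolded ddual_def]
  have "transpose_up ?D N t = 0"
  proof (rule M.tr_nondegenerate[OF transpose_up_in[OF t']])
    fix k assume k: "k \<in> Hom M (?D \<rhd> W) N"
    \<comment> \<open>The morphism whose transpose is the given \<open>k\<close>.\<close>
    let ?u = "transpose_up X W k"
    note u = transpose_up_in[OF k]
    have "M.tr (?D \<rhd> W) (transpose_up ?D N t \<cdot> k) = M.tr N (k \<cdot> transpose_up ?D N t)"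
      by (rule M.wtrace_cyclic[OF transpose_up_in[OF t'] k])
    also have "\<dots> = M.tr W (t \<cdot> double_dual X N \<cdot> ?u)"
      using tr_double_dual_cmp[OF u t] transpose_down_up[OF k] by simp
    also have "\<dots> = 0"
      using M.cmp_assoc[OF u double_dual_in t] zero M.cmp_zero_left[OF u] M.wtrace_zero by simp
    finally show "M.tr (?D \<rhd> W) (transpose_up ?D N t \<cdot> k) = 0" .
  qed
  then have "transpose_down ?D W 0 = t"
    using transpose_down_up[OF t'] by simp
  then show ?thesis
    using M.cmp_zero_right[OF act_ev_in] by (simp add: transpose_down_def act_zero)
qed

lemma is_iso_double_dual: "is_iso M (X \<rhd> N) (ddual C X \<rhd> N) (double_dual X N)"
proof (rule M.iso_if_mono_epi)
  show "is_mono M (X \<rhd> N) (ddual C X \<rhd> N) (double_dual X N)"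
    unfolding is_mono_def
  proof (intro conjI allI ballI impI double_dual_in)
    fix W g h assume g: "g \<in> Hom M W (X \<rhd> N)" and h: "h \<in> Hom M W (X \<rhd> N)"
      and "double_dual X N \<cdot> g = double_dual X N \<cdot> h"
    then have "g - h = 0"
      using M.cmp_diff_right[OF g h double_dual_in] by (intro double_dual_cancel_left[OF M.diff_in[OF g h]]) simp
    then show "g = h" by simp
  qed
  show "is_epi M (X \<rhd> N) (ddual C X \<rhd> N) (double_dual X N)"
    unfolding is_epi_def
  proof (intro conjI allI ballI impI double_dual_in)
    fix W g h assume g: "g \<in> Hom M (ddual C X \<rhd> N) W" and h: "h \<in> Hom M (ddual C X \<rhd> N) W"
      and "g \<cdot> double_dual X N = h \<cdot> double_dual X N"
    then have "g - h = 0"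
      using M.cmp_diff_left[OF double_dual_in g h] by (intro double_dual_cancel_right[OF M.diff_in[OF g h]]) simp
    then show "g = h" by simp
  qed
qed

lemma pairing_transposed:
  assumes i: "i \<in> I" and g: "g \<in> Hom M (S j) (dual C X \<rhd> S i)"
    and v: "v \<in> Hom M (S i) (ddual C X \<rhd> S j)"
  shows "duality_pairing C M (dual C X) (S i) v g = M.tr (S i) (transpose_down (dual C X) (S i) g \<cdot> v)"
proof -
  let ?D = "dual C X"
  note v' = v[unfolded ddual_def]
  note types = g v' act_ev_in actm_in C.id_in M.cmp_in
  have "act_ev C M ?D (S i) \<cdot> (idm C (dual C ?D) \<unrhd> g) \<cdot> v = transpose_down ?D (S i) g \<cdot> v"
    unfolding transpose_down_def by (rule M.cmp_assoc[symmetric], (rule types)+)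
  moreover have "transpose_down ?D (S i) g \<cdot> v \<in> Hom M (S i) (S i)"
    by (rule M.cmp_in[OF v' transpose_down_in[OF g]])
  ultimately show ?thesis
    unfolding duality_pairing_def by (simp add: M.wtrace_S[OF i])
qed

text \<open>
  The pairing condition for \<open>f\<close> and \<open>g\<close> is the defining equation of \<open>double_dual\<close> at \<open>h = f \<cdot> t\<close>, where \<open>t\<close> is the
  transpose of \<open>g\<close>.
\<close>

lemma double_dual_is_identification: "is_double_dual_identification C M I S double_dual"
  unfolding is_double_dual_identification_def
proof (intro conjI allI ballI)
  fix X i j f g
  assume i: "i \<in> I" and j: "j \<in> I" and f: "f \<in> Hom M (S i) (X \<rhd> S j)"
    and g: "g \<in> Hom M (S j) (dual C X \<rhd> S i)"
  let ?D = "dual C X"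
  let ?t = "transpose_down ?D (S i) g"
  have t: "?t \<in> Hom M (ddual C X \<rhd> S j) (S i)"
    using transpose_down_in[OF g] by (simp add: ddual_def)
  have "duality_pairing C M ?D (S i) (double_dual X (S j) \<cdot> f) g = M.tr (S j) (transpose_down X (S j) f \<cdot> g)"
    using pairing_transposed[OF i g M.cmp_in[OF f double_dual_in]] tr_double_dual_cmp[OF f t] transpose_up_down[OF g]
    by simp
  also have "\<dots> = M.sc j (transpose_down X (S j) f \<cdot> g)"
    using M.wtrace_S[OF j M.cmp_in[OF g transpose_down_in[OF f]]] by simp
  also have "\<dots> = duality_pairing C M X (S j) g f"
    unfolding duality_pairing_def transpose_down_def
    using M.cmp_assoc[OF g actm_in[OF C.id_in f] act_ev_in] by simp
  finally show "duality_pairing C M ?D (S i) (double_dual X (S j) \<cdot> f) g = duality_pairing C M X (S j) g f" .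
qed (simp_all add: is_iso_double_dual double_dual_natural)

text \<open>
  By naturality and decomposition of \<open>N\<close>, two identifications need only be compared at \<open>S j\<close>, and there only after
  composition with morphisms \<open>f : S i \<rightarrow> X \<rhd> S j\<close>. The pairing condition fixes these composites, since every
  \<open>t : X** \<rhd> S j \<rightarrow> S i\<close> is the transpose of some \<open>g : S j \<rightarrow> X* \<rhd> S i\<close>.
\<close>

lemma identification_unique:
  assumes "is_double_dual_identification C M I S \<phi>" and "is_double_dual_identification C M I S \<psi>"
  shows "\<phi> = \<psi>"
proof (intro ext)
  fix X N
  let ?X = "ddual C X"
  have nat: "\<phi> X N' \<cdot> (idm C X \<unrhd> h) = (idm C ?X \<unrhd> h) \<cdot> \<phi> X N"
      "\<psi> X N' \<cdot> (idm C X \<unrhd> h) = (idm C ?X \<unrhd> h) \<cdot> \<psi> X N" if "h \<in> Hom M N N'" for N N' h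
    using assms[unfolded is_double_dual_identification_def, THEN conjunct2, THEN conjunct1] that by blast+
  have "is_iso M (X \<rhd> N) (?X \<rhd> N) (\<phi> X N)" "is_iso M (X \<rhd> N) (?X \<rhd> N) (\<psi> X N)" for N
    using assms[unfolded is_double_dual_identification_def, THEN conjunct1] by simp_all
  note types = this[THEN M.is_iso_in]
  have pair: "duality_pairing C M (dual C X) (S i) (\<phi> X (S j) \<cdot> f) g
      = duality_pairing C M (dual C X) (S i) (\<psi> X (S j) \<cdot> f) g"
    if "i \<in> I" "j \<in> I" "f \<in> Hom M (S i) (X \<rhd> S j)" "g \<in> Hom M (S j) (dual C X \<rhd> S i)" for i j f g
    using assms[unfolded is_double_dual_identification_def, THEN conjunct2, THEN conjunct2] that by simp
  have on_simple: "\<phi> X (S j) = \<psi> X (S j)" if j: "j \<in> I" for j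
  proof -
    have eq: "\<phi> X (S j) \<cdot> f = \<psi> X (S j) \<cdot> f" if i: "i \<in> I" and f: "f \<in> Hom M (S i) (X \<rhd> S j)" for i f
    proof (rule M.tr_eqI[OF M.cmp_in[OF f types(1)] M.cmp_in[OF f types(2)]])
      fix t assume t: "t \<in> Hom M (?X \<rhd> S j) (S i)"
      let ?g = "transpose_up (dual C X) (S j) t"
      note g = transpose_up_in[OF t[unfolded ddual_def]]
      have "M.tr (?X \<rhd> S j) (v \<cdot> t) = duality_pairing C M (dual C X) (S i) v ?g"
        if v: "v \<in> Hom M (S i) (?X \<rhd> S j)" for v
        using pairing_transposed[OF i g v] transpose_down_up[OF t[unfolded ddual_def]]
          M.wtrace_cyclic[OF v t] by simp
      then show "M.tr (?X \<rhd> S j) ((\<phi> X (S j) \<cdot> f) \<cdot> t) = M.tr (?X \<rhd> S j) ((\<psi> X (S j) \<cdot> f) \<cdot> t)"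
        using pair[OF i j f g] M.cmp_in[OF f types(1)] M.cmp_in[OF f types(2)] by simp
    qed
    obtain n \<sigma> inc prj where D: "M.decomposes (X \<rhd> S j) n \<sigma> inc prj"
      using M.decomposition_exists by blast
    have "(\<Sum>l<n. (\<phi> X (S j) \<cdot> inc l) \<cdot> prj l) = (\<Sum>l<n. (\<psi> X (S j) \<cdot> inc l) \<cdot> prj l)"
      using eq[OF M.decomposesD(1,2)[OF D]] by (intro sum.cong) auto
    then show ?thesis
      using M.expand_source[OF D types(1)] M.expand_source[OF D types(2)] by simp
  qed
  obtain n \<sigma> inc prj where D: "M.decomposes N n \<sigma> inc prj"
    using M.decomposition_exists by blast
  note D' = M.decomposesD[OF D]
  have id: "(\<Sum>l<n. (idm C X \<unrhd> inc l) \<cdot> (idm C X \<unrhd> prj l)) = idm M (X \<rhd> N)"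
  proof -
    have "(\<Sum>l<n. (idm C X \<unrhd> inc l) \<cdot> (idm C X \<unrhd> prj l)) = (\<Sum>l<n. idm C X \<unrhd> (inc l \<cdot> prj l))"
      using act_cmp_right[OF D'(3) D'(2)] by (intro sum.cong) auto
    also have "\<dots> = idm C X \<unrhd> (\<Sum>l<n. inc l \<cdot> prj l)"
      using M.cmp_in[OF D'(3) D'(2)] by (intro act_sum[symmetric]) simp
    finally show ?thesis by (simp add: D'(5) actm_id)
  qed
  have expand: "\<theta> = (\<Sum>l<n. (\<theta> \<cdot> (idm C X \<unrhd> inc l)) \<cdot> (idm C X \<unrhd> prj l))"
    if \<theta>: "\<theta> \<in> Hom M (X \<rhd> N) (?X \<rhd> N)" for \<theta>
  proof -
    note i = actm_in[OF C.id_in D'(2), of _ X] and p = actm_in[OF C.id_in D'(3), of _ X]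
    have "\<theta> = \<theta> \<cdot> (\<Sum>l<n. (idm C X \<unrhd> inc l) \<cdot> (idm C X \<unrhd> prj l))"
      using id M.id_right[OF \<theta>] by simp
    also have "\<dots> = (\<Sum>l<n. \<theta> \<cdot> (idm C X \<unrhd> inc l) \<cdot> (idm C X \<unrhd> prj l))"
      using M.cmp_in[OF p i] by (intro M.cmp_sum_right[OF \<theta>]) simp
    also have "\<dots> = (\<Sum>l<n. (\<theta> \<cdot> (idm C X \<unrhd> inc l)) \<cdot> (idm C X \<unrhd> prj l))"
      using M.cmp_assoc[OF p i \<theta>] by (intro sum.cong) auto
    finally show ?thesis .
  qed
  have "\<phi> X N \<cdot> (idm C X \<unrhd> inc l) = \<psi> X N \<cdot> (idm C X \<unrhd> inc l)" if l: "l < n" for l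
    using nat[OF D'(2)[OF l]] on_simple[OF D'(1)[OF l]] by simp
  then have "(\<Sum>l<n. (\<phi> X N \<cdot> (idm C X \<unrhd> inc l)) \<cdot> (idm C X \<unrhd> prj l))
      = (\<Sum>l<n. (\<psi> X N \<cdot> (idm C X \<unrhd> inc l)) \<cdot> (idm C X \<unrhd> prj l))"
    by simp
  then show "\<phi> X N = \<psi> X N"
    using expand[OF types(1)] expand[OF types(2)] by simp
qed

lemma double_dual_identification_eq_double_dual: "double_dual_identification C M I S = double_dual"
  unfolding double_dual_identification_def
  using double_dual_is_identification identification_unique by blast

section \<open>Module traces and matched pivotal structures\<close>

lemma weighted_trace_eq_wtrace: "weighted_trace M I S m N f = M.wtrace m N f"
  unfolding weighted_trace_def M.wtrace_def ..

text \<open>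
  The equation to which both sides of the equivalence reduce. On the component \<open>Hom(S i, X \<rhd> S j)\<close> it says that
  \<open>m i\<close> times the action of \<open>a X\<close> is \<open>m j\<close> times the canonical identification.
\<close>

definition intertwines :: "('o \<Rightarrow> 'a) \<Rightarrow> ('i \<Rightarrow> 'k) \<Rightarrow> bool" where
  "intertwines a m \<longleftrightarrow>
     (\<forall>X N. (a X \<unrhd> idm M N) \<cdot> M.scaling m (X \<rhd> N) = double_dual X N \<cdot> (idm C X \<unrhd> M.scaling m N))"

lemma module_trace_difference:
  assumes "is_module_trace C M I S a m" "is_module_trace C M I S a m'"
  shows "is_module_trace C M I S a (\<lambda>i. m' i - c * m i)"
proof -
  have "weighted_trace M I S (\<lambda>i. m' i - c * m i) N f
      = weighted_trace M I S m' N f - c * weighted_trace M I S m N f" for N f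
    unfolding weighted_trace_def by (simp add: algebra_simps sum_subtractf sum_distrib_left)
  then show ?thesis
    using assms unfolding is_module_trace_def by simp
qed

text \<open>
  The structure \<open>s\<close> is the trivial structure of the identity functor, conjugated by the natural automorphism
  \<open>scaling m\<close>. Therefore it satisfies the axioms of a module functor.
\<close>

lemma identity_with_structure_is_module_functor:
  assumes m: "\<And>i. i \<in> I \<Longrightarrow> m i \<noteq> 0"
    and s: "\<And>X N. s X N = (idm C X \<unrhd> M.scaling m N) \<cdot> M.scaling (\<lambda>i. inverse (m i)) (X \<rhd> N)"
  shows "is_module_functor C M \<lparr>fob = (\<lambda>N. N), far = (\<lambda>h. h), fstr = s\<rparr>"
proof -
  let ?u = "M.scaling m" and ?v = "M.scaling (\<lambda>i. inverse (m i))"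
  have inv: "inverses M N N (?u N) (?v N)" for N
    using m by (rule M.inverses_scaling)
  have vu: "?v N \<cdot> ?u N = idm M N" and uv: "?u N \<cdot> ?v N = idm M N" for N
    using inv[of N] by (auto simp: inverses_def)
  have iso: "is_iso M N N (?u N)" "is_iso M N N (?v N)" for N
    using inv[of N] unfolding is_iso_def inverses_def by blast+
  have u_in: "?u N \<in> Hom M N N" for N
    by (rule M.scaling_in)
  note types = M.scaling_in arrow_types
  have s_iso: "is_iso M (X \<rhd> N) (X \<rhd> N) (s X N)" for X N
    unfolding s by (rule M.is_iso_cmp[OF iso(2) is_iso_act[OF C.is_iso_id iso(1)]])
  have s_natural: "s X' N' \<cdot> (f \<unrhd> h) = (f \<unrhd> h) \<cdot> s X N"
    if f: "f \<in> Hom C X X'" and h: "h \<in> Hom M N N'" for X X' N N' f h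
  proof -
    note types' = f h types
    have "s X' N' \<cdot> (f \<unrhd> h) = (idm C X' \<unrhd> ?u N') \<cdot> ?v (X' \<rhd> N') \<cdot> (f \<unrhd> h)"
      unfolding s by (rule M.cmp_assoc, (rule types')+)
    also have "\<dots> = (idm C X' \<unrhd> ?u N') \<cdot> (f \<unrhd> h) \<cdot> ?v (X \<rhd> N)"
      by (simp add: M.scaling_natural[OF actm_in[OF f h]])
    also have "\<dots> = (f \<unrhd> h) \<cdot> (idm C X \<unrhd> ?u N) \<cdot> ?v (X \<rhd> N)"
    proof (rule M.extend_square)
      show "(idm C X' \<unrhd> ?u N') \<cdot> (f \<unrhd> h) = (f \<unrhd> h) \<cdot> (idm C X \<unrhd> ?u N)"
        using actm_cmp[OF f C.id_in h u_in] actm_cmp[OF C.id_in f u_in h]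
          C.id_left[OF f] C.id_right[OF f] M.scaling_natural[OF h] by simp
    qed (rule types')+
    finally show ?thesis unfolding s .
  qed
  have s_mas: "mas M X Y N \<cdot> s (X \<otimes>\<^bsub>C\<^esub> Y) N = (idm C X \<unrhd> s Y N) \<cdot> s X (Y \<rhd> N) \<cdot> mas M X Y N"
    for X Y N
  proof -
    have "mas M X Y N \<cdot> s (X \<otimes>\<^bsub>C\<^esub> Y) N
        = (idm C X \<unrhd> (idm C Y \<unrhd> ?u N)) \<cdot> mas M X Y N \<cdot> ?v ((X \<otimes>\<^bsub>C\<^esub> Y) \<rhd> N)"
      unfolding s by (rule M.extend_square[OF mas_natural_object[OF M.scaling_in]], (rule types)+)
    also have "\<dots> = (idm C X \<unrhd> (idm C Y \<unrhd> ?u N)) \<cdot> ?v (X \<rhd> (Y \<rhd> N)) \<cdot> mas M X Y N"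
      by (simp add: M.scaling_natural[OF M.is_iso_in[OF mas_iso]])
    finally have left: "mas M X Y N \<cdot> s (X \<otimes>\<^bsub>C\<^esub> Y) N
        = (idm C X \<unrhd> (idm C Y \<unrhd> ?u N)) \<cdot> ?v (X \<rhd> (Y \<rhd> N)) \<cdot> mas M X Y N" .
    have "(idm C X \<unrhd> s Y N) \<cdot> s X (Y \<rhd> N) \<cdot> mas M X Y N
        = (idm C X \<unrhd> (idm C Y \<unrhd> ?u N)) \<cdot> (idm C X \<unrhd> ?v (Y \<rhd> N))
          \<cdot> (idm C X \<unrhd> ?u (Y \<rhd> N)) \<cdot> ?v (X \<rhd> (Y \<rhd> N)) \<cdot> mas M X Y N"
      unfolding s by (subst act_cmp_right, (rule types)+, (subst M.cmp_assoc, (rule types)+)+) (rule refl)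
    also have "(idm C X \<unrhd> ?v (Y \<rhd> N)) \<cdot> (idm C X \<unrhd> ?u (Y \<rhd> N)) \<cdot> ?v (X \<rhd> (Y \<rhd> N)) \<cdot> mas M X Y N
        = ((idm C X \<unrhd> ?v (Y \<rhd> N)) \<cdot> (idm C X \<unrhd> ?u (Y \<rhd> N))) \<cdot> ?v (X \<rhd> (Y \<rhd> N)) \<cdot> mas M X Y N"
      by (rule M.cmp_assoc[symmetric], (rule types)+)
    also have "(idm C X \<unrhd> ?v (Y \<rhd> N)) \<cdot> (idm C X \<unrhd> ?u (Y \<rhd> N)) = idm M (X \<rhd> (Y \<rhd> N))"
      unfolding act_cmp_right[OF M.scaling_in M.scaling_in, symmetric] vu actm_id ..
    also have "idm M (X \<rhd> (Y \<rhd> N)) \<cdot> ?v (X \<rhd> (Y \<rhd> N)) \<cdot> mas M X Y N = ?v (X \<rhd> (Y \<rhd> N)) \<cdot> mas M X Y N"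
      by (rule M.id_left, (rule types)+)
    finally show ?thesis using left by simp
  qed
  have s_mun: "mun M N \<cdot> s \<one>\<^bsub>C\<^esub> N = mun M N" for N
  proof -
    note mun = M.is_iso_in[OF mun_iso[of N]]
    have "mun M N \<cdot> s \<one>\<^bsub>C\<^esub> N = ?u N \<cdot> mun M N \<cdot> ?v (\<one>\<^bsub>C\<^esub> \<rhd> N)"
      unfolding s by (rule M.extend_square[OF mun_natural[OF M.scaling_in]], (rule types)+)
    also have "\<dots> = (?u N \<cdot> ?v N) \<cdot> mun M N"
      using M.scaling_natural[OF mun] M.cmp_assoc[OF mun M.scaling_in M.scaling_in] by simp
    finally show ?thesis by (simp add: uv M.id_left[OF mun])
  qed
  show ?thesis
    unfolding is_module_functor_def using s_iso s_natural s_mas s_mun by simp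
qed

lemma identity_module_functor_is_module_functor: "is_module_functor C M (identity_module_functor M)"
  unfolding identity_module_functor_def
proof (rule identity_with_structure_is_module_functor[where m = "\<lambda>_. 1"])
  show "idm M (X \<rhd> N) = (idm C X \<unrhd> M.scaling (\<lambda>_. 1) N) \<cdot> M.scaling (\<lambda>i. inverse 1) (X \<rhd> N)" for X N
    by (simp add: M.scaling_one actm_id M.id_left[OF M.id_in])
qed simp

context
  fixes a :: "'o \<Rightarrow> 'a"
  assumes a_iso: "\<And>X. is_iso C X (ddual C X) (a X)"
begin

abbreviation a_inv :: "'o \<Rightarrow> 'a" where
  "a_inv X \<equiv> inv_arr C X (ddual C X) (a X)"

lemma a_act_in: "a X \<unrhd> idm M N \<in> Hom M (X \<rhd> N) (ddual C X \<rhd> N)"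
  by (rule actm_in[OF C.is_iso_in[OF a_iso] M.id_in])

lemma a_inv_act_in: "a_inv X \<unrhd> idm M N \<in> Hom M (ddual C X \<rhd> N) (X \<rhd> N)"
  by (rule actm_in[OF C.inv_arr_in[OF a_iso] M.id_in])

lemma a_act_inverse:
  "(a X \<unrhd> idm M N) \<cdot> (a_inv X \<unrhd> idm M N) = idm M (ddual C X \<rhd> N)"
  "(a_inv X \<unrhd> idm M N) \<cdot> (a X \<unrhd> idm M N) = idm M (X \<rhd> N)"
  using act_cmp_left[OF C.inv_arr_in[OF a_iso] C.is_iso_in[OF a_iso], of X N]
    act_cmp_left[OF C.is_iso_in[OF a_iso] C.inv_arr_in[OF a_iso], of X N]
  by (simp_all add: C.inv_arr_left[OF a_iso] C.inv_arr_right[OF a_iso] actm_id)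

lemma is_iso_a_act: "is_iso M (X \<rhd> N) (ddual C X \<rhd> N) (a X \<unrhd> idm M N)"
  unfolding is_iso_def inverses_def using a_act_in a_inv_act_in a_act_inverse by blast

lemma partial_trace_eq_close:
  assumes f: "f \<in> Hom M (X \<rhd> N) (X \<rhd> N)"
  shows "partial_trace C M a X N f = close X N N (f \<cdot> (a_inv X \<unrhd> idm M N))"
proof -
  note types = f a_inv_act_in act_ev_in ddual_coev_in actm_in C.id_in M.cmp_in
  show ?thesis
    unfolding partial_trace_def close_def
    by (subst act_cmp_right, (rule types)+, (subst M.cmp_assoc, (rule types)+)+) (rule refl)
qed

text \<open>
  The weight moves under the closed strand by naturality of \<open>close\<close>, the closure is replaced by a pairing with
  \<open>double_dual\<close>, and the inverse of \<open>a\<close> is moved to the front by cyclicity.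
\<close>

lemma wtrace_partial_trace:
  assumes f: "f \<in> Hom M (X \<rhd> N) (X \<rhd> N)"
  shows "M.wtrace m N (partial_trace C M a X N f)
    = M.tr (X \<rhd> N) (((a_inv X \<unrhd> idm M N) \<cdot> double_dual X N \<cdot> (idm C X \<unrhd> M.scaling m N)) \<cdot> f)"
proof -
  let ?a = "a_inv X \<unrhd> idm M N" and ?m = "idm C X \<unrhd> M.scaling m N"
  note types = f a_inv_act_in double_dual_in actm_in[OF C.id_in M.scaling_in] M.cmp_in
  have fa: "f \<cdot> ?a \<in> Hom M (ddual C X \<rhd> N) (X \<rhd> N)"
    by (rule types)+
  have "M.wtrace m N (partial_trace C M a X N f) = M.tr N (M.scaling m N \<cdot> close X N N (f \<cdot> ?a))"
    using M.wtrace_eq_tr_scaling[OF close_in[OF fa]] partial_trace_eq_close[OF f] by simp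
  also have "\<dots> = M.tr (ddual C X \<rhd> N) (double_dual X N \<cdot> ?m \<cdot> f \<cdot> ?a)"
    using close_left[OF M.scaling_in fa] tr_double_dual[OF M.cmp_in[OF fa actm_in[OF C.id_in M.scaling_in]]] by simp
  also have "double_dual X N \<cdot> ?m \<cdot> f \<cdot> ?a = (double_dual X N \<cdot> ?m \<cdot> f) \<cdot> ?a"
    by ((subst M.cmp_assoc, (rule types)+)+) (rule refl)
  also have "M.tr (ddual C X \<rhd> N) \<dots> = M.tr (X \<rhd> N) (?a \<cdot> double_dual X N \<cdot> ?m \<cdot> f)"
    by (rule M.wtrace_cyclic) (rule types)+
  also have "?a \<cdot> double_dual X N \<cdot> ?m \<cdot> f = (?a \<cdot> double_dual X N \<cdot> ?m) \<cdot> f"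
    by ((subst M.cmp_assoc, (rule types)+)+) (rule refl)
  finally show ?thesis .
qed

lemma module_trace_iff_intertwines:
  "is_module_trace C M I S a m \<longleftrightarrow> intertwines a m"
proof -
  have "(\<forall>f\<in>Hom M (X \<rhd> N) (X \<rhd> N).
            weighted_trace M I S m (X \<rhd> N) f = weighted_trace M I S m N (partial_trace C M a X N f))
      \<longleftrightarrow> (a X \<unrhd> idm M N) \<cdot> M.scaling m (X \<rhd> N) = double_dual X N \<cdot> (idm C X \<unrhd> M.scaling m N)"
    (is "?T \<longleftrightarrow> ?E") for X N
  proof -
    let ?b = "a_inv X \<unrhd> idm M N" and ?d = "double_dual X N \<cdot> (idm C X \<unrhd> M.scaling m N)"
    have d: "?d \<in> Hom M (X \<rhd> N) (ddual C X \<rhd> N)"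
      by (rule M.cmp_in[OF actm_in[OF C.id_in M.scaling_in] double_dual_in])
    note bd = M.cmp_in[OF d a_inv_act_in]
    have "?T \<longleftrightarrow> (\<forall>f\<in>Hom M (X \<rhd> N) (X \<rhd> N).
        M.tr (X \<rhd> N) (M.scaling m (X \<rhd> N) \<cdot> f) = M.tr (X \<rhd> N) ((?b \<cdot> ?d) \<cdot> f))"
      by (simp add: weighted_trace_eq_wtrace wtrace_partial_trace M.wtrace_eq_tr_scaling cong: ball_cong)
    also have "\<dots> \<longleftrightarrow> M.scaling m (X \<rhd> N) = ?b \<cdot> ?d"
      using M.tr_eqI[OF M.scaling_in bd] by auto
    also have "\<dots> \<longleftrightarrow> ?E"
    proof
      assume "M.scaling m (X \<rhd> N) = ?b \<cdot> ?d"
      then show ?E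
        using M.cmp_assoc[OF d a_inv_act_in a_act_in] by (simp add: a_act_inverse M.id_left[OF d])
    next
      assume E: ?E
      have "?b \<cdot> (a X \<unrhd> idm M N) \<cdot> M.scaling m (X \<rhd> N) = M.scaling m (X \<rhd> N)"
        using M.cmp_assoc[OF M.scaling_in a_act_in a_inv_act_in] by (simp add: a_act_inverse M.id_left[OF M.scaling_in])
      then show "M.scaling m (X \<rhd> N) = ?b \<cdot> ?d"
        using E by simp
    qed
    finally show ?thesis .
  qed
  then show ?thesis
    unfolding is_module_trace_def intertwines_def by simp
qed

lemma double_dual_inv_a:
  defines "s \<equiv> \<lambda>X N. inv_arr M (X \<rhd> N) (ddual C X \<rhd> N) (double_dual X N) \<cdot> (a X \<unrhd> idm M N)"
  shows "s X N \<in> Hom M (X \<rhd> N) (X \<rhd> N)" and "double_dual X N \<cdot> s X N = a X \<unrhd> idm M N"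
  unfolding s_def
  using M.cmp_in[OF a_act_in M.inv_arr_in[OF is_iso_double_dual]]
    M.cmp_assoc[OF a_act_in M.inv_arr_in[OF is_iso_double_dual] double_dual_in]
    M.inv_arr_right[OF is_iso_double_dual] M.id_left[OF a_act_in] by simp_all

text \<open>
  The weights \<open>m\<close> and the isomorphism \<open>\<eta>\<close> from \<open>\<chi>(a,M)\<close> to the identity functor are inverse to each other,
  \<open>\<eta> = (scaling m)\<inverse>\<close>.
\<close>

lemma matched_iff_intertwines:
  "matched C M I S a \<longleftrightarrow> (\<exists>m. (\<forall>i\<in>I. m i \<noteq> 0) \<and> intertwines a m)"
proof
  let ?s = "\<lambda>X N. inv_arr M (X \<rhd> N) (ddual C X \<rhd> N) (double_dual X N) \<cdot> (a X \<unrhd> idm M N)"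
  have chi: "chi C M I S a = \<lparr>fob = (\<lambda>N. N), far = (\<lambda>h. h), fstr = ?s\<rparr>"
    unfolding chi_def double_dual_identification_eq_double_dual ..
  {
    assume "matched C M I S a"
    then obtain \<eta> where "\<forall>N. is_iso M N N (\<eta> N)"
      and natural: "\<forall>N N'. \<forall>h\<in>Hom M N N'. \<eta> N' \<cdot> h = h \<cdot> \<eta> N"
      and str: "\<forall>X N. idm M (X \<rhd> N) \<cdot> \<eta> (X \<rhd> N) = (idm C X \<unrhd> \<eta> N) \<cdot> ?s X N"
      unfolding matched_def module_functors_isomorphic_def chi identity_module_functor_def by auto
    then have iso: "is_iso M N N (\<eta> N)" for N
      by simp
    note \<eta>_in = M.is_iso_in[OF iso]
    have \<eta>: "M.natural_endo \<eta>"
      unfolding M.natural_endo_def using \<eta>_in natural by blast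
    define r where "r i = M.sc i (\<eta> (S i))" for i
    have \<eta>_scaling: "\<eta> N = M.scaling r N" for N
      using M.natural_endo_is_scaling[OF \<eta>] unfolding r_def .
    have r: "r i \<noteq> 0" if i: "i \<in> I" for i
    proof
      assume "r i = 0"
      then have "\<eta> (S i) = 0" using i by (simp add: \<eta>_scaling M.scaling_S)
      then have "idm M (S i) = 0"
        using M.inv_arr_left[OF iso[of "S i"]] M.cmp_zero_right[OF M.inv_arr_in[OF iso[of "S i"]]] by simp
      then show False
        using M.id_nonzero_if_simple[OF M.simple_S[OF i]] by simp
    qed
    let ?m = "\<lambda>i. inverse (r i)"
    have inv: "M.scaling ?m N \<cdot> \<eta> N = idm M N" "\<eta> N \<cdot> M.scaling ?m N = idm M N" for N
      using M.inverses_scaling[of r N] r unfolding \<eta>_scaling inverses_def by auto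
    have "intertwines a ?m"
      unfolding intertwines_def
    proof (intro allI)
      fix X N
      let ?i = "idm C X \<unrhd> \<eta> N" and ?j = "idm C X \<unrhd> M.scaling ?m N"
      note types = double_dual_in double_dual_inv_a(1) \<eta>_in M.scaling_in actm_in C.id_in M.cmp_in
      note i_in = actm_in[OF C.id_in[of X] \<eta>_in[of N]] and j_in = actm_in[OF C.id_in[of X] M.scaling_in[of ?m N]]
      have ji: "?j \<cdot> ?i = idm M (X \<rhd> N)"
        unfolding act_cmp_right[OF \<eta>_in[of N] M.scaling_in, symmetric] inv actm_id ..
      have "?s X N \<cdot> M.scaling ?m (X \<rhd> N) = (?j \<cdot> ?i) \<cdot> ?s X N \<cdot> M.scaling ?m (X \<rhd> N)"
        unfolding ji by (rule M.id_left[OF M.cmp_in[OF M.scaling_in double_dual_inv_a(1)], symmetric])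
      also have "\<dots> = ?j \<cdot> ((?i \<cdot> ?s X N) \<cdot> M.scaling ?m (X \<rhd> N))"
        using M.cmp_assoc[OF M.cmp_in[OF M.scaling_in double_dual_inv_a(1)] i_in j_in]
          M.cmp_assoc[OF M.scaling_in double_dual_inv_a(1) i_in] by simp
      also have "?i \<cdot> ?s X N = \<eta> (X \<rhd> N)"
        using str[rule_format, of X N] M.id_left[OF \<eta>_in] by simp
      also have "\<eta> (X \<rhd> N) \<cdot> M.scaling ?m (X \<rhd> N) = idm M (X \<rhd> N)"
        by (rule inv)
      also have "?j \<cdot> idm M (X \<rhd> N) = ?j"
        by (rule M.id_right[OF j_in])
      finally have "double_dual X N \<cdot> ?s X N \<cdot> M.scaling ?m (X \<rhd> N) = double_dual X N \<cdot> ?j"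
        by simp
      then show "(a X \<unrhd> idm M N) \<cdot> M.scaling ?m (X \<rhd> N) = double_dual X N \<cdot> ?j"
        using M.cmp_assoc[OF M.scaling_in double_dual_inv_a(1) double_dual_in] by (simp add: double_dual_inv_a(2))
    qed
    with r show "\<exists>m. (\<forall>i\<in>I. m i \<noteq> 0) \<and> intertwines a m"
      by (intro exI[of _ ?m]) simp
  }
  {
    assume "\<exists>m. (\<forall>i\<in>I. m i \<noteq> 0) \<and> intertwines a m"
    then obtain m where m: "\<And>i. i \<in> I \<Longrightarrow> m i \<noteq> 0"
      and eq: "\<And>X N. (a X \<unrhd> idm M N) \<cdot> M.scaling m (X \<rhd> N) = double_dual X N \<cdot> (idm C X \<unrhd> M.scaling m N)"
      unfolding intertwines_def by blast
    let ?\<eta> = "M.scaling (\<lambda>i. inverse (m i))"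
    have inv: "?\<eta> N \<cdot> M.scaling m N = idm M N" "M.scaling m N \<cdot> ?\<eta> N = idm M N" for N
      using M.inverses_scaling[of m N, OF m] by (auto simp: inverses_def)
    have s: "?s X N = (idm C X \<unrhd> M.scaling m N) \<cdot> ?\<eta> (X \<rhd> N)" for X N
    proof -
      let ?j = "idm C X \<unrhd> M.scaling m N"
      note j_in = actm_in[OF C.id_in[of X] M.scaling_in[of m N]]
      have "double_dual X N \<cdot> ?s X N \<cdot> M.scaling m (X \<rhd> N) = double_dual X N \<cdot> ?j"
        using M.cmp_assoc[OF M.scaling_in double_dual_inv_a(1) double_dual_in] eq[of X N] by (simp add: double_dual_inv_a(2))
      then have j: "?s X N \<cdot> M.scaling m (X \<rhd> N) = ?j"
        by (rule M.cancel_iso_left[OF is_iso_double_dual M.cmp_in[OF M.scaling_in double_dual_inv_a(1)] j_in])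
      have "?j \<cdot> ?\<eta> (X \<rhd> N) = ?s X N \<cdot> M.scaling m (X \<rhd> N) \<cdot> ?\<eta> (X \<rhd> N)"
        unfolding j[symmetric] by (rule M.cmp_assoc[OF M.scaling_in M.scaling_in double_dual_inv_a(1)])
      then show ?thesis
        by (simp add: inv M.id_right[OF double_dual_inv_a(1)])
    qed
    have chi_functor: "is_module_functor C M (chi C M I S a)"
      unfolding chi by (rule identity_with_structure_is_module_functor[OF m s])
    have str: "idm M (X \<rhd> N) \<cdot> ?\<eta> (X \<rhd> N) = (idm C X \<unrhd> ?\<eta> N) \<cdot> ?s X N" for X N
    proof -
      have "(idm C X \<unrhd> ?\<eta> N) \<cdot> ?s X N = ((idm C X \<unrhd> ?\<eta> N) \<cdot> (idm C X \<unrhd> M.scaling m N)) \<cdot> ?\<eta> (X \<rhd> N)"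
        unfolding s by (rule M.cmp_assoc[symmetric, OF M.scaling_in actm_in[OF C.id_in M.scaling_in] actm_in[OF C.id_in M.scaling_in]])
      also have "(idm C X \<unrhd> ?\<eta> N) \<cdot> (idm C X \<unrhd> M.scaling m N) = idm M (X \<rhd> N)"
        unfolding act_cmp_right[OF M.scaling_in M.scaling_in, symmetric] inv actm_id ..
      finally show ?thesis by simp
    qed
    have iso: "is_iso M N N (?\<eta> N)" for N
      unfolding is_iso_def inverses_def using inv M.scaling_in by blast
    show "matched C M I S a"
      unfolding matched_def module_functors_isomorphic_def
    proof (intro conjI chi_functor identity_module_functor_is_module_functor exI[of _ ?\<eta>])
      show "\<forall>N. is_iso M (fob (chi C M I S a) N) (fob (identity_module_functor M) N) (?\<eta> N)"
        using iso by (simp add: chi identity_module_functor_def)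
      show "\<forall>N N'. \<forall>h\<in>Hom M N N'.
          ?\<eta> N' \<cdot> far (chi C M I S a) h = far (identity_module_functor M) h \<cdot> ?\<eta> N"
        using M.scaling_natural by (simp add: chi identity_module_functor_def)
      show "\<forall>X N. fstr (identity_module_functor M) X N \<cdot> ?\<eta> (X \<rhd> N)
          = (idm C X \<unrhd> ?\<eta> N) \<cdot> fstr (chi C M I S a) X N"
        using str by (simp add: chi identity_module_functor_def)
    qed
  }
qed

text \<open>
  Suppose that \<open>m\<close> has a zero as well as a nonzero value. Let \<open>P\<close> be the objects on which \<open>scaling m\<close> is
  invertible and \<open>Q\<close> those on which it is zero. The equation \<open>intertwines\<close> makes both stable under the action,
  naturality of \<open>scaling m\<close> leaves no nonzero morphisms between them, and every object splits into a part of
  each kind by the idempotent \<open>e\<close> that projects to the summands with nonzero weight.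
\<close>

lemma intertwines_nonvanishing:
  assumes indecomposable: "indecomposable_module M" and m: "intertwines a m"
    and i: "i \<in> I" "m i \<noteq> 0" and j: "j \<in> I"
  shows "m j \<noteq> 0"
proof
  assume "m j = 0"
  let ?u = "M.scaling m"
  define P where "P N \<longleftrightarrow> is_iso M N N (?u N)" for N
  define Q where "Q N \<longleftrightarrow> ?u N = 0" for N
  define e where "e = M.scaling (\<lambda>i. if m i = 0 then 0 else 1)"
  have not_zero: "\<not> is_zero_obj M (S k)" if "k \<in> I" for k
    using M.simple_S[OF that] unfolding is_simple_def by blast
  have eq: "(a X \<unrhd> idm M N) \<cdot> ?u (X \<rhd> N) = double_dual X N \<cdot> (idm C X \<unrhd> ?u N)" for X N
    using m unfolding intertwines_def by blast
  have "P (S i)"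
  proof -
    have "inverses M (S i) (S i) (scl M (m i) (idm M (S i))) (scl M (inverse (m i)) (idm M (S i)))"
      unfolding inverses_def
      using M.scl_in[OF M.id_in] M.cmp_scl_left[OF M.scl_in[OF M.id_in] M.id_in] M.id_left[OF M.id_in]
        M.id_left[OF M.scl_in[OF M.id_in]] i by simp
    then show ?thesis unfolding P_def is_iso_def using M.scaling_S[OF i(1)] by auto
  qed
  moreover have "Q (S j)"
    unfolding Q_def using M.scaling_S[OF j] \<open>m j = 0\<close> by simp
  moreover have "P (X \<rhd> N)" if "P N" for X N
  proof -
    have "is_iso M (X \<rhd> N) (ddual C X \<rhd> N) ((a X \<unrhd> idm M N) \<cdot> ?u (X \<rhd> N))"
      unfolding eq using that unfolding P_def
      by (intro M.is_iso_cmp[OF is_iso_act[OF C.is_iso_id] is_iso_double_dual])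
    from M.is_iso_cmp[OF this M.is_iso_inv_arr[OF is_iso_a_act]]
    have "is_iso M (X \<rhd> N) (X \<rhd> N)
        (inv_arr M (X \<rhd> N) (ddual C X \<rhd> N) (a X \<unrhd> idm M N) \<cdot> (a X \<unrhd> idm M N) \<cdot> ?u (X \<rhd> N))" .
    then show ?thesis
      unfolding P_def
      using M.cmp_assoc[OF M.scaling_in a_act_in M.inv_arr_in[OF is_iso_a_act]]
        M.inv_arr_left[OF is_iso_a_act] M.id_left[OF M.scaling_in] by simp
  qed
  moreover have "Q (X \<rhd> N)" if "Q N" for X N
    unfolding Q_def
  proof (rule M.cancel_iso_left[OF is_iso_a_act M.scaling_in M.zero_in])
    show "(a X \<unrhd> idm M N) \<cdot> ?u (X \<rhd> N) = (a X \<unrhd> idm M N) \<cdot> 0"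
      using eq[of X N] that M.cmp_zero_right[OF double_dual_in] M.cmp_zero_right[OF a_act_in]
      by (simp add: Q_def act_zero)
  qed
  moreover have "Hom M N L = {0}" "Hom M L N = {0}" if P: "P N" and Q: "Q L" for N L
  proof -
    have "h = 0" if h: "h \<in> Hom M N L" for h
    proof (rule M.cancel_iso_right[OF P[unfolded P_def] h M.zero_in])
      show "h \<cdot> ?u N = 0 \<cdot> ?u N"
        using M.scaling_natural[OF h, of m] Q M.cmp_zero_left[OF h] M.cmp_zero_left[OF M.scaling_in] by (simp add: Q_def)
    qed
    then show "Hom M N L = {0}" using M.zero_in by blast
    have "h = 0" if h: "h \<in> Hom M L N" for h
    proof (rule M.cancel_iso_left[OF P[unfolded P_def] h M.zero_in])
      show "?u N \<cdot> h = ?u N \<cdot> 0"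
        using M.scaling_natural[OF h, of m] Q M.cmp_zero_right[OF h] M.cmp_zero_right[OF M.scaling_in] by (simp add: Q_def)
    qed
    then show "Hom M L N = {0}" using M.zero_in by blast
  qed
  moreover have "\<exists>N1 N2. P N1 \<and> Q N2 \<and> is_direct_sum M N 2 (\<lambda>j. if j = 0 then N1 else N2)" for N
  proof -
    have e_in: "e L \<in> Hom M L L" for L
      unfolding e_def by (rule M.scaling_in)
    have e_natural: "e L' \<cdot> h = h \<cdot> e L" if "h \<in> Hom M L L'" for L L' h
      unfolding e_def using that by (rule M.scaling_natural)
    have ee: "e L \<cdot> e L = e L" for L
      unfolding e_def M.scaling_mult by (rule M.scaling_cong) simp
    let ?f = "idm M N - e N"
    note f_in = M.diff_in[OF M.id_in e_in, of N]
    have ef: "e N \<cdot> ?f = 0"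
      using M.cmp_diff_right[OF M.id_in e_in e_in] M.id_right[OF e_in] ee by simp
    have ff: "?f \<cdot> ?f = ?f"
      using M.cmp_diff_left[OF f_in M.id_in e_in] M.id_left[OF f_in] ef by simp
    obtain N1 k1 r1 where 1: "k1 \<in> Hom M N1 N" "r1 \<in> Hom M N N1" "r1 \<cdot> k1 = idm M N1" "k1 \<cdot> r1 = e N"
      using M.idempotent_splits[OF e_in ee] .
    obtain N2 k2 r2 where 2: "k2 \<in> Hom M N2 N" "r2 \<in> Hom M N N2" "r2 \<cdot> k2 = idm M N2" "k2 \<cdot> r2 = ?f"
      using M.idempotent_splits[OF f_in ff] .
    have ek1: "e N \<cdot> k1 = k1"
      using M.cmp_assoc[OF 1(1,2,1)] 1 M.id_right[OF 1(1)] by simp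
    have fk2: "?f \<cdot> k2 = k2"
      using M.cmp_assoc[OF 2(1,2,1)] 2 M.id_right[OF 2(1)] by simp
    have ek2: "e N \<cdot> k2 = 0"
      using M.cmp_diff_left[OF 2(1) M.id_in e_in] M.id_left[OF 2(1)] fk2 by simp
    have fk1: "?f \<cdot> k1 = 0"
      using M.cmp_diff_left[OF 1(1) M.id_in e_in] M.id_left[OF 1(1)] ek1 by simp
    have e1: "e N1 = idm M N1"
      using M.cmp_assoc[OF e_in 1(1,2)] e_natural[OF 1(1)] ek1 1(3) M.id_left[OF e_in] by simp
    have e2: "e N2 = 0"
      using M.cmp_assoc[OF e_in 2(1,2)] e_natural[OF 2(1)] ek2 2(3) M.id_left[OF e_in]
        M.cmp_zero_right[OF 2(2)] by simp
    have r1k2: "r1 \<cdot> k2 = 0"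
    proof -
      have "r1 \<cdot> k2 = (r1 \<cdot> k1) \<cdot> r1 \<cdot> k2"
        using M.id_left[OF M.cmp_in[OF 2(1) 1(2)]] 1(3) by simp
      also have "\<dots> = r1 \<cdot> (k1 \<cdot> r1) \<cdot> k2"
        using M.cmp_assoc[OF M.cmp_in[OF 2(1) 1(2)] 1(1,2)] M.cmp_assoc[OF 2(1) 1(2,1)] by simp
      finally show ?thesis
        using 1(4) ek2 M.cmp_zero_right[OF 1(2)] by simp
    qed
    have r2k1: "r2 \<cdot> k1 = 0"
    proof -
      have "r2 \<cdot> k1 = (r2 \<cdot> k2) \<cdot> r2 \<cdot> k1"
        using M.id_left[OF M.cmp_in[OF 1(1) 2(2)]] 2(3) by simp
      also have "\<dots> = r2 \<cdot> (k2 \<cdot> r2) \<cdot> k1"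
        using M.cmp_assoc[OF M.cmp_in[OF 1(1) 2(2)] 2(1,2)] M.cmp_assoc[OF 1(1) 2(2,1)] by simp
      finally show ?thesis
        using 2(4) fk1 M.cmp_zero_right[OF 2(2)] by simp
    qed
    have "P N1"
    proof -
      \<comment> \<open>As \<open>inverse 0 = 0\<close>, the weights \<open>inverse (m i) * m i\<close> are those of \<open>e\<close>.\<close>
      let ?v = "M.scaling (\<lambda>i. inverse (m i)) N1"
      have "?v \<cdot> ?u N1 = e N1" "?u N1 \<cdot> ?v = e N1"
        unfolding e_def M.scaling_mult by (intro M.scaling_cong; simp)+
      then show ?thesis
        unfolding P_def is_iso_def inverses_def e1 using M.scaling_in by blast
    qed
    moreover have "Q N2"
    proof -
      have "?u N2 = ?u N2 \<cdot> e N2"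
        unfolding e_def M.scaling_mult by (intro M.scaling_cong) simp
      then show ?thesis
        unfolding Q_def e2 using M.cmp_zero_right[OF M.scaling_in] by simp
    qed
    moreover have "direct_sum M N 2 (\<lambda>j. if j = 0 then N1 else N2)
        (\<lambda>j. if j = 0 then k1 else k2) (\<lambda>j. if j = 0 then r1 else r2)"
      unfolding direct_sum_def
      using 1 2 r1k2 r2k1 by (auto simp: less_2_cases_iff numeral_2_eq_2)
    ultimately show ?thesis
      unfolding is_direct_sum_def by blast
  qed
  ultimately have "(\<exists>N. P N \<and> \<not> is_zero_obj M N) \<and> (\<exists>N. Q N \<and> \<not> is_zero_obj M N) \<and>
      (\<forall>X N. P N \<longrightarrow> P (X \<rhd> N)) \<and> (\<forall>X N. Q N \<longrightarrow> Q (X \<rhd> N)) \<and>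
      (\<forall>N L. P N \<and> Q L \<longrightarrow> Hom M N L = {0} \<and> Hom M L N = {0}) \<and>
      (\<forall>N. \<exists>N1 N2. P N1 \<and> Q N2 \<and> is_direct_sum M N 2 (\<lambda>j. if j = 0 then N1 else N2))"
    using not_zero[OF i(1)] not_zero[OF j] by (intro conjI allI impI) auto
  then show False
    using indecomposable unfolding indecomposable_module_def by blast
qed

end

end

theorem proposition2p4:
  fixes C :: "('k::alg_closed_field, 'o, 'a::ab_group_add) tensor_cat"
    and M :: "('k, 'o, 'a, 'p, 'b::ab_group_add) mod_cat"
    and a :: "'o \<Rightarrow> 'a"
    and I :: "'i set"
    and S :: "'i \<Rightarrow> 'p"
  assumes "finite_tensor_category C"
    and "module_category C M"
    and "finite_semisimple_category M"
    and "indecomposable_module M"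
    and "pivotal_structure C a"
    and "simple_representatives M I S"
  shows "(matched C M I S a \<longleftrightarrow>
            (\<exists>m :: 'i \<Rightarrow> 'k. (\<exists>i\<in>I. m i \<noteq> 0) \<and> is_module_trace C M I S a m)) \<and>
         (matched C M I S a \<longrightarrow>
            (\<forall>m m' :: 'i \<Rightarrow> 'k.
               (\<exists>i\<in>I. m i \<noteq> 0) \<and> is_module_trace C M I S a m \<and>
               (\<exists>i\<in>I. m' i \<noteq> 0) \<and> is_module_trace C M I S a m' \<longrightarrow>
               (\<exists>c. c \<noteq> 0 \<and> (\<forall>i\<in>I. m' i = c * m i))))"
proof -
  interpret semisimple_module_category C M I S
    using assms(2,3,6)
    by (simp add: semisimple_module_category_def based_semisimple_category_def
        based_semisimple_category_axioms_def)
  have a_iso: "is_iso C X (ddual C X) (a X)" for X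
    using assms(5) unfolding pivotal_structure_def by blast
  note trace_iff = module_trace_iff_intertwines[OF a_iso]
  have nonvanishing: "m j \<noteq> 0"
    if "is_module_trace C M I S a m" "i \<in> I" "m i \<noteq> 0" "j \<in> I" for m i j
    using intertwines_nonvanishing[OF a_iso assms(4)] that trace_iff by blast
  obtain N where "\<not> is_zero_obj M N"
    using assms(4)[unfolded indecomposable_module_def, THEN conjunct1] by blast
  then have "I \<noteq> {}"
    by (rule M.simple_exists)
  then have "matched C M I S a \<longleftrightarrow>
      (\<exists>m :: 'i \<Rightarrow> 'k. (\<exists>i\<in>I. m i \<noteq> 0) \<and> is_module_trace C M I S a m)"
    unfolding matched_iff_intertwines[OF a_iso] using trace_iff nonvanishing by blast
  moreover have "\<exists>c. c \<noteq> 0 \<and> (\<forall>i\<in>I. m' i = c * m i)"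
    if m: "i \<in> I" "m i \<noteq> 0" "is_module_trace C M I S a m"
      and m': "i' \<in> I" "m' i' \<noteq> 0" "is_module_trace C M I S a m'" for m m' :: "'i \<Rightarrow> 'k" and i i'
  proof -
    \<comment> \<open>This \<open>c\<close> makes the module trace \<open>m' - c m\<close> vanish at \<open>i\<close>.\<close>
    let ?c = "m' i / m i"
    have "m' j - ?c * m j = 0" if "j \<in> I" for j
      using nonvanishing[OF module_trace_difference[OF m(3) m'(3), of ?c] that _ m(1)] m(2) by auto
    moreover have "?c \<noteq> 0"
      using nonvanishing[OF m'(3,1,2) m(1)] m(2) by simp
    ultimately show ?thesis by (intro exI[of _ ?c]) auto
  qed
  ultimately show ?thesis by blast
qed

end
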